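(* For every $\xi\in\mathcal E$ and every $\tau>0$ there exists $\Phi_\tau(\xi)\in\mathcal E$ which solves the equation $\Phi_\tau(\xi)=\xi-\tau(K*\xi)\cdot\nabla\Phi_\tau(\xi)$ in the sense that $$\langle\Phi_\tau(\xi),\zeta\rangle=\langle\xi,\zeta\rangle+\tau\langle(K*\xi)\cdot\nabla\zeta,\Phi_\tau(\xi)\rangle,\qquad\forall\,\zeta\in W^{1,4}(\mathbb T^2)\cap\mathcal E.$$
   Context: $\mathbb T^2=\mathbb R^2/\mathbb Z^2$; $\langle\cdot,\cdot\rangle$ is the $L^2(\mathbb T^2)$ inner product; $\mathcal E$ is the space of square integrable periodic functions on $\mathbb T^2$ with zero mean. For $\xi\in\mathcal E$, $K*\xi$ ($K$ the Biot–Savart kernel on $\mathbb T^2$) denotes the unique zero-mean divergence free vector field $u$ on $\mathbb T^2$ with $\nabla^\perp\cdot u=\partial_1u_2-\partial_2u_1=\xi$. *)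

theory Defs
  imports "HOL-Analysis.Analysis"
begin

text \<open>
  Functions on the torus are represented by everywhere defined, \<open>\<int>\<^sup>2\<close>-periodic functions on the
  plane, integrated over the unit square. Elements of the function spaces are representatives:
  nothing is identified almost everywhere.
\<close>

definition torus :: "(real^2) measure" where
  "torus = lebesgue_on (cbox 0 1)"

definition periodic :: "(real^2 \<Rightarrow> 'b) \<Rightarrow> bool" where
  "periodic f \<longleftrightarrow> (\<forall>x k. (\<forall>i. k $ i \<in> \<int>) \<longrightarrow> f (x + k) = f x)"

definition Lspace :: "real \<Rightarrow> (real^2 \<Rightarrow> 'b::euclidean_space) set" where
  "Lspace p = {f. periodic f \<and> f \<in> borel_measurable torus \<and>
                  integrable torus (\<lambda>x. norm (f x) powr p)}"

definition L2_inner :: "(real^2 \<Rightarrow> real) \<Rightarrow> (real^2 \<Rightarrow> real) \<Rightarrow> real" where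
  "L2_inner f g = (LINT x|torus. f x * g x)"

definition zero_mean :: "(real^2 \<Rightarrow> 'b::euclidean_space) \<Rightarrow> bool" where
  "zero_mean f \<longleftrightarrow> (LINT x|torus. f x) = 0"

definition E_space :: "(real^2 \<Rightarrow> real) set" where
  "E_space = {f \<in> Lspace 2. zero_mean f}"

definition grad :: "(real^2 \<Rightarrow> real) \<Rightarrow> real^2 \<Rightarrow> real^2" where
  "grad f x = (\<chi> i. frechet_derivative f (at x) (axis i 1))"

primrec C_k :: "nat \<Rightarrow> (real^2 \<Rightarrow> real) \<Rightarrow> bool" where
  "C_k 0 f \<longleftrightarrow> continuous_on UNIV f"
| "C_k (Suc n) f \<longleftrightarrow> (\<forall>x. f differentiable (at x)) \<and> (\<forall>i. C_k n (\<lambda>x. grad f x $ i))"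

definition test_fun :: "(real^2 \<Rightarrow> real) set" where
  "test_fun = {\<psi>. periodic \<psi> \<and> (\<forall>n. C_k n \<psi>)}"

definition has_weak_gradient :: "(real^2 \<Rightarrow> real) \<Rightarrow> (real^2 \<Rightarrow> real^2) \<Rightarrow> bool" where
  "has_weak_gradient f g \<longleftrightarrow> f \<in> Lspace 1 \<and> g \<in> Lspace 1 \<and>
     (\<forall>\<psi>\<in>test_fun. \<forall>i. (LINT x|torus. f x * grad \<psi> x $ i) = - (LINT x|torus. g x $ i * \<psi> x))"

text \<open>The weak gradient is unique up to null sets; an arbitrary representative is chosen.\<close>

definition weak_grad :: "(real^2 \<Rightarrow> real) \<Rightarrow> real^2 \<Rightarrow> real^2" where
  "weak_grad f = (SOME g. has_weak_gradient f g)"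

definition W1 :: "real \<Rightarrow> (real^2 \<Rightarrow> real) set" where
  "W1 p = {f \<in> Lspace p. \<exists>g\<in>Lspace p. has_weak_gradient f g}"

definition weakly_div_free :: "(real^2 \<Rightarrow> real^2) \<Rightarrow> bool" where
  "weakly_div_free u \<longleftrightarrow> (\<forall>\<psi>\<in>test_fun. (LINT x|torus. u x \<bullet> grad \<psi> x) = 0)"

definition perp :: "real^2 \<Rightarrow> real^2" where
  "perp v = vector [- v $ 2, v $ 1]"

text \<open>The equation \<open>\<partial>\<^sub>1 u\<^sub>2 - \<partial>\<^sub>2 u\<^sub>1 = \<xi>\<close> in the sense of distributions.\<close>

definition weak_curl_eq :: "(real^2 \<Rightarrow> real^2) \<Rightarrow> (real^2 \<Rightarrow> real) \<Rightarrow> bool" where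
  "weak_curl_eq u \<xi> \<longleftrightarrow>
     (\<forall>\<psi>\<in>test_fun. (LINT x|torus. u x \<bullet> perp (grad \<psi> x)) = - (LINT x|torus. \<xi> x * \<psi> x))"

text \<open>
  The convolution of \<open>\<xi>\<close> with the Biot--Savart kernel. The four conditions determine the field up
  to null sets; an arbitrary representative is chosen.
\<close>

definition biot_savart :: "(real^2 \<Rightarrow> real) \<Rightarrow> real^2 \<Rightarrow> real^2" where
  "biot_savart \<xi> =
     (SOME u. u \<in> Lspace 2 \<and> zero_mean u \<and> weakly_div_free u \<and> weak_curl_eq u \<xi>)"

definition transport :: "(real^2 \<Rightarrow> real) \<Rightarrow> (real^2 \<Rightarrow> real) \<Rightarrow> real^2 \<Rightarrow> real" where
  "transport \<xi> \<zeta> x = biot_savart \<xi> x \<bullet> weak_grad \<zeta> x"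

end

theory Submission
  imports Defs
begin

text \<open>
  Put \<open>T \<zeta> = \<zeta> - \<tau> (K * \<xi>) \<cdot> \<nabla>\<zeta>\<close>. Since \<open>K * \<xi>\<close> is solenoidal, the transport
  term is orthogonal to the constants and to \<open>\<zeta>\<close>, so that \<open>\<parallel>T \<zeta>\<parallel> \<ge> \<parallel>\<zeta>\<parallel>\<close>. Hence
  \<open>T \<zeta> \<mapsto> \<langle>\<xi>, \<zeta>\<rangle>\<close> is a bounded functional on the range of \<open>T\<close>, and the
  vector which represents it on the closure of the range is the solution. The transport term is square
  integrable, and the cancellations survive the passage from smooth functions to \<open>W\<^sup>1\<^sup>,\<^sup>4\<close>,
  because \<open>K * \<xi>\<close> is in \<open>L\<^sup>4\<close>: its Fourier coefficients are of the form
  \<open>\<bar>k\<bar>\<^sup>-\<^sup>1 c\<^sub>k\<close> with a square summable \<open>c\<close>, and \<open>\<bar>k\<bar>\<^sup>-\<^sup>4\<close> is summable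
  on the lattice.
\<close>

section \<open>Square integrable functions\<close>

text \<open>All spaces consist of everywhere defined periodic functions, and
  \<open>biot_savart\<close> and \<open>weak_grad\<close> are arbitrary choices. What is known of
  one good field (the exponent 4, approximation by truncations) therefore reaches the chosen one
  only through uniqueness almost everywhere, and this rests on uniqueness of Fourier coefficients
  for merely integrable functions. Also, \<open>T\<close> is linear only almost everywhere, while
  its limits have to be periodic at every point. Fourier truncation regularizes both the velocity
  and \<open>\<zeta>\<close>. It commutes with derivatives, so that truncated velocities are exactly
  solenoidal, and it converges in the mean square. As truncations are not controlled in a stronger
  norm, the velocity is truncated first and kept fixed while \<open>\<zeta>\<close> is approximated.
  Orthogonality of the transport term to the constants gives the solution zero mean. The equation
  cannot do this: test functions have zero mean, and adding a constant to a solution gives another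
  one. The mean of the solution is inherited from the range of \<open>T\<close>, in whose closure it
  lies.\<close>

lemma
  fixes f g :: "'a \<Rightarrow> 'b::{real_normed_algebra, banach, second_countable_topology}"
  assumes [measurable]: "f \<in> borel_measurable M" "g \<in> borel_measurable M"
    and f2: "integrable M (\<lambda>x. (norm (f x))\<^sup>2)" and g2: "integrable M (\<lambda>x. (norm (g x))\<^sup>2)"
  shows integrable_mult_L2: "integrable M (\<lambda>x. f x * g x)"
    and Cauchy_Schwarz_integral:
      "(LINT x|M. norm (f x * g x))\<^sup>2 \<le> (LINT x|M. (norm (f x))\<^sup>2) * (LINT x|M. (norm (g x))\<^sup>2)"
proof -
  have young0: "norm (f x) * norm (g x) \<le> (norm (f x))\<^sup>2 + (norm (g x))\<^sup>2" for x
  proof -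
    have "0 \<le> (norm (f x) - norm (g x))\<^sup>2" by simp
    then show ?thesis
      using zero_le_power2[of "norm (f x)"] zero_le_power2[of "norm (g x)"]
      unfolding power2_diff by linarith
  qed
  have young: "norm (f x * g x) \<le> (norm (f x))\<^sup>2 + (norm (g x))\<^sup>2" for x
    using norm_mult_ineq[of "f x" "g x"] young0[of x] by linarith
  show int: "integrable M (\<lambda>x. f x * g x)"
    by (rule Bochner_Integration.integrable_bound[OF Bochner_Integration.integrable_add[OF f2 g2]])
       (use young in auto)
  have fg: "integrable M (\<lambda>x. norm (f x) * norm (g x))"
    by (rule Bochner_Integration.integrable_bound[OF Bochner_Integration.integrable_add[OF f2 g2]])
       (use young0 in auto)
  define a where "a = (LINT x|M. (norm (f x))\<^sup>2)"
  define b where "b = (LINT x|M. norm (f x) * norm (g x))"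
  define c where "c = (LINT x|M. (norm (g x))\<^sup>2)"
  \<comment> \<open>The squared norm of \<open>t * \<bar>f\<bar> - \<bar>g\<bar>\<close> as a
    polynomial in \<open>t\<close>; that it is nowhere negative is the Cauchy-Schwarz
    inequality.\<close>
  have quad: "0 \<le> a * t\<^sup>2 - 2 * b * t + c" for t
  proof -
    have "0 \<le> (LINT x|M. (t * norm (f x) - norm (g x))\<^sup>2)"
      by (rule Bochner_Integration.integral_nonneg) simp
    also have "(LINT x|M. (t * norm (f x) - norm (g x))\<^sup>2)
        = (LINT x|M. t\<^sup>2 * (norm (f x))\<^sup>2 - (2 * t) * (norm (f x) * norm (g x)) + (norm (g x))\<^sup>2)"
      by (rule Bochner_Integration.integral_cong) (auto simp: power2_diff power_mult_distrib)
    also have "\<dots> = t\<^sup>2 * a - (2 * t) * b + c"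
      using f2 g2 fg by (simp add: a_def b_def c_def)
    finally show ?thesis by (simp add: mult_ac)
  qed
  have a0: "a \<ge> 0" unfolding a_def by (rule Bochner_Integration.integral_nonneg) simp
  have c0: "c \<ge> 0" unfolding c_def by (rule Bochner_Integration.integral_nonneg) simp
  have "b\<^sup>2 \<le> a * c"
  proof (cases "a = 0")
    case True
    have "b = 0"
    proof (rule ccontr)
      assume "b \<noteq> 0"
      \<comment> \<open>For \<open>a = 0\<close> the polynomial is affine, and this argument gives
        it the value -1.\<close>
      then show False using quad[of "(c + 1) / (2 * b)"] True by simp
    qed
    then show ?thesis using True by simp
  next
    case False
    then have "a > 0" using a0 by simp
    \<comment> \<open>The polynomial at its minimizer \<open>b / a\<close>.\<close>
    then have "a * (b / a)\<^sup>2 - 2 * b * (b / a) + c = c - b\<^sup>2 / a"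
      by (simp add: power2_eq_square field_simps)
    then have "b\<^sup>2 / a \<le> c" using quad[of "b / a"] by linarith
    then show ?thesis using \<open>a > 0\<close> by (simp add: field_simps)
  qed
  moreover have "(LINT x|M. norm (f x * g x)) \<le> b"
    unfolding b_def by (rule integral_mono) (use int fg norm_mult_ineq in auto)
  moreover have "0 \<le> (LINT x|M. norm (f x * g x))" by simp
  ultimately show "(LINT x|M. norm (f x * g x))\<^sup>2 \<le> a * c"
    by (meson power_mono order_trans)
qed

lemma norm_integral_mult_le:
  fixes f g :: "'a \<Rightarrow> 'b::{real_normed_algebra, banach, second_countable_topology}"
  assumes "f \<in> borel_measurable M" "g \<in> borel_measurable M"
    and "integrable M (\<lambda>x. (norm (f x))\<^sup>2)" "integrable M (\<lambda>x. (norm (g x))\<^sup>2)"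
  shows "norm (LINT x|M. f x * g x)
    \<le> sqrt ((LINT x|M. (norm (f x))\<^sup>2) * (LINT x|M. (norm (g x))\<^sup>2))"
proof -
  have "norm (LINT x|M. f x * g x) \<le> (LINT x|M. norm (f x * g x))"
    by (rule integral_norm_bound)
  also have "\<dots> \<le> sqrt ((LINT x|M. (norm (f x))\<^sup>2) * (LINT x|M. (norm (g x))\<^sup>2))"
    using Cauchy_Schwarz_integral[OF assms] by (rule real_le_rsqrt)
  finally show ?thesis .
qed

lemma norm_diff_power2_le:
  fixes a b :: "'a::real_normed_vector"
  shows "(norm (a - b))\<^sup>2 \<le> 2 * (norm a)\<^sup>2 + 2 * (norm b)\<^sup>2"
proof -
  have "(norm (a - b))\<^sup>2 \<le> (norm a + norm b)\<^sup>2"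
    by (intro power_mono norm_triangle_ineq4) simp
  also have "\<dots> \<le> 2 * (norm a)\<^sup>2 + 2 * (norm b)\<^sup>2"
    using zero_le_power2[of "norm a - norm b"] unfolding power2_diff power2_sum by linarith
  finally show ?thesis .
qed

lemma L2_diff:
  fixes f g :: "'a \<Rightarrow> 'b::{banach, second_countable_topology}"
  assumes [measurable]: "f \<in> borel_measurable M" "g \<in> borel_measurable M"
    and f2: "integrable M (\<lambda>x. (norm (f x))\<^sup>2)" and g2: "integrable M (\<lambda>x. (norm (g x))\<^sup>2)"
  shows "integrable M (\<lambda>x. (norm (f x - g x))\<^sup>2)"
proof -
  have i: "integrable M (\<lambda>x. 2 * (norm (f x))\<^sup>2 + 2 * (norm (g x))\<^sup>2)"
    using f2 g2 by simp
  show "integrable M (\<lambda>x. (norm (f x - g x))\<^sup>2)"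
    by (rule Bochner_Integration.integrable_bound[OF i]) (auto intro!: norm_diff_power2_le)
qed

text \<open>Cauchy-Schwarz against the constant 1, which is square integrable because the measure is
  finite.\<close>

lemma (in finite_measure)
  fixes f :: "'a \<Rightarrow> 'b::{banach, second_countable_topology}"
  assumes [measurable]: "f \<in> borel_measurable M"
    and f2: "integrable M (\<lambda>x. (norm (f x))\<^sup>2)"
  shows L2_imp_integrable: "integrable M f"
    and integral_norm_power2_le: "(LINT x|M. norm (f x))\<^sup>2 \<le> measure M (space M) * (LINT x|M. (norm (f x))\<^sup>2)"
proof -
  have *: "integrable M (\<lambda>x. 1 * norm (f x))"
    by (rule integrable_mult_L2) (use f2 in auto)
  then show "integrable M f"
    by (simp add: integrable_norm_iff)
  show "(LINT x|M. norm (f x))\<^sup>2 \<le> measure M (space M) * (LINT x|M. (norm (f x))\<^sup>2)"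
    using Cauchy_Schwarz_integral[of "\<lambda>_. 1::real" M "\<lambda>x. norm (f x)"] f2 by simp
qed

text \<open>Monotone convergence allows integration term by term, so the sum of the norms has a
  finite integral and is finite almost everywhere.\<close>

lemma AE_summable_norm:
  fixes d :: "nat \<Rightarrow> 'a \<Rightarrow> 'b::{banach, second_countable_topology}"
  assumes int: "\<And>j. integrable M (d j)" and sm: "summable (\<lambda>j. LINT x|M. norm (d j x))"
  shows "AE x in M. summable (\<lambda>j. norm (d j x))"
proof -
  have [measurable]: "d j \<in> borel_measurable M" for j using int by auto
  have "(\<integral>\<^sup>+x. (\<Sum>j. ennreal (norm (d j x))) \<partial>M) = (\<Sum>j. \<integral>\<^sup>+x. norm (d j x) \<partial>M)"
    by (rule nn_integral_suminf) simp
  also have "\<dots> = (\<Sum>j. ennreal (LINT x|M. norm (d j x)))"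
    using int by (simp add: nn_integral_eq_integral)
  also have "\<dots> = ennreal (\<Sum>j. LINT x|M. norm (d j x))"
    by (rule suminf_ennreal2) (use sm in auto)
  finally have "(\<integral>\<^sup>+x. (\<Sum>j. ennreal (norm (d j x))) \<partial>M) \<noteq> \<infinity>" by simp
  then have "AE x in M. (\<Sum>j. ennreal (norm (d j x))) \<noteq> \<infinity>"
    by (intro nn_integral_PInf_AE) auto
  then show ?thesis
    by eventually_elim (auto intro: summable_suminf_not_top)
qed

text \<open>Fatou's lemma for Bochner integrals. The bound is asked only from some index on, so that
  the tail of a Cauchy sequence qualifies.\<close>

lemma Fatou_bound:
  fixes f :: "nat \<Rightarrow> 'a \<Rightarrow> real"
  assumes int: "\<And>n. integrable M (f n)" and nn: "\<And>n x. f n x \<ge> 0"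
    and [measurable]: "g \<in> borel_measurable M"
    and lim: "AE x in M. (\<lambda>n. f n x) \<longlonglongrightarrow> g x"
    and bnd: "\<And>n. n \<ge> N \<Longrightarrow> (LINT x|M. f n x) \<le> C" and g0: "\<And>x. g x \<ge> 0"
  shows "integrable M g" "(LINT x|M. g x) \<le> C"
proof -
  have [measurable]: "f j \<in> borel_measurable M" for j using int by auto
  have C0: "C \<ge> 0"
    using bnd[of N] Bochner_Integration.integral_nonneg[of M "f N"] nn by fastforce
  have "(\<integral>\<^sup>+x. g x \<partial>M) = (\<integral>\<^sup>+x. liminf (\<lambda>n. ennreal (f n x)) \<partial>M)"
  proof (rule nn_integral_cong_AE)
    show "AE x in M. ennreal (g x) = liminf (\<lambda>n. ennreal (f n x))"
      using lim
    proof eventually_elim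
      case (elim x)
      then have "(\<lambda>n. ennreal (f n x)) \<longlonglongrightarrow> ennreal (g x)" by (rule tendsto_ennrealI)
      then show ?case by (simp add: lim_imp_Liminf)
    qed
  qed
  also have "\<dots> \<le> liminf (\<lambda>n. \<integral>\<^sup>+x. f n x \<partial>M)"
    by (rule nn_integral_liminf) simp
  also have "\<dots> = liminf (\<lambda>n. ennreal (LINT x|M. f n x))"
    using int nn by (simp add: nn_integral_eq_integral)
  also have "\<dots> \<le> ennreal C"
  proof (rule Liminf_le)
    show "\<forall>\<^sub>F n in sequentially. ennreal (LINT x|M. f n x) \<le> ennreal C"
      using bnd by (auto simp: eventually_sequentially intro!: exI[of _ N] ennreal_leI)
  qed simp
  finally have le: "(\<integral>\<^sup>+x. g x \<partial>M) \<le> ennreal C" .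
  then show "integrable M g"
    by (intro integrableI_bounded) (use g0 in \<open>auto simp: le_less_trans\<close>)
  show "(LINT x|M. g x) \<le> C"
    using le C0 g0 by (subst integral_eq_nn_integral) (auto intro: enn2real_leI)
qed

text \<open>The limit is a pointwise one along a fixed subsequence, so that it inherits periodicity.\<close>

lemma (in finite_measure) L2_complete:
  fixes f :: "nat \<Rightarrow> 'a \<Rightarrow> 'b::{banach, second_countable_topology}"
  assumes [measurable]: "\<And>n. f n \<in> borel_measurable M"
    and f2: "\<And>n. integrable M (\<lambda>x. (norm (f n x))\<^sup>2)"
    and Cauchy: "\<And>e. e > 0 \<Longrightarrow> \<exists>N. \<forall>m\<ge>N. \<forall>n\<ge>N. (LINT x|M. (norm (f m x - f n x))\<^sup>2) < e"
  obtains h r where "h = (\<lambda>x. lim (\<lambda>j. f (r j) x))" "h \<in> borel_measurable M"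
    "integrable M (\<lambda>x. (norm (h x))\<^sup>2)" "(\<lambda>n. LINT x|M. (norm (f n x - h x))\<^sup>2) \<longlonglongrightarrow> 0"
proof -
  \<comment> \<open>Squared distances below \<open>(1/4)^j\<close> become first-order distances of
    order \<open>(1/2)^j\<close>, which are summable.\<close>
  have "\<exists>N. \<forall>m\<ge>N. \<forall>n\<ge>N. (LINT x|M. (norm (f m x - f n x))\<^sup>2) < (1/4)^j" for j
    by (rule Cauchy) simp
  then obtain N where N: "\<And>j m n. m \<ge> N j \<Longrightarrow> n \<ge> N j \<Longrightarrow> (LINT x|M. (norm (f m x - f n x))\<^sup>2) < (1/4)^j"
    by metis
  \<comment> \<open>The maximum makes \<open>r\<close> strictly increasing and keeps it above
    \<open>N\<close>.\<close>
  define r where "r = rec_nat (N 0) (\<lambda>j p. max (Suc p) (N (Suc j)))"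
  have r0: "r 0 = N 0" and rS: "r (Suc j) = max (Suc (r j)) (N (Suc j))" for j
    by (simp_all add: r_def)
  have rmono: "strict_mono r"
    by (rule strict_monoI_Suc) (simp add: rS less_max_iff_disj)
  have rN: "r j \<ge> N j" for j by (cases j) (auto simp: r0 rS)
  define d where "d j x = f (r (Suc j)) x - f (r j) x" for j x
  define h where "h x = lim (\<lambda>j. f (r j) x)" for x
  have dmeas[measurable]: "d j \<in> borel_measurable M" for j unfolding d_def[abs_def] by measurable
  have d2: "integrable M (\<lambda>x. (norm (d j x))\<^sup>2)" for j
    unfolding d_def by (intro L2_diff f2) measurable
  have dint: "integrable M (d j)" for j by (rule L2_imp_integrable[OF dmeas d2])
  have dle: "(LINT x|M. norm (d j x)) \<le> sqrt (measure M (space M)) * (1/2)^j" for j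
  proof -
    have "(LINT x|M. (norm (d j x))\<^sup>2) \<le> (1/4)^j"
      unfolding d_def using N[of j "r (Suc j)" "r j"] rN[of j] strict_monoD[OF rmono, of j "Suc j"] by force
    then have "(LINT x|M. norm (d j x))\<^sup>2 \<le> measure M (space M) * (1/4)^j"
      using integral_norm_power2_le[OF dmeas d2, of j]
      by (meson measure_nonneg mult_left_mono order_trans)
    also have "(1/4::real)^j = ((1/2)^j)\<^sup>2"
      by (simp add: power2_eq_square flip: power_mult_distrib)
    finally have "(LINT x|M. norm (d j x)) \<le> sqrt (measure M (space M) * ((1/2)^j)\<^sup>2)"
      by (rule real_le_rsqrt)
    then show ?thesis by (simp add: real_sqrt_mult)
  qed
  have "AE x in M. summable (\<lambda>j. norm (d j x))"
  proof (rule AE_summable_norm[OF dint], rule summable_comparison_test')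
    show "summable (\<lambda>j. sqrt (measure M (space M)) * (1/2::real)^j)" by (intro summable_mult summable_geometric) auto
  qed (use dle in auto)
  \<comment> \<open>The partial sums of the increments \<open>d\<close> telescope to the subsequence
    itself.\<close>
  then have hlim: "AE x in M. (\<lambda>j. f (r j) x) \<longlonglongrightarrow> h x"
  proof eventually_elim
    case (elim x)
    then have "summable (\<lambda>j. d j x)" by (rule summable_norm_cancel)
    then have "convergent (\<lambda>n. \<Sum>j<n. d j x)" by (simp add: summable_iff_convergent)
    then have "convergent (\<lambda>n. f (r n) x - f (r 0) x)"
      unfolding d_def using sum_lessThan_telescope[of "\<lambda>j. f (r j) x"] by simp
    then have "convergent (\<lambda>n. f (r n) x)" by (subst (asm) convergent_diff_const_right_iff)
    then show ?case unfolding h_def by (simp add: convergent_LIMSEQ_iff)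
  qed
  have hmeas[measurable]: "h \<in> borel_measurable M"
    unfolding h_def[abs_def] by (rule borel_measurable_lim_metric) measurable
  \<comment> \<open>Fatou's lemma in the second index carries the Cauchy estimate over to the
    limit.\<close>
  have est: "integrable M (\<lambda>x. (norm (f n x - h x))\<^sup>2) \<and> (LINT x|M. (norm (f n x - h x))\<^sup>2) \<le> e"
    if "e > 0" and K: "\<And>m. m \<ge> K \<Longrightarrow> (LINT x|M. (norm (f n x - f m x))\<^sup>2) \<le> e" for n e K
  proof -
    have 1: "AE x in M. (\<lambda>j. (norm (f n x - f (r j) x))\<^sup>2) \<longlonglongrightarrow> (norm (f n x - h x))\<^sup>2"
      using hlim by eventually_elim (intro tendsto_intros, assumption)
    have 2: "j \<ge> K \<Longrightarrow> (LINT x|M. (norm (f n x - f (r j) x))\<^sup>2) \<le> e" for j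
      using K[of "r j"] seq_suble[OF rmono, of j] by simp
    have 3: "integrable M (\<lambda>x. (norm (f n x - f (r j) x))\<^sup>2)" for j
      by (intro L2_diff f2) measurable
    show ?thesis
      using Fatou_bound[OF 3 _ _ 1 2] by simp
  qed
  have conv: "(\<lambda>n. LINT x|M. (norm (f n x - h x))\<^sup>2) \<longlonglongrightarrow> 0"
  proof (rule LIMSEQ_I)
    fix e :: real assume e: "e > 0"
    obtain K where K: "\<forall>m\<ge>K. \<forall>n\<ge>K. (LINT x|M. (norm (f m x - f n x))\<^sup>2) < e/2"
      using Cauchy[of "e/2"] e by auto
    have "norm ((LINT x|M. (norm (f n x - h x))\<^sup>2) - 0) < e" if "n \<ge> K" for n
      using est[of "e/2" K n] K that e by (fastforce simp: less_imp_le)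
    then show "\<exists>no. \<forall>n\<ge>no. norm ((LINT x|M. (norm (f n x - h x))\<^sup>2) - 0) < e" by blast
  qed
  obtain K where K: "\<forall>m\<ge>K. \<forall>n\<ge>K. (LINT x|M. (norm (f m x - f n x))\<^sup>2) < 1"
    using Cauchy[of 1] by auto
  have "integrable M (\<lambda>x. (norm (f K x - h x))\<^sup>2)"
    using est[of 1 K K] K by (fastforce simp: less_imp_le)
  \<comment> \<open>\<open>h\<close> is square integrable because it differs from a member of the
    sequence by a square integrable function.\<close>
  from L2_diff[OF _ _ f2[of K] this]
  have "integrable M (\<lambda>x. (norm (f K x - (f K x - h x)))\<^sup>2)" by simp
  then have "integrable M (\<lambda>x. (norm (h x))\<^sup>2)" by simp
  then show thesis using that[of h r] conv hmeas h_def by auto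
qed

text \<open>Along a subsequence the convergence is almost everywhere, and Fatou's lemma applies.\<close>

lemma (in finite_measure) L2_limit_power4:
  fixes f :: "nat \<Rightarrow> 'a \<Rightarrow> 'b::{banach, second_countable_topology}"
  assumes [measurable]: "\<And>n. f n \<in> borel_measurable M" "h \<in> borel_measurable M"
    and f2: "\<And>n. integrable M (\<lambda>x. (norm (f n x))\<^sup>2)" and h2: "integrable M (\<lambda>x. (norm (h x))\<^sup>2)"
    and lim: "(\<lambda>n. LINT x|M. (norm (f n x - h x))\<^sup>2) \<longlonglongrightarrow> 0"
    and f4: "\<And>n. integrable M (\<lambda>x. (norm (f n x))^4)" "\<And>n. (LINT x|M. (norm (f n x))^4) \<le> C"
  shows "integrable M (\<lambda>x. (norm (h x))^4)"
proof -
  have d2: "integrable M (\<lambda>x. (norm (f n x - h x))\<^sup>2)" for n by (intro L2_diff f2 h2) measurable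
  have d1: "integrable M (\<lambda>x. (f n x - h x))" for n by (rule L2_imp_integrable[OF _ d2]) measurable
  \<comment> \<open>On a finite measure, convergence in the mean square implies convergence in the
    mean, from which an almost everywhere convergent subsequence can be extracted.\<close>
  have sq: "(\<lambda>n. (LINT x|M. norm (f n x - h x))\<^sup>2) \<longlonglongrightarrow> 0"
  proof (rule tendsto_sandwich[OF _ _ tendsto_const])
    show "\<forall>\<^sub>F n in sequentially. (LINT x|M. norm (f n x - h x))\<^sup>2
        \<le> measure M (space M) * (LINT x|M. (norm (f n x - h x))\<^sup>2)"
      by (intro always_eventually allI integral_norm_power2_le d2) measurable
    show "(\<lambda>n. measure M (space M) * (LINT x|M. (norm (f n x - h x))\<^sup>2)) \<longlonglongrightarrow> 0"
      using tendsto_mult_left[OF lim, of "measure M (space M)"] by simp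
  qed simp
  have "(\<lambda>n. LINT x|M. norm (f n x - h x)) \<longlonglongrightarrow> 0"
    using tendsto_real_sqrt[OF sq] by simp
  from tendsto_L1_AE_subseq[OF d1 this] obtain r :: "nat \<Rightarrow> nat" where
    ae: "AE x in M. (\<lambda>n. f (r n) x - h x) \<longlonglongrightarrow> 0" by blast
  have ae4: "AE x in M. (\<lambda>n. (norm (f (r n) x))^4) \<longlonglongrightarrow> (norm (h x))^4"
    using ae
  proof eventually_elim
    case (elim x)
    then have "(\<lambda>n. f (r n) x) \<longlonglongrightarrow> h x" by (rule LIM_zero_cancel)
    then show ?case by (intro tendsto_intros)
  qed
  show ?thesis
    by (rule Fatou_bound[OF f4(1) _ _ ae4]) (use f4 in auto)
qed

section \<open>Integration over the torus\<close>

lemma space_torus: "space torus = cbox 0 1"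
  by (simp add: torus_def)

lemma finite_measure_torus: "finite_measure torus"
  unfolding torus_def by (rule finite_measure_lebesgue_on) simp

interpretation torus: finite_measure torus
  by (rule finite_measure_torus)

lemma measure_torus: "measure torus (space torus) = 1"
proof -
  have "measure torus (space torus) = measure lebesgue (cbox 0 (1::real^2))"
    unfolding space_torus by (simp add: torus_def measure_restrict_space)
  also have "\<dots> = 1"
    by (subst measure_completion) (auto simp: content_cbox_cart interval_ne_empty_cart)
  finally show ?thesis .
qed

lemma borel_measurable_torus:
  fixes f :: "real^2 \<Rightarrow> 'b::euclidean_space"
  assumes "continuous_on UNIV f"
  shows "f \<in> borel_measurable torus"
  unfolding torus_def
  by (intro measurable_restrict_space1 measurable_completion)
     (use borel_measurable_continuous_onI[OF assms] in simp)

lemma bounded_on_torus: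
  fixes f :: "real^2 \<Rightarrow> 'b::euclidean_space"
  assumes "continuous_on UNIV f"
  obtains B where "\<And>x. x \<in> space torus \<Longrightarrow> norm (f x) \<le> B"
proof -
  have "compact (f ` cbox 0 1)"
    by (intro compact_continuous_image continuous_on_subset[OF assms]) auto
  then have "bounded (f ` cbox 0 1)" by (rule compact_imp_bounded)
  then show thesis using that unfolding bounded_iff space_torus by blast
qed

lemma integrable_torus_continuous:
  fixes f :: "real^2 \<Rightarrow> 'b::euclidean_space"
  assumes "continuous_on UNIV f"
  shows "integrable torus f"
proof -
  obtain B where "\<And>x. x \<in> space torus \<Longrightarrow> norm (f x) \<le> B" using bounded_on_torus[OF assms] by blast
  then show ?thesis
    by (intro torus.integrable_const_bound[where B = B]) (use borel_measurable_torus[OF assms] in auto)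
qed

text \<open>Makes Fubini's theorem available on \<open>real^2\<close>, which is not a product type.
  The first factor carries the coordinate \<open>j\<close>, so that the integration in the direction
  \<open>j\<close> can be made the inner one for either \<open>j\<close>.\<close>

lemma lborel_vec2:
  fixes j :: 2
  defines "\<phi> \<equiv> (\<lambda>p. \<chi> i. if i = j then fst p else snd p) :: real \<times> real \<Rightarrow> real^2"
  shows "lborel = distr (lborel \<Otimes>\<^sub>M lborel) borel \<phi>"
proof (rule lborel_eqI)
  have meas: "\<phi> \<in> borel_measurable (lborel \<Otimes>\<^sub>M lborel)"
  proof -
    have "continuous_on UNIV \<phi>" unfolding \<phi>_def
      by (rule continuous_on_vec_lambda, case_tac "i = j") (auto intro!: continuous_intros)
    then show ?thesis by (simp add: lborel_prod borel_measurable_continuous_onI)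
  qed
  fix l u :: "real^2"
  assume le: "\<And>b. b \<in> Basis \<Longrightarrow> l \<bullet> b \<le> u \<bullet> b"
  then have le': "l $ i \<le> u $ i" for i
    by (metis axis_in_Basis_iff Basis_real_def cart_eq_inner_axis insertI1)
  obtain j' where j': "j' \<noteq> j" "UNIV = {j, j'}"
    using that[of 1] that[of 2] exhaust_2[of j] UNIV_2 by (auto simp: insert_commute)
  have all: "(\<forall>i::2. P i) \<longleftrightarrow> P j \<and> P j'" for P using j'(2) by (metis UNIV_I insert_iff singletonD)
  have vim: "\<phi> -` box l u = {l $ j<..<u $ j} \<times> {l $ j'<..<u $ j'}"
    using j'(1) by (auto simp: \<phi>_def mem_box_cart all)
  have "emeasure (distr (lborel \<Otimes>\<^sub>M lborel) borel \<phi>) (box l u)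
      = emeasure (lborel \<Otimes>\<^sub>M lborel) ({l $ j<..<u $ j} \<times> {l $ j'<..<u $ j'})"
    by (subst emeasure_distr[OF meas]) (auto simp: vim space_pair_measure)
  also have "\<dots> = ennreal (u $ j - l $ j) * ennreal (u $ j' - l $ j')"
    by (subst lborel.emeasure_pair_measure_Times) (auto simp: le')
  also have "\<dots> = ennreal (\<Prod>i\<in>UNIV. u $ i - l $ i)"
    unfolding j'(2) using j'(1) le' by (simp add: ennreal_mult)
  also have "(\<Prod>i\<in>UNIV. u $ i - l $ i) = (\<Prod>b\<in>Basis. (u - l) \<bullet> b)"
  proof -
    have B: "Basis = (\<lambda>i::2. axis i (1::real)) ` UNIV" by (auto simp: Basis_vec_def)
    have "inj (\<lambda>i::2. axis i (1::real))" by (auto simp: inj_def axis_eq_axis)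
    then show ?thesis unfolding B by (simp add: prod.reindex inner_axis)
  qed
  finally show "emeasure (distr (lborel \<Otimes>\<^sub>M lborel) borel \<phi>) (box l u) = (\<Prod>b\<in>Basis. (u - l) \<bullet> b)" .
qed simp

text \<open>Passes from the completed measure of \<open>torus\<close> to \<open>lborel\<close>, to
  which the product decomposition applies.\<close>

lemma LINT_torus_continuous:
  fixes f :: "real^2 \<Rightarrow> 'b::euclidean_space"
  assumes "continuous_on UNIV f"
  shows "(LINT x|torus. f x) = (LINT x|lborel. indicator (cbox 0 1) x *\<^sub>R f x)"
proof -
  have [measurable]: "f \<in> borel_measurable borel" using assms by (rule borel_measurable_continuous_onI)
  show ?thesis
    unfolding torus_def
    by (subst integral_restrict_space) (auto simp: integral_completion)
qed

text \<open>The fundamental theorem of calculus along the lines parallel to the axis \<open>j\<close>: the boundary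
  terms cancel by periodicity.\<close>

lemma integral_partial_derivative_periodic:
  fixes h :: "real^2 \<Rightarrow> 'b::euclidean_space"
  assumes per: "periodic h" and der: "\<And>x. (h has_derivative h' x) (at x)"
    and cont: "continuous_on UNIV (\<lambda>x. h' x (axis j 1))"
  shows "(LINT x|torus. h' x (axis j 1)) = 0"
proof -
  define D where "D x = h' x (axis j 1)" for x
  define \<phi> :: "real \<times> real \<Rightarrow> real^2" where "\<phi> p = (\<chi> i. if i = j then fst p else snd p)" for p
  have contD: "continuous_on UNIV D" using cont by (simp add: D_def[abs_def])
  have [measurable]: "D \<in> borel_measurable borel" using contD by (rule borel_measurable_continuous_onI)
  have cphi: "continuous_on UNIV \<phi>" unfolding \<phi>_def
    by (rule continuous_on_vec_lambda, case_tac "i = j") (auto intro!: continuous_intros)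
  have mphi[measurable]: "\<phi> \<in> borel_measurable (lborel \<Otimes>\<^sub>M lborel)"
    using borel_measurable_continuous_onI[OF cphi] by (simp add: lborel_prod)
  have eq: "lborel = distr (lborel \<Otimes>\<^sub>M lborel) borel \<phi>"
    using lborel_vec2[of j] by (simp add: \<phi>_def[abs_def])
  define G where "G x = indicator (cbox 0 1) x *\<^sub>R D x" for x
  have Gint: "integrable lborel G"
    unfolding G_def by (intro borel_integrable_compact continuous_on_subset[OF contD]) auto
  have Gphi: "integrable (lborel \<Otimes>\<^sub>M lborel) (\<lambda>p. G (\<phi> p))"
    by (rule integrable_distr[OF mphi]) (use Gint eq in simp)
  have inner: "(LINT s|lborel. G (\<phi> (s, t))) = 0" for t
  proof -
    \<comment> \<open>The square is a product: a line either misses it or meets it in a full unit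
      interval, where the fundamental theorem applies.\<close>
    have "G (\<phi> (s, t)) = (if t \<in> {0..1} then 1 else 0) *\<^sub>R (indicator {0..1} s *\<^sub>R D (\<phi> (s, t)))" for s
    proof -
      have "\<phi> (s, t) \<in> cbox 0 1 \<longleftrightarrow> s \<in> {0..1} \<and> t \<in> {0..1}"
      proof -
        obtain j' where "j' \<noteq> j" using exhaust_2 by (metis one_neq_zero zero_neq_one)
        then show ?thesis by (auto simp: \<phi>_def mem_box_cart)
      qed
      then show ?thesis by (auto simp: G_def indicator_def)
    qed
    then have "(LINT s|lborel. G (\<phi> (s, t)))
       = (if t \<in> {0..1} then 1 else 0) *\<^sub>R (LINT s|lborel. indicator {0..1} s *\<^sub>R D (\<phi> (s, t)))"
      by simp
    also have "(LINT s|lborel. indicator {0..1} s *\<^sub>R D (\<phi> (s, t))) = h (\<phi> (1, t)) - h (\<phi> (0, t))"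
    proof (rule integral_FTC_atLeastAtMost)
      have "continuous_on {0..1} (\<lambda>s. D (\<phi> (s, t)))"
        by (intro continuous_on_compose2[OF contD] continuous_on_compose2[OF cphi]) (auto intro!: continuous_intros)
      then show "continuous_on {0..1} (\<lambda>s. D (\<phi> (s, t)))" .
      fix s :: real
      have "((\<lambda>s. \<phi> (s, t)) has_derivative (\<lambda>r. r *\<^sub>R axis j 1)) (at s within {0..1})"
      proof -
        define c where "c = \<phi> (0, t)"
        have *: "(\<lambda>s. \<phi> (s, t)) = (\<lambda>s. s *\<^sub>R axis j 1 + c)"
          by (auto simp: c_def \<phi>_def vec_eq_iff axis_def)
        show ?thesis unfolding * by (auto intro!: derivative_eq_intros)
      qed
      from has_derivative_compose[OF this der]
      have "((\<lambda>s. h (\<phi> (s, t))) has_derivative (\<lambda>r. h' (\<phi> (s, t)) (r *\<^sub>R axis j 1))) (at s within {0..1})" .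
      moreover have "linear (h' (\<phi> (s, t)))" using der has_derivative_linear by blast
      ultimately show "((\<lambda>s. h (\<phi> (s, t))) has_vector_derivative D (\<phi> (s, t))) (at s within {0..1})"
        by (simp add: has_vector_derivative_def D_def linear_scale)
    qed simp
    also have "h (\<phi> (1, t)) = h (\<phi> (0, t))"
    proof -
      have "\<phi> (1, t) = \<phi> (0, t) + axis j 1" by (auto simp: \<phi>_def vec_eq_iff axis_def)
      moreover have "\<forall>i. axis j (1::real) $ i \<in> \<int>" by (auto simp: axis_def)
      ultimately show ?thesis using per unfolding periodic_def by simp
    qed
    finally show ?thesis by simp
  qed
  have "(LINT x|torus. D x) = (LINT x|lborel. G x)"
    unfolding G_def by (rule LINT_torus_continuous[OF contD])
  also have "\<dots> = (LINT p|(lborel \<Otimes>\<^sub>M lborel). G (\<phi> p))"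
    by (subst eq, rule integral_distr[OF mphi]) (simp add: G_def[abs_def])
  also have "\<dots> = (LINT t|lborel. LINT s|lborel. G (\<phi> (s, t)))"
    using lborel_pair.integral_snd[of "\<lambda>s t. G (\<phi> (s, t))"] Gphi by (simp add: case_prod_beta')
  also have "\<dots> = 0" by (simp add: inner)
  finally show ?thesis by (simp add: D_def)
qed

section \<open>Trigonometric polynomials\<close>

definition char2 :: "int^2 \<Rightarrow> real^2 \<Rightarrow> complex" where
  "char2 k x = cis (2 * pi * (\<Sum>i\<in>UNIV. of_int (k $ i) * x $ i))"

definition trig :: "(int^2) set \<Rightarrow> (int^2 \<Rightarrow> complex) \<Rightarrow> real^2 \<Rightarrow> complex" where
  "trig F a x = (\<Sum>k\<in>F. a k * char2 k x)"

text \<open>The Fourier multiplier of the partial derivative in the direction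
  \<open>i\<close>.\<close>

definition dcoef :: "2 \<Rightarrow> (int^2 \<Rightarrow> complex) \<Rightarrow> int^2 \<Rightarrow> complex" where
  "dcoef i a k = 2 * pi * \<i> * of_int (k $ i) * a k"

lemma char2_0 [simp]: "char2 0 x = 1"
  by (simp add: char2_def)

lemma char2_mult: "char2 k x * char2 m x = char2 (k + m) x"
  by (simp add: char2_def cis_mult sum.distrib distrib_left distrib_right)

lemma cnj_char2: "cnj (char2 k x) = char2 (- k) x"
  by (simp add: char2_def cis_cnj sum_negf)

lemma norm_char2 [simp]: "norm (char2 k x) = 1"
  by (simp add: char2_def)

lemma periodic_char2: "periodic (char2 k)"
proof -
  have "char2 k (x + m) = char2 k x" if "\<forall>i. m $ i \<in> \<int>" for x m
  proof -
    have "(\<Sum>i\<in>UNIV. of_int (k $ i) * m $ i) \<in> \<int>"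
      using that by (intro Ints_sum Ints_mult) auto
    then have "cis (2 * pi * (\<Sum>i\<in>UNIV. of_int (k $ i) * m $ i)) = 1"
      by (rule cis_multiple_2pi)
    then show ?thesis
      by (simp add: char2_def sum.distrib distrib_left flip: cis_mult)
  qed
  then show ?thesis by (simp add: periodic_def)
qed

lemma has_derivative_char2:
  "(char2 k has_derivative (\<lambda>h. 2 * pi * \<i> * (\<Sum>i\<in>UNIV. of_int (k $ i) * h $ i) * char2 k x)) (at x)"
proof -
  have "((\<lambda>x. 2 * pi * (\<Sum>i\<in>UNIV. of_int (k $ i) * x $ i)) has_derivative
      (\<lambda>h. 2 * pi * (\<Sum>i\<in>UNIV. of_int (k $ i) * h $ i))) (at x)"
    by (intro has_derivative_mult_right has_derivative_sum
        bounded_linear_imp_has_derivative[OF bounded_linear_vec_nth])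
  from has_derivative_cis[OF this]
  have "(char2 k has_derivative (\<lambda>h. (2 * pi * (\<Sum>i\<in>UNIV. of_int (k $ i) * h $ i)) *\<^sub>R (\<i> * char2 k x))) (at x)"
    unfolding char2_def[abs_def] .
  moreover have "(2 * pi * s) *\<^sub>R (\<i> * c) = 2 * pi * \<i> * s * c" for s :: real and c
    by (simp only: scaleR_conv_of_real of_real_mult mult_ac)
  ultimately show ?thesis by (simp only:)
qed

lemma continuous_char2: "continuous_on S (char2 k)"
  by (rule has_derivative_continuous_on) (rule has_derivative_at_withinI[OF has_derivative_char2])

lemma periodic_trig: "periodic (trig F a)"
  using periodic_char2 unfolding periodic_def trig_def by auto

lemma continuous_trig: "continuous_on S (trig F a)"
  unfolding trig_def by (intro continuous_intros continuous_char2)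

lemma trig_linear:
  "trig F (\<lambda>k. a k + b k) x = trig F a x + trig F b x"
  "trig F (\<lambda>k. a k - b k) x = trig F a x - trig F b x"
  "trig F (\<lambda>k. c * a k) x = c * trig F a x"
  by (simp_all add: trig_def algebra_simps sum.distrib sum_subtractf sum_distrib_left)

lemma has_derivative_trig:
  "(trig F a has_derivative (\<lambda>h. \<Sum>i\<in>UNIV. h $ i *\<^sub>R trig F (dcoef i a) x)) (at x)"
proof -
  have "(trig F a has_derivative
      (\<lambda>h. \<Sum>k\<in>F. a k * (2 * pi * \<i> * (\<Sum>i\<in>UNIV. of_int (k $ i) * h $ i) * char2 k x))) (at x)"
    unfolding trig_def[abs_def]
    by (intro has_derivative_sum has_derivative_mult_right has_derivative_char2)
  moreover have "(\<Sum>k\<in>F. a k * (2 * pi * \<i> * (\<Sum>i\<in>UNIV. of_int (k $ i) * h $ i) * char2 k x))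
      = (\<Sum>i\<in>UNIV. h $ i *\<^sub>R trig F (dcoef i a) x)" for h :: "real^2"
    by (simp add: trig_def dcoef_def sum_2 scaleR_conv_of_real algebra_simps sum_distrib_left sum.distrib)
  ultimately show ?thesis by simp
qed

lemma continuous_Re_trig: "continuous_on S (\<lambda>x. Re (trig F a x))"
  by (intro continuous_intros continuous_trig)

lemma periodic_Re_trig: "periodic (\<lambda>x. Re (trig F a x))"
  using periodic_trig[of F a] by (simp add: periodic_def)

lemma has_derivative_Re_trig:
  "((\<lambda>x. Re (trig F a x)) has_derivative (\<lambda>h. \<Sum>i\<in>UNIV. h $ i * Re (trig F (dcoef i a) x))) (at x)"
  using has_derivative_Re[OF has_derivative_trig[of F a x]] by simp

lemma sum_axis: "(\<Sum>i\<in>UNIV. axis j (1::real) $ i * f i) = f (j::'n::finite)"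
proof -
  have "(\<Sum>i\<in>UNIV. axis j (1::real) $ i * f i) = (\<Sum>i\<in>UNIV. if i = j then f i else 0)"
    by (rule sum.cong) (auto simp: axis_def)
  then show ?thesis by simp
qed

lemma grad_Re_trig: "grad (\<lambda>x. Re (trig F a x)) x $ i = Re (trig F (dcoef i a) x)"
  using frechet_derivative_at[OF has_derivative_Re_trig[of F a x], symmetric]
  by (simp add: grad_def sum_axis)

text \<open>A partial derivative only replaces the coefficients by their \<open>dcoef\<close>, so
  the induction on the order of smoothness runs over all coefficients at once.\<close>

lemma test_fun_Re_trig: "(\<lambda>x. Re (trig F a x)) \<in> test_fun"
proof -
  have "C_k n (\<lambda>x. Re (trig F a x))" for n
  proof (induction n arbitrary: a)
    case 0
    then show ?case by (simp add: continuous_Re_trig)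
  next
    case (Suc n)
    then show ?case
      using has_derivative_Re_trig unfolding C_k.simps(2) grad_Re_trig differentiable_def by blast
  qed
  then show ?thesis by (simp add: test_fun_def periodic_Re_trig)
qed

lemma continuous_test_fun:
  assumes "\<psi> \<in> test_fun"
  shows "continuous_on UNIV \<psi>" "continuous_on UNIV (\<lambda>x. grad \<psi> x $ i)"
  using assms C_k.simps(1)[of \<psi>] C_k.simps(1)[of "\<lambda>x. grad \<psi> x $ i"]
  unfolding test_fun_def by (force, metis (mono_tags, lifting) C_k.simps(2) mem_Collect_eq)

lemma has_derivative_test_fun:
  assumes "\<psi> \<in> test_fun"
  shows "(\<psi> has_derivative frechet_derivative \<psi> (at x)) (at x)"
    "frechet_derivative \<psi> (at x) (axis i 1) = grad \<psi> x $ i"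
proof -
  have "C_k (Suc 0) \<psi>" using assms unfolding test_fun_def by blast
  then have "\<psi> differentiable (at x)" by simp
  then show "(\<psi> has_derivative frechet_derivative \<psi> (at x)) (at x)"
    by (simp add: frechet_derivative_works)
qed (simp add: grad_def)

text \<open>The product with the test function is periodic, so its partial derivative integrates to
  0; the product rule splits it.\<close>

lemma integral_partial_Re_trig_mult:
  assumes "\<psi> \<in> test_fun"
  shows "(LINT x|torus. Re (trig F a x) * grad \<psi> x $ i) = - (LINT x|torus. Re (trig F (dcoef i a) x) * \<psi> x)"
proof -
  let ?u = "\<lambda>x. Re (trig F a x)" and ?du = "\<lambda>x. Re (trig F (dcoef i a) x)"
  note c = continuous_test_fun[OF assms] continuous_Re_trig
  have "(LINT x|torus. (?u x * frechet_derivative \<psi> (at x) (axis i 1)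
      + (\<Sum>j\<in>UNIV. axis i 1 $ j * Re (trig F (dcoef j a) x)) * \<psi> x)) = 0"
  proof (rule integral_partial_derivative_periodic)
    show "periodic (\<lambda>x. ?u x * \<psi> x)"
      using periodic_Re_trig[of F a] assms by (simp add: periodic_def test_fun_def)
    show "((\<lambda>x. ?u x * \<psi> x) has_derivative (\<lambda>h. ?u x * frechet_derivative \<psi> (at x) h
      + (\<Sum>j\<in>UNIV. h $ j * Re (trig F (dcoef j a) x)) * \<psi> x)) (at x)" for x
      by (rule has_derivative_mult[OF has_derivative_Re_trig has_derivative_test_fun(1)[OF assms]])
    show "continuous_on UNIV (\<lambda>x. ?u x * frechet_derivative \<psi> (at x) (axis i 1)
      + (\<Sum>j\<in>UNIV. axis i 1 $ j * Re (trig F (dcoef j a) x)) * \<psi> x)"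
      by (simp add: sum_axis has_derivative_test_fun(2)[OF assms]) (intro continuous_intros c)
  qed
  then have "(LINT x|torus. (?u x * grad \<psi> x $ i + ?du x * \<psi> x)) = 0"
    by (simp add: sum_axis has_derivative_test_fun(2)[OF assms])
  moreover have "integrable torus (\<lambda>x. ?u x * grad \<psi> x $ i)" "integrable torus (\<lambda>x. ?du x * \<psi> x)"
    by (intro integrable_torus_continuous continuous_intros c)+
  ultimately show ?thesis by simp
qed

text \<open>If \<open>k $ j\<close> is not 0, the character is a nonzero multiple of its own partial
  derivative in the direction \<open>j\<close>, whose integral vanishes.\<close>

lemma integral_char2: "(LINT x|torus. char2 k x) = (if k = 0 then 1 else 0)"
proof (cases "k = 0")
  case True
  then show ?thesis using measure_torus by simp
next
  case False
  then obtain j where j: "k $ j \<noteq> 0" by (auto simp: vec_eq_iff)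
  have *: "(\<Sum>i\<in>UNIV. of_int (k $ i) * axis j (1::real) $ i) = of_int (k $ j)"
    using sum_axis[of j "\<lambda>i. of_int (k $ i)"] by (simp add: mult.commute)
  have "(LINT x|torus. 2 * pi * \<i> * (\<Sum>i\<in>UNIV. of_int (k $ i) * axis j (1::real) $ i) * char2 k x) = 0"
    by (rule integral_partial_derivative_periodic[OF periodic_char2 has_derivative_char2])
       (intro continuous_intros continuous_char2)
  then show ?thesis using j False by (simp add: *)
qed

lemma integral_char2_mult_cnj:
  "(LINT x|torus. char2 k x * cnj (char2 m x)) = (if k = m then 1 else 0)"
  by (simp add: cnj_char2 char2_mult integral_char2)

section \<open>Uniqueness of Fourier coefficients\<close>

definition trig_poly :: "(real^2 \<Rightarrow> complex) \<Rightarrow> bool" where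
  "trig_poly f \<longleftrightarrow> (\<exists>F a. finite F \<and> f = trig F a)"

lemma trig_poly_monom: "trig_poly (\<lambda>x. c * char2 k x)"
  unfolding trig_poly_def by (rule exI[of _ "{k}"], rule exI[of _ "\<lambda>_. c"]) (auto simp: trig_def)

lemma trig_poly_const: "trig_poly (\<lambda>x. c)"
  using trig_poly_monom[of c 0] by simp

lemma trig_extend:
  assumes "finite G" "F \<subseteq> G"
  shows "trig F a = trig G (\<lambda>k. if k \<in> F then a k else 0)"
  unfolding trig_def using assms
  by (intro ext sum.mono_neutral_cong_left) auto

lemma trig_poly_add:
  assumes "trig_poly f" "trig_poly g"
  shows "trig_poly (\<lambda>x. f x + g x)"
proof -
  obtain F a G b where *: "finite F" "f = trig F a" "finite G" "g = trig G b"
    using assms unfolding trig_poly_def by blast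
  have "trig F a x + trig G b x
      = trig (F \<union> G) (\<lambda>k. (if k \<in> F then a k else 0) + (if k \<in> G then b k else 0)) x" for x
    unfolding trig_linear using * by (simp flip: trig_extend)
  then show ?thesis
    unfolding trig_poly_def * using * by blast
qed

lemma trig_poly_sum:
  assumes "finite I" "\<And>i. i \<in> I \<Longrightarrow> trig_poly (f i)"
  shows "trig_poly (\<lambda>x. \<Sum>i\<in>I. f i x)"
  using assms by (induction I rule: finite_induct) (auto intro: trig_poly_const trig_poly_add)

lemma trig_poly_mult:
  assumes "trig_poly f" "trig_poly g"
  shows "trig_poly (\<lambda>x. f x * g x)"
proof -
  obtain F a G b where *: "finite F" "f = trig F a" "finite G" "g = trig G b"
    using assms unfolding trig_poly_def by blast
  have "trig F a x * trig G b x = (\<Sum>k\<in>F. \<Sum>m\<in>G. (a k * b m) * char2 (k + m) x)" for x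
    by (simp add: trig_def sum_product mult_ac flip: char2_mult)
  moreover have "trig_poly (\<lambda>x. \<Sum>k\<in>F. \<Sum>m\<in>G. (a k * b m) * char2 (k + m) x)"
    by (intro trig_poly_sum trig_poly_monom *)
  ultimately show ?thesis using * by simp
qed

text \<open>Embeds the torus into a Euclidean space, where the polynomials are dense in the continuous
  functions; their pullbacks are trigonometric polynomials.\<close>

definition cis2 :: "real^2 \<Rightarrow> complex^2" where
  "cis2 x = (\<chi> i. cis (2 * pi * x $ i))"

lemma continuous_cis2: "continuous_on S cis2"
  unfolding cis2_def[abs_def] by (intro continuous_intros continuous_on_vec_lambda)

lemma cis_eq_char2: "cis (2 * pi * x $ i) = char2 (axis i 1) x"
proof -
  have "(\<Sum>j\<in>UNIV. real_of_int (axis i 1 $ j) * x $ j) = (\<Sum>j\<in>UNIV. axis i (1::real) $ j * x $ j)"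
    by (rule sum.cong) (auto simp: axis_def)
  then show ?thesis unfolding char2_def by (simp add: sum_axis)
qed

lemma cis2_nth: "cis2 x $ i = char2 (axis i 1) x"
  by (simp add: cis2_def cis_eq_char2)

lemma of_real_Re_char2: "complex_of_real (Re (char2 k x)) = char2 k x / 2 + char2 (- k) x / 2"
  by (simp add: complex_eq_iff flip: cnj_char2)

lemma of_real_Im_char2:
  "complex_of_real (Im (char2 k x)) = char2 k x / (2 * \<i>) + (- char2 (- k) x / (2 * \<i>))"
  by (simp add: complex_eq_iff flip: cnj_char2)

text \<open>Trigonometric polynomials form an algebra, so only linear functionals require a
  computation. At \<open>cis2 x\<close> these are combinations of the cosines and sines of the two
  coordinates.\<close>

lemma trig_poly_polynomial_cis2:
  assumes "real_polynomial_function \<phi>"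
  shows "trig_poly (\<lambda>x. complex_of_real (\<phi> (cis2 x)))"
  using assms
proof induction
  case (linear f)
  interpret f: bounded_linear f by fact
  \<comment> \<open>The functional is only real linear, so 1 and \<open>\<i>\<close> need separate
    coefficients in each coordinate.\<close>
  have ax: "axis i z = Re z *\<^sub>R axis i (1::complex) + Im z *\<^sub>R axis i \<i>" for i :: 2 and z
    by (auto simp: vec_eq_iff axis_def complex_eq_iff)
  have fax: "f (axis i w) = Re w * f (axis i 1) + Im w * f (axis i \<i>)" for i w
    by (subst ax[of i w]) (simp only: f.add f.scaleR real_scaleR_def)
  have rep: "f z = (\<Sum>i\<in>UNIV. Re (z $ i) * f (axis i 1) + Im (z $ i) * f (axis i \<i>))" for z :: "complex^2"
  proof -
    have "(\<Sum>i\<in>UNIV. axis i (z $ i)) = z"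
      by (auto simp: vec_eq_iff axis_def)
    moreover have "f (\<Sum>i\<in>UNIV. axis i (z $ i)) = (\<Sum>i\<in>UNIV. f (axis i (z $ i)))"
      by (rule f.sum)
    ultimately have "f z = (\<Sum>i\<in>UNIV. f (axis i (z $ i)))" by simp
    also have "\<dots> = (\<Sum>i\<in>UNIV. Re (z $ i) * f (axis i 1) + Im (z $ i) * f (axis i \<i>))"
      by (rule sum.cong[OF refl fax])
    finally show ?thesis .
  qed
  have "complex_of_real (f (cis2 x)) = (\<Sum>i\<in>UNIV. (f (axis i 1) / 2 * char2 (axis i 1) x + f (axis i 1) / 2 * char2 (- axis i 1) x)
      + (f (axis i \<i>) / (2 * \<i>) * char2 (axis i 1) x + (- f (axis i \<i>) / (2 * \<i>)) * char2 (- axis i 1) x))" for x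
    unfolding rep[of "cis2 x"]
    by (simp add: cis2_nth of_real_Re_char2 of_real_Im_char2 algebra_simps)
  moreover have "trig_poly (\<lambda>x. \<Sum>i\<in>UNIV. (f (axis i 1) / 2 * char2 (axis i 1) x + f (axis i 1) / 2 * char2 (- axis i 1) x)
      + (f (axis i \<i>) / (2 * \<i>) * char2 (axis i 1) x + (- f (axis i \<i>) / (2 * \<i>)) * char2 (- axis i 1) x))"
    by (intro trig_poly_sum trig_poly_add trig_poly_monom finite)
  ultimately show ?case by simp
next
  case (const c)
  then show ?case by (rule trig_poly_const)
next
  case (add f g)
  then show ?case by (auto intro: trig_poly_add)
next
  case (mult f g)
  then show ?case by (auto intro: trig_poly_mult)
qed

lemma integral_mult_trig_poly_eq_0:
  assumes g: "integrable torus g" and coef: "\<And>k. (LINT x|torus. g x * char2 k x) = 0"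
    and f: "trig_poly f"
  shows "(LINT x|torus. g x * f x) = 0"
proof -
  obtain F a where *: "finite F" "f = trig F a" using f unfolding trig_poly_def by blast
  have [measurable]: "g \<in> borel_measurable torus" "char2 k \<in> borel_measurable torus" for k
    using g borel_measurable_torus[OF continuous_char2] by auto
  have i: "integrable torus (\<lambda>x. g x * char2 k x)" for k
    by (rule Bochner_Integration.integrable_bound[OF g]) (auto simp: norm_mult)
  have "(LINT x|torus. g x * f x) = (LINT x|torus. (\<Sum>k\<in>F. a k * (g x * char2 k x)))"
    by (simp add: * trig_def sum_distrib_left mult_ac)
  also have "\<dots> = 0" by (subst Bochner_Integration.integral_sum) (use i coef in auto)
  finally show ?thesis .
qed

text \<open>By Stone-Weierstrass, \<open>\<phi>\<close> is uniformly close to a polynomial on the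
  compact image of the square. The polynomial integrates to 0 against \<open>g\<close>, and the
  error is at most \<open>e\<close> times the norm of \<open>g\<close> in the mean.\<close>

lemma integral_mult_continuous_cis2_eq_0:
  fixes \<phi> :: "complex^2 \<Rightarrow> real"
  assumes g: "integrable torus g" and coef: "\<And>k. (LINT x|torus. g x * char2 k x) = 0"
    and \<phi>: "continuous_on UNIV \<phi>"
  shows "(LINT x|torus. g x * complex_of_real (\<phi> (cis2 x))) = 0"
proof -
  have [measurable]: "g \<in> borel_measurable torus" using g by auto
  have meas: "(\<lambda>x. complex_of_real (\<psi> (cis2 x))) \<in> borel_measurable torus"
    if "continuous_on UNIV \<psi>" for \<psi> :: "complex^2 \<Rightarrow> real"
    by (intro borel_measurable_torus continuous_intros continuous_on_compose2[OF that] continuous_cis2) auto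
  have int: "integrable torus (\<lambda>x. g x * complex_of_real (\<psi> (cis2 x)))"
    if c: "continuous_on UNIV \<psi>" for \<psi> :: "complex^2 \<Rightarrow> real"
  proof -
    have "continuous_on UNIV (\<lambda>x. \<psi> (cis2 x))"
      by (intro continuous_on_compose2[OF c] continuous_cis2) auto
    from bounded_on_torus[OF this] obtain B where B: "\<And>x. x \<in> space torus \<Longrightarrow> norm (\<psi> (cis2 x)) \<le> B" by blast
    show ?thesis
    proof (rule Bochner_Integration.integrable_bound)
      show "integrable torus (\<lambda>x. B * norm (g x))" using g by auto
      show "AE x in torus. norm (g x * complex_of_real (\<psi> (cis2 x))) \<le> norm (B * norm (g x))"
      proof (rule AE_I2)
        fix x assume "x \<in> space torus"
        from B[OF this] have "\<bar>\<psi> (cis2 x)\<bar> \<le> \<bar>B\<bar>" by simp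
        then have "\<bar>\<psi> (cis2 x)\<bar> * norm (g x) \<le> \<bar>B\<bar> * norm (g x)" by (rule mult_right_mono) simp
        then show "norm (g x * complex_of_real (\<psi> (cis2 x))) \<le> norm (B * norm (g x))"
          by (simp add: norm_mult abs_mult mult.commute)
      qed
    qed (use meas[OF c] in measurable)
  qed
  have "norm (LINT x|torus. g x * complex_of_real (\<phi> (cis2 x))) \<le> e * (LINT x|torus. norm (g x))" if "e > 0" for e
  proof -
    have "compact (cis2 ` cbox 0 1)" by (intro compact_continuous_image continuous_cis2) auto
    then obtain p where p: "real_polynomial_function p"
      and pe: "\<And>y. y \<in> cis2 ` cbox 0 1 \<Longrightarrow> \<bar>\<phi> y - p y\<bar> < e"
      using Stone_Weierstrass_real_polynomial_function[of "cis2 ` cbox 0 1" \<phi> e] \<phi> \<open>e > 0\<close>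
      by (metis continuous_on_subset subset_UNIV)
    have pc: "continuous_on UNIV p" using p continuous_on_polymonial_function real_polynomial_function_eq by blast
    have dc: "continuous_on UNIV (\<lambda>y. \<phi> y - p y)" using \<phi> pc by (intro continuous_intros)
    have "(LINT x|torus. g x * complex_of_real (\<phi> (cis2 x)))
        = (LINT x|torus. g x * complex_of_real (\<phi> (cis2 x))) - (LINT x|torus. g x * complex_of_real (p (cis2 x)))"
      using integral_mult_trig_poly_eq_0[OF g coef trig_poly_polynomial_cis2[OF p]] by simp
    also have "\<dots> = (LINT x|torus. g x * complex_of_real (\<phi> (cis2 x) - p (cis2 x)))"
      using int[OF \<phi>] int[OF pc] by (subst Bochner_Integration.integral_diff[symmetric]) (auto simp: algebra_simps)
    also have "norm \<dots> \<le> (LINT x|torus. norm (g x * complex_of_real (\<phi> (cis2 x) - p (cis2 x))))"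
      by (rule integral_norm_bound)
    also have "\<dots> \<le> (LINT x|torus. e * norm (g x))"
    proof (rule integral_mono)
      show "integrable torus (\<lambda>x. norm (g x * complex_of_real (\<phi> (cis2 x) - p (cis2 x))))"
        using int[OF dc] by (rule integrable_norm)
      show "integrable torus (\<lambda>x. e * norm (g x))" using g by auto
      fix x assume "x \<in> space torus"
      then have "\<bar>\<phi> (cis2 x) - p (cis2 x)\<bar> \<le> e" using pe by (auto simp: space_torus less_imp_le)
      then have "\<bar>\<phi> (cis2 x) - p (cis2 x)\<bar> * norm (g x) \<le> e * norm (g x)" by (rule mult_right_mono) simp
      then show "norm (g x * complex_of_real (\<phi> (cis2 x) - p (cis2 x))) \<le> e * norm (g x)"
        by (simp add: norm_mult mult.commute flip: of_real_diff)
    qed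
    also have "\<dots> = e * (LINT x|torus. norm (g x))" by simp
    finally show ?thesis .
  qed
  note bnd = this
  define I where "I = (LINT x|torus. norm (g x))"
  have I0: "I \<ge> 0" unfolding I_def by simp
  have "norm (LINT x|torus. g x * complex_of_real (\<phi> (cis2 x))) \<le> 0"
  proof (rule field_le_epsilon)
    fix e :: real assume "e > 0"
    \<comment> \<open>Division by \<open>I + 1\<close> rather than by \<open>I\<close>, which may be
      0.\<close>
    then have "norm (LINT x|torus. g x * complex_of_real (\<phi> (cis2 x))) \<le> e / (I + 1) * I"
      using bnd[of "e / (I + 1)"] I0 unfolding I_def by simp
    also have "\<dots> \<le> 0 + e" using \<open>e > 0\<close> I0 by (simp add: field_simps)
    finally show "norm (LINT x|torus. g x * complex_of_real (\<phi> (cis2 x))) \<le> 0 + e" .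
  qed
  then show ?thesis by simp
qed

text \<open>Opposite boundary points have the same image. With one point in the open square the
  coordinates differ by an integer of absolute value below 1.\<close>

lemma cis2_inj:
  assumes eq: "cis2 x = cis2 y" and x: "x \<in> cbox 0 1" and y: "y \<in> box 0 1"
  shows "x = y"
proof (rule vec_eq_iff[THEN iffD2], rule allI)
  fix i
  have "cis (2 * pi * x $ i) = cis (2 * pi * y $ i)" using eq by (auto simp: cis2_def vec_eq_iff)
  then obtain n where "2 * pi * x $ i = 2 * pi * y $ i + 2 * pi * of_int n"
    by (metis cis.sel sin_cos_eq_iff)
  then have "2 * pi * (x $ i - y $ i - of_int n) = 0" by (simp add: algebra_simps)
  then have n: "x $ i - y $ i = of_int n" by simp
  have "\<bar>x $ i - y $ i\<bar> < 1" using x y by (auto simp: mem_box_cart dest!: spec[of _ i])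
  then have "n = 0" unfolding n by linarith
  then show "x $ i = y $ i" using n by simp
qed

lemma integral_mult_indicator_compact_eq_0:
  assumes g: "integrable torus g" and coef: "\<And>k. (LINT x|torus. g x * char2 k x) = 0"
    and K: "compact K" "K \<subseteq> box 0 1"
  shows "(LINT x|torus. g x * indicator K x) = 0"
proof (cases "K = {}")
  case False
  have [measurable]: "g \<in> borel_measurable torus" using g by auto
  have cK: "closed (cis2 ` K)" using K by (intro compact_imp_closed compact_continuous_image continuous_cis2)
  define \<phi> where "\<phi> n y = max 0 (1 - real n * infdist y (cis2 ` K))" for n y
  have c\<phi>: "continuous_on UNIV (\<phi> n)" for n unfolding \<phi>_def[abs_def] by (intro continuous_intros)
  have "(\<lambda>n. LINT x|torus. g x * complex_of_real (\<phi> n (cis2 x))) \<longlonglongrightarrow> (LINT x|torus. g x * indicator K x)"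
  proof (rule integral_dominated_convergence)
    show "integrable torus (\<lambda>x. norm (g x))" using g by auto
    have "(\<lambda>x. complex_of_real (\<phi> n (cis2 x))) \<in> borel_measurable torus" for n
      by (intro borel_measurable_torus continuous_intros continuous_on_compose2[OF c\<phi>] continuous_cis2) auto
    then show "(\<lambda>x. g x * complex_of_real (\<phi> n (cis2 x))) \<in> borel_measurable torus" for n by measurable
    have "K \<inter> space torus \<in> sets torus"
      unfolding torus_def using K by (auto simp: sets_restrict_space_iff lmeasurable_compact fmeasurableD)
    then have [measurable]: "(indicator K :: _ \<Rightarrow> complex) \<in> borel_measurable torus"
      by (simp add: borel_measurable_indicator_iff)
    show "(\<lambda>x. g x * indicator K x) \<in> borel_measurable torus" by measurable
    show "AE x in torus. (\<lambda>n. g x * complex_of_real (\<phi> n (cis2 x))) \<longlonglongrightarrow> g x * indicator K x"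
    proof (rule AE_I2)
      fix x assume "x \<in> space torus"
      then have x: "x \<in> cbox 0 1" by (simp add: space_torus)
      have "(\<lambda>n. \<phi> n (cis2 x)) \<longlonglongrightarrow> indicator K x"
      proof (cases "x \<in> K")
        case True
        then show ?thesis by (simp add: \<phi>_def)
      next
        case nK: False
        have "cis2 x \<notin> cis2 ` K" using cis2_inj[OF _ x] K(2) nK by auto
        then have pos: "infdist (cis2 x) (cis2 ` K) > 0"
          using cK False by (simp add: infdist_pos_not_in_closed)
        obtain N where N: "real N * infdist (cis2 x) (cis2 ` K) > 1"
          using reals_Archimedean3[OF pos] by blast
        have "\<phi> n (cis2 x) = 0" if "n \<ge> N" for n
        proof -
          have "real N * infdist (cis2 x) (cis2 ` K) \<le> real n * infdist (cis2 x) (cis2 ` K)"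
            using that pos by (intro mult_right_mono) auto
          then show ?thesis using N by (simp add: \<phi>_def)
        qed
        then have "\<forall>\<^sub>F n in sequentially. \<phi> n (cis2 x) = 0"
          unfolding eventually_sequentially by blast
        then show ?thesis using nK by (simp add: tendsto_eventually)
      qed
      then have "(\<lambda>n. g x * complex_of_real (\<phi> n (cis2 x))) \<longlonglongrightarrow> g x * complex_of_real (indicator K x)"
        by (intro tendsto_intros)
      then show "(\<lambda>n. g x * complex_of_real (\<phi> n (cis2 x))) \<longlonglongrightarrow> g x * indicator K x"
        by (cases "x \<in> K") auto
    qed
    show "AE x in torus. norm (g x * complex_of_real (\<phi> n (cis2 x))) \<le> norm (g x)" for n
    proof (rule AE_I2)
      fix x
      have "0 \<le> \<phi> n (cis2 x)" "\<phi> n (cis2 x) \<le> 1" by (auto simp: \<phi>_def infdist_nonneg)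
      then show "norm (g x * complex_of_real (\<phi> n (cis2 x))) \<le> norm (g x)"
        by (simp add: norm_mult mult_left_le)
    qed
  qed
  moreover have "(LINT x|torus. g x * complex_of_real (\<phi> n (cis2 x))) = 0" for n
    by (rule integral_mult_continuous_cis2_eq_0[OF g coef c\<phi>])
  ultimately show ?thesis by (simp add: LIMSEQ_const_iff)
qed simp

text \<open>On a closed subset of the part \<open>A\<close> of the open square where the real part
  is positive, a positive integrand has integral 0, so the subset is null. Inner regularity of
  Lebesgue measure then makes \<open>A\<close> null, and so is the boundary of the square.\<close>

lemma AE_Re_nonpos_of_fourier_coefficients:
  assumes g: "integrable torus g" and coef: "\<And>k. (LINT x|torus. g x * char2 k x) = 0"
  shows "AE x in torus. Re (g x) \<le> 0"
proof -
  have [measurable]: "g \<in> borel_measurable torus" using g by auto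
  define A where "A = {x \<in> space torus. Re (g x) > 0} \<inter> box 0 1"
  have "{x \<in> space torus. Re (g x) > 0} \<in> sets torus" by measurable
  then have A: "A \<in> sets lebesgue"
    unfolding A_def torus_def by (subst (asm) sets_restrict_space_iff) auto
  have null: "emeasure lebesgue K = 0" if K: "closed K" "K \<subseteq> A" for K
  proof -
    have Kb: "K \<subseteq> box 0 1" using K by (auto simp: A_def)
    have cK: "compact K" using K(1) bounded_subset[OF bounded_box Kb] by (simp add: compact_eq_bounded_closed)
    have Kc: "K \<subseteq> space torus" using K(2) by (auto simp: A_def)
    have Ks[measurable]: "K \<in> sets torus"
      using K Kc unfolding torus_def
      by (subst sets_restrict_space_iff) (auto intro: borel_closed)
    have i: "integrable torus (\<lambda>x. g x * indicator K x)"
      by (rule Bochner_Integration.integrable_bound[OF g]) (auto simp: indicator_def)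
    have nn: "0 \<le> Re (g x) * indicator K x" for x using K(2) by (auto simp: A_def indicator_def)
    have "(LINT x|torus. Re (g x) * indicator K x) = Re (LINT x|torus. g x * indicator K x)"
      by (subst integral_Re[OF i, symmetric]) (auto intro!: Bochner_Integration.integral_cong simp: indicator_def)
    then have z: "(LINT x|torus. Re (g x) * indicator K x) = 0"
      using integral_mult_indicator_compact_eq_0[OF g coef cK Kb] by simp
    have i2: "integrable torus (\<lambda>x. Re (g x) * indicator K x)"
      by (rule Bochner_Integration.integrable_bound[OF g]) (auto simp: indicator_def abs_Re_le_cmod)
    have "AE x in torus. Re (g x) * indicator K x = 0"
      using integral_nonneg_eq_0_iff_AE[OF i2] z nn by simp
    then have "AE x in torus. x \<notin> K"
      by eventually_elim (use K(2) in \<open>auto simp: A_def indicator_def split: if_splits\<close>)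
    then have "emeasure torus K = 0"
      using AE_iff_measurable[OF Ks, of "\<lambda>x. x \<notin> K"] Kc by auto
    then show ?thesis
      using Kc unfolding torus_def by (subst (asm) emeasure_restrict_space) (auto simp: space_torus[unfolded torus_def])
  qed
  have "emeasure lebesgue A \<le> ennreal e" if "e > 0" for e
  proof -
    obtain T where T: "closed T" "T \<subseteq> A" "A - T \<in> lmeasurable" "emeasure lebesgue (A - T) < ennreal e"
      using sets_lebesgue_inner_closed[OF A \<open>e > 0\<close>] by blast
    have "emeasure lebesgue A = emeasure lebesgue (T \<union> (A - T))" using T(2) by (simp add: Un_absorb1)
    also have "\<dots> \<le> emeasure lebesgue T + emeasure lebesgue (A - T)"
      using T by (intro emeasure_subadditive) auto
    also have "\<dots> \<le> ennreal e" using null[OF T(1,2)] T(4) by simp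
    finally show ?thesis .
  qed
  then have "emeasure lebesgue A = 0"
    by (metis ennreal_le_epsilon add_0 le_zero_eq)
  then have "A \<in> null_sets lebesgue" using A by auto
  moreover have "cbox 0 1 - box 0 1 \<in> null_sets (lebesgue :: (real^2) measure)"
    using null_sets_cbox_Diff_box by (rule null_sets_completionI)
  ultimately have "A \<union> (cbox 0 1 - box 0 1) \<in> null_sets lebesgue" by blast
  then have "AE x in lebesgue. x \<notin> A \<union> (cbox 0 1 - box 0 1)" by (rule AE_not_in)
  then have "AE x in lebesgue. x \<in> cbox 0 1 \<longrightarrow> Re (g x) \<le> 0"
    by (rule eventually_mono) (auto simp: A_def space_torus not_less)
  then show ?thesis
    unfolding torus_def by (subst AE_restrict_space_iff) simp_all
qed

theorem fourier_uniqueness: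
  assumes g: "integrable torus g" and coef: "\<And>k. (LINT x|torus. g x * char2 k x) = 0"
  shows "AE x in torus. g x = 0"
proof -
  have *: "AE x in torus. Re (c * g x) \<le> 0" for c
    by (rule AE_Re_nonpos_of_fourier_coefficients) (use g coef in \<open>auto simp: mult.assoc\<close>)
  show ?thesis
    \<comment> \<open>The four factors bound the real and the imaginary part from both
      sides.\<close>
    using *[of 1] *[of "-1"] *[of "\<i>"] *[of "-\<i>"]
    by eventually_elim (auto simp: complex_eq_iff)
qed

section \<open>Fourier series in the mean square\<close>

text \<open>Partial sums are taken over squares. Convergence in the mean square relies only on these
  being finite sets which increase to the whole lattice.\<close>

definition freqs :: "nat \<Rightarrow> (int^2) set" where
  "freqs n = {k. \<forall>i. \<bar>k $ i\<bar> \<le> int n}"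

definition fcoef :: "(real^2 \<Rightarrow> complex) \<Rightarrow> int^2 \<Rightarrow> complex" where
  "fcoef f k = (LINT x|torus. f x * cnj (char2 k x))"

lemma finite_freqs [simp]: "finite (freqs n)"
proof -
  have "inj_on vec_nth (freqs n)" by (auto simp: inj_on_def vec_eq_iff)
  moreover have "vec_nth ` freqs n \<subseteq> PiE UNIV (\<lambda>_. {-int n..int n})"
    by (auto simp: freqs_def abs_le_iff minus_le_iff)
  moreover have "finite (PiE (UNIV :: 2 set) (\<lambda>_. {-int n..int n}))" by (rule finite_PiE) auto
  ultimately show ?thesis by (meson finite_imageD finite_subset)
qed

lemma freqs_mono: "m \<le> n \<Longrightarrow> freqs m \<subseteq> freqs n"
  unfolding freqs_def by (auto intro: order_trans[of _ "int m" "int n"])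

lemma eventually_in_freqs: "\<forall>\<^sub>F n in sequentially. k \<in> freqs n"
proof -
  have "k \<in> freqs n" if "n \<ge> nat (Max (range (\<lambda>i. \<bar>k $ i\<bar>)))" for n
  proof -
    have "\<bar>k $ i\<bar> \<le> Max (range (\<lambda>i. \<bar>k $ i\<bar>))" for i by (rule Max_ge) auto
    moreover have "Max (range (\<lambda>i. \<bar>k $ i\<bar>)) \<le> int n" using that by (simp add: nat_le_iff)
    ultimately show ?thesis unfolding freqs_def by (blast intro: order_trans)
  qed
  then show ?thesis unfolding eventually_sequentially by blast
qed

lemma measurable_trig [measurable]: "trig F a \<in> borel_measurable torus"
  by (rule borel_measurable_torus[OF continuous_trig])

lemma measurable_char2 [measurable]: "char2 k \<in> borel_measurable torus"
  by (rule borel_measurable_torus[OF continuous_char2])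

lemma measurable_cnj [measurable (raw)]: "f \<in> borel_measurable M \<Longrightarrow> (\<lambda>x. cnj (f x)) \<in> borel_measurable M"
  by (rule measurable_compose[of f M borel cnj])
     (auto intro!: borel_measurable_continuous_onI continuous_intros)

lemma integrable_trig_power: "integrable torus (\<lambda>x. (norm (trig F a x)) ^ p)"
  by (intro integrable_torus_continuous continuous_intros continuous_trig)

lemma integrable_char2_power: "integrable torus (\<lambda>x. (norm (char2 k x)) ^ p)"
  by (intro integrable_torus_continuous continuous_intros continuous_char2)

lemma fcoef_trig:
  assumes "finite F"
  shows "fcoef (trig F a) k = (if k \<in> F then a k else 0)"
proof -
  have "fcoef (trig F a) k = (LINT x|torus. (\<Sum>m\<in>F. a m * (char2 m x * cnj (char2 k x))))"
    by (simp add: fcoef_def trig_def sum_distrib_right mult.assoc)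
  also have "\<dots> = (\<Sum>m\<in>F. (LINT x|torus. a m * (char2 m x * cnj (char2 k x))))"
    by (rule Bochner_Integration.integral_sum, intro integrable_torus_continuous continuous_intros continuous_char2)
  also have "\<dots> = (\<Sum>m\<in>F. if m = k then a m else 0)"
    by (simp add: integral_char2_mult_cnj if_distrib cong: if_cong)
  finally show ?thesis using assms by simp
qed

lemma integrable_mult_cnj_char2:
  assumes "integrable torus f"
  shows "integrable torus (\<lambda>x. f x * cnj (char2 k x))"
proof -
  have [measurable]: "f \<in> borel_measurable torus" using assms by auto
  show ?thesis by (rule Bochner_Integration.integrable_bound[OF assms]) (auto simp: norm_mult)
qed

lemma integral_mult_cnj_trig:
  assumes f: "integrable torus f"
  shows "(LINT x|torus. f x * cnj (trig F a x)) = (\<Sum>k\<in>F. fcoef f k * cnj (a k))"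
proof -
  have "(LINT x|torus. f x * cnj (trig F a x)) = (LINT x|torus. (\<Sum>k\<in>F. cnj (a k) * (f x * cnj (char2 k x))))"
    by (simp add: trig_def sum_distrib_left mult_ac)
  also have "\<dots> = (\<Sum>k\<in>F. (LINT x|torus. cnj (a k) * (f x * cnj (char2 k x))))"
    by (rule Bochner_Integration.integral_sum) (use integrable_mult_cnj_char2[OF f] in simp)
  finally show ?thesis by (simp add: fcoef_def mult.commute)
qed

lemma parseval_trig:
  assumes "finite F"
  shows "(LINT x|torus. (norm (trig F a x))\<^sup>2) = (\<Sum>k\<in>F. (norm (a k))\<^sup>2)"
proof -
  have "complex_of_real (LINT x|torus. (norm (trig F a x))\<^sup>2) = (LINT x|torus. trig F a x * cnj (trig F a x))"
    by (simp only: integral_complex_of_real[symmetric] complex_norm_square)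
  also have "\<dots> = (\<Sum>k\<in>F. fcoef (trig F a) k * cnj (a k))"
    by (rule integral_mult_cnj_trig, rule integrable_torus_continuous, rule continuous_trig)
  also have "\<dots> = complex_of_real (\<Sum>k\<in>F. (norm (a k))\<^sup>2)"
    by (simp add: fcoef_trig[OF assms] flip: complex_norm_square)
  finally show ?thesis by (simp only: of_real_eq_iff)
qed

text \<open>Expands the squared distance of \<open>f\<close> to its partial sum \<open>s\<close>;
  the pairing of \<open>f\<close> with \<open>s\<close> and the squared norm of \<open>s\<close> are
  the same sum of coefficients.\<close>

lemma bessel:
  assumes [measurable]: "f \<in> borel_measurable torus"
    and f2: "integrable torus (\<lambda>x. (norm (f x))\<^sup>2)" and F: "finite F"
  shows "(\<Sum>k\<in>F. (norm (fcoef f k))\<^sup>2) \<le> (LINT x|torus. (norm (f x))\<^sup>2)"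
proof -
  define s where "s = trig F (fcoef f)"
  have [measurable]: "s \<in> borel_measurable torus" by (simp add: s_def)
  have s2: "integrable torus (\<lambda>x. (norm (s x))\<^sup>2)" unfolding s_def by (rule integrable_trig_power)
  have fs: "integrable torus (\<lambda>x. f x * cnj (s x))"
    by (rule integrable_mult_L2) (use f2 s2 in auto)
  have f1: "integrable torus f" by (rule torus.L2_imp_integrable[OF _ f2]) simp
  define R where "R x = Re (f x * cnj (s x))" for x
  have R: "integrable torus R" "(LINT x|torus. R x) = Re (LINT x|torus. f x * cnj (s x))"
    unfolding R_def[abs_def] using fs by (simp_all only: integrable_Re integral_Re)
  have eq: "(norm (f x - s x))\<^sup>2 = (norm (f x))\<^sup>2 - 2 * R x + (norm (s x))\<^sup>2" for x
    unfolding cmod_power2 R_def by (simp add: power2_eq_square algebra_simps)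
  have "0 \<le> (LINT x|torus. (norm (f x - s x))\<^sup>2)" by simp
  also have "\<dots> = (LINT x|torus. (norm (f x))\<^sup>2) - 2 * Re (LINT x|torus. f x * cnj (s x)) + (LINT x|torus. (norm (s x))\<^sup>2)"
    unfolding eq R(2)[symmetric] using f2 s2 R(1) by simp
  also have "(LINT x|torus. f x * cnj (s x)) = complex_of_real (\<Sum>k\<in>F. (norm (fcoef f k))\<^sup>2)"
    unfolding s_def integral_mult_cnj_trig[OF f1] by (simp flip: complex_norm_square)
  also have "(LINT x|torus. (norm (s x))\<^sup>2) = (\<Sum>k\<in>F. (norm (fcoef f k))\<^sup>2)"
    unfolding s_def by (rule parseval_trig[OF F])
  finally show ?thesis by simp
qed

lemma (in finite_measure) tendsto_integral_mult_L2:
  fixes f :: "nat \<Rightarrow> 'a \<Rightarrow> 'b::{real_normed_algebra, banach, second_countable_topology}"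
  assumes [measurable]: "\<And>n. f n \<in> borel_measurable M" "h \<in> borel_measurable M" "g \<in> borel_measurable M"
    and f2: "\<And>n. integrable M (\<lambda>x. (norm (f n x))\<^sup>2)" and h2: "integrable M (\<lambda>x. (norm (h x))\<^sup>2)"
    and g2: "integrable M (\<lambda>x. (norm (g x))\<^sup>2)"
    and lim: "(\<lambda>n. LINT x|M. (norm (f n x - h x))\<^sup>2) \<longlonglongrightarrow> 0"
  shows "(\<lambda>n. LINT x|M. f n x * g x) \<longlonglongrightarrow> (LINT x|M. h x * g x)"
proof (rule LIM_zero_cancel, rule Lim_null_comparison)
  have i: "integrable M (\<lambda>x. f n x * g x)" "integrable M (\<lambda>x. h x * g x)" for n
    by (intro integrable_mult_L2 f2 h2 g2; measurable)+
  have d2: "integrable M (\<lambda>x. (norm (f n x - h x))\<^sup>2)" for n by (intro L2_diff f2 h2) measurable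
  have "norm ((LINT x|M. f n x * g x) - (LINT x|M. h x * g x))
      \<le> sqrt ((LINT x|M. (norm (f n x - h x))\<^sup>2) * (LINT x|M. (norm (g x))\<^sup>2))" for n
  proof -
    have "(LINT x|M. f n x * g x) - (LINT x|M. h x * g x) = (LINT x|M. (f n x - h x) * g x)"
      using i by (simp add: left_diff_distrib)
    also have "norm \<dots> \<le> sqrt ((LINT x|M. (norm (f n x - h x))\<^sup>2) * (LINT x|M. (norm (g x))\<^sup>2))"
      by (intro norm_integral_mult_le d2 g2) measurable
    finally show ?thesis .
  qed
  then show "\<forall>\<^sub>F n in sequentially. norm ((LINT x|M. f n x * g x) - (LINT x|M. h x * g x))
      \<le> sqrt ((LINT x|M. (norm (f n x - h x))\<^sup>2) * (LINT x|M. (norm (g x))\<^sup>2))" by simp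
  show "(\<lambda>n. sqrt ((LINT x|M. (norm (f n x - h x))\<^sup>2) * (LINT x|M. (norm (g x))\<^sup>2))) \<longlonglongrightarrow> 0"
    using tendsto_real_sqrt[OF tendsto_mult_left_zero[OF lim, of "LINT x|M. (norm (g x))\<^sup>2"]] by simp
qed

text \<open>By Parseval, the squared distance of two partial sums is the difference of two terms of
  a bounded increasing sequence, so completeness yields a limit. Each coefficient of the partial
  sums is eventually constant.\<close>

lemma Riesz_Fischer:
  assumes bnd: "\<And>n. (\<Sum>k\<in>freqs n. (norm (a k))\<^sup>2) \<le> C"
  obtains h where "periodic h" "h \<in> borel_measurable torus" "integrable torus (\<lambda>x. (norm (h x))\<^sup>2)"
    "(\<lambda>n. LINT x|torus. (norm (trig (freqs n) a x - h x))\<^sup>2) \<longlonglongrightarrow> 0" "fcoef h = a"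
proof -
  define s where "s n = (\<Sum>k\<in>freqs n. (norm (a k))\<^sup>2)" for n
  have smono: "s m \<le> s n" if "m \<le> n" for m n
    unfolding s_def by (rule sum_mono2) (use freqs_mono[OF that] in auto)
  have "incseq s" using smono by (simp add: incseq_def)
  then obtain L where "s \<longlonglongrightarrow> L"
    by (rule incseq_convergent[where B = C]) (use bnd in \<open>auto simp: s_def\<close>)
  then have "convergent s" by (auto simp: convergent_def)
  then have Cs: "Cauchy s" by (rule convergent_Cauchy)
  have diff: "(LINT x|torus. (norm (trig (freqs m) a x - trig (freqs n) a x))\<^sup>2) = \<bar>s m - s n\<bar>" for m n
  proof (induction m n rule: linorder_wlog)
    case (le n m)
    have "trig (freqs m) a x - trig (freqs n) a x = trig (freqs m - freqs n) a x" for x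
      unfolding trig_def by (rule sum_diff[symmetric]) (use freqs_mono[OF le] in auto)
    then have "(LINT x|torus. (norm (trig (freqs m) a x - trig (freqs n) a x))\<^sup>2) = s m - s n"
      by (simp add: parseval_trig s_def sum_diff freqs_mono[OF le])
    then show ?case using smono[OF le] by (simp add: norm_minus_commute)
  next
    case (sym m n)
    then show ?case by (simp add: norm_minus_commute abs_minus_commute)
  qed
  have "\<exists>N. \<forall>m\<ge>N. \<forall>n\<ge>N. (LINT x|torus. (norm (trig (freqs m) a x - trig (freqs n) a x))\<^sup>2) < e" if "e > 0" for e
    unfolding diff using CauchyD[OF Cs that] by simp
  from torus.L2_complete[OF measurable_trig integrable_trig_power this] obtain h r where
    h: "h = (\<lambda>x. lim (\<lambda>j. trig (freqs (r j)) a x))" and hm[measurable]: "h \<in> borel_measurable torus"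
    and h2: "integrable torus (\<lambda>x. (norm (h x))\<^sup>2)"
    and lim: "(\<lambda>n. LINT x|torus. (norm (trig (freqs n) a x - h x))\<^sup>2) \<longlonglongrightarrow> 0"
    by blast
  \<comment> \<open>\<open>lim\<close> depends only on the sequence of values, which agree at
    equivalent points; this covers points of divergence as well.\<close>
  have "periodic h" using periodic_trig unfolding h periodic_def by simp
  moreover have "fcoef h k = a k" for k
  proof -
    have "(\<lambda>n. fcoef (trig (freqs n) a) k) \<longlonglongrightarrow> fcoef h k"
      unfolding fcoef_def
      by (rule torus.tendsto_integral_mult_L2[OF _ _ _ integrable_trig_power h2 _ lim])
         (use integrable_char2_power[of k 2] in auto)
    moreover have "(\<lambda>n. fcoef (trig (freqs n) a) k) \<longlonglongrightarrow> a k"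
      by (rule tendsto_eventually, rule eventually_mono[OF eventually_in_freqs[of k]]) (simp add: fcoef_trig)
    ultimately show ?thesis by (rule LIMSEQ_unique)
  qed
  ultimately show thesis using that hm h2 lim by blast
qed

text \<open>Bessel and Riesz-Fischer give convergence to some function with the coefficients of
  \<open>f\<close>, and uniqueness of the coefficients identifies it with \<open>f\<close> almost
  everywhere.\<close>

theorem fourier_L2_convergence:
  assumes [measurable]: "f \<in> borel_measurable torus" and f2: "integrable torus (\<lambda>x. (norm (f x))\<^sup>2)"
  shows "(\<lambda>n. LINT x|torus. (norm (trig (freqs n) (fcoef f) x - f x))\<^sup>2) \<longlonglongrightarrow> 0"
proof -
  obtain h where [measurable]: "h \<in> borel_measurable torus" and h2: "integrable torus (\<lambda>x. (norm (h x))\<^sup>2)"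
    and lim: "(\<lambda>n. LINT x|torus. (norm (trig (freqs n) (fcoef f) x - h x))\<^sup>2) \<longlonglongrightarrow> 0" and co: "fcoef h = fcoef f"
    using Riesz_Fischer[OF bessel[OF _ f2]] by auto
  have i: "integrable torus f" "integrable torus h"
    using f2 h2 by (auto intro: torus.L2_imp_integrable)
  have "AE x in torus. h x - f x = 0"
  proof (rule fourier_uniqueness)
    show "integrable torus (\<lambda>x. h x - f x)" using i by simp
    fix k
    have "(LINT x|torus. (h x - f x) * cnj (char2 (- k) x)) = fcoef h (- k) - fcoef f (- k)"
      unfolding fcoef_def left_diff_distrib
      by (intro Bochner_Integration.integral_diff integrable_mult_cnj_char2 i)
    then show "(LINT x|torus. (h x - f x) * char2 k x) = 0" by (simp add: co cnj_char2)
  qed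
  then have "(LINT x|torus. (norm (trig (freqs n) (fcoef f) x - h x))\<^sup>2)
      = (LINT x|torus. (norm (trig (freqs n) (fcoef f) x - f x))\<^sup>2)" for n
    by (intro integral_cong_AE) auto
  then show ?thesis using lim by simp
qed

text \<open>The real part makes this a real test function without an appeal to the symmetry of the
  coefficients. Taking real parts does not increase distances, so convergence is kept.\<close>

definition fourier_sum :: "(real^2 \<Rightarrow> real) \<Rightarrow> nat \<Rightarrow> real^2 \<Rightarrow> real" where
  "fourier_sum f n x = Re (trig (freqs n) (fcoef (\<lambda>y. complex_of_real (f y))) x)"

lemma tendsto_L2_Re:
  assumes [measurable]: "\<And>n. f n \<in> borel_measurable M" "h \<in> borel_measurable M"
    and f2: "\<And>n. integrable M (\<lambda>x. (norm (f n x))\<^sup>2)" and h2: "integrable M (\<lambda>x. (norm (h x))\<^sup>2)"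
    and lim: "(\<lambda>n. LINT x|M. (norm (f n x - h x))\<^sup>2) \<longlonglongrightarrow> 0"
  shows "(\<lambda>n. LINT x|M. (norm (Re (f n x) - Re (h x)))\<^sup>2) \<longlonglongrightarrow> 0"
proof (rule tendsto_sandwich[OF _ _ tendsto_const lim])
  show "\<forall>\<^sub>F n in sequentially. (LINT x|M. (norm (Re (f n x) - Re (h x)))\<^sup>2) \<le> (LINT x|M. (norm (f n x - h x))\<^sup>2)"
  proof (intro always_eventually allI)
    fix n
    have d2: "integrable M (\<lambda>x. (norm (f n x - h x))\<^sup>2)" by (intro L2_diff f2 h2) measurable
    have le: "(norm (Re (f n x) - Re (h x)))\<^sup>2 \<le> (norm (f n x - h x))\<^sup>2" for x
      using abs_Re_le_cmod[of "f n x - h x"] by (intro power_mono) auto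
    show "(LINT x|M. (norm (Re (f n x) - Re (h x)))\<^sup>2) \<le> (LINT x|M. (norm (f n x - h x))\<^sup>2)"
      by (intro integral_mono d2 le Bochner_Integration.integrable_bound[OF d2]) (use le in auto)
  qed
qed simp

lemma fourier_sum_tendsto_L2:
  assumes [measurable]: "f \<in> borel_measurable torus" and f2: "integrable torus (\<lambda>x. (norm (f x))\<^sup>2)"
  shows "(\<lambda>n. LINT x|torus. (norm (fourier_sum f n x - f x))\<^sup>2) \<longlonglongrightarrow> 0"
proof -
  have "(\<lambda>n. LINT x|torus. (norm (trig (freqs n) (fcoef (\<lambda>y. complex_of_real (f y))) x - complex_of_real (f x)))\<^sup>2) \<longlonglongrightarrow> 0"
    by (rule fourier_L2_convergence) (use f2 in auto)
  from tendsto_L2_Re[OF _ _ integrable_trig_power _ this] show ?thesis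
    using f2 by (simp add: fourier_sum_def)
qed

section \<open>The fourth power of a trigonometric polynomial\<close>

text \<open>Young's convolution inequality in disguise: the coefficients of the square are estimated by
  the Cauchy--Schwarz inequality, and the weights by the inequality of the means.\<close>

lemma L4_trig_le:
  assumes F: "finite F" and w: "\<And>k. w k \<ge> 0" and aw: "\<And>k. k \<in> F \<Longrightarrow> (norm (a k))\<^sup>2 \<le> w k * (norm (c k))\<^sup>2"
    and S: "(\<Sum>k\<in>F. (w k)\<^sup>2) \<le> S"
  shows "(LINT x|torus. (norm (trig F a x))^4) \<le> S * (\<Sum>k\<in>F. (norm (c k))\<^sup>2)\<^sup>2"
proof -
  \<comment> \<open>\<open>G\<close> holds the frequencies of the squared polynomial,
    \<open>P m\<close> the pairs which contribute to the frequency \<open>m\<close>, and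
    \<open>b m\<close> the resulting coefficient.\<close>
  define G where "G = (\<lambda>p. fst p + snd p) ` (F \<times> F)"
  define P where "P m = {p \<in> F \<times> F. fst p + snd p = m}" for m
  define b where "b m = (\<Sum>p\<in>P m. a (fst p) * a (snd p))" for m
  define q where "q p = (norm (c (fst p)))\<^sup>2 * (norm (c (snd p)))\<^sup>2" for p
  have fG: "finite G" using F by (simp add: G_def)
  have group: "(\<Sum>m\<in>G. \<Sum>p\<in>P m. h p) = (\<Sum>p\<in>F \<times> F. h p)" for h :: "(int^2) \<times> (int^2) \<Rightarrow> 'z::comm_monoid_add"
    unfolding P_def by (rule sum.group) (use F in \<open>auto simp: G_def\<close>)
  have sq: "(trig F a x)\<^sup>2 = trig G b x" for x
  proof -
    have "(trig F a x)\<^sup>2 = (\<Sum>p\<in>F \<times> F. (a (fst p) * a (snd p)) * char2 (fst p + snd p) x)"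
      by (simp add: power2_eq_square trig_def sum_product sum.cartesian_product case_prod_beta' mult_ac flip: char2_mult)
    also have "\<dots> = (\<Sum>m\<in>G. \<Sum>p\<in>P m. (a (fst p) * a (snd p)) * char2 (fst p + snd p) x)"
      by (rule group[symmetric])
    also have "\<dots> = (\<Sum>m\<in>G. b m * char2 m x)"
      unfolding b_def sum_distrib_right by (intro sum.cong refl) (auto simp: P_def)
    finally show ?thesis by (simp add: trig_def)
  qed
  have bm: "(norm (b m))\<^sup>2 \<le> S * (\<Sum>p\<in>P m. q p)" for m
  proof -
    have "norm (b m) \<le> (\<Sum>p\<in>P m. sqrt (w (fst p) * w (snd p)) * sqrt (q p))"
      unfolding b_def
    proof (rule sum_norm_le)
      fix p assume "p \<in> P m"
      then have "fst p \<in> F" "snd p \<in> F" by (auto simp: P_def)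
      from mult_mono[OF aw[OF this(1)] aw[OF this(2)]]
      have "(norm (a (fst p) * a (snd p)))\<^sup>2 \<le> (w (fst p) * w (snd p)) * q p"
        using w by (simp add: norm_mult power_mult_distrib q_def mult_ac)
      then show "norm (a (fst p) * a (snd p)) \<le> sqrt (w (fst p) * w (snd p)) * sqrt (q p)"
        using real_le_rsqrt by (simp add: real_sqrt_mult[symmetric])
    qed
    then have "(norm (b m))\<^sup>2 \<le> (\<Sum>p\<in>P m. sqrt (w (fst p) * w (snd p)) * sqrt (q p))\<^sup>2"
      by (intro power_mono) auto
    also have "\<dots> \<le> (\<Sum>p\<in>P m. (sqrt (w (fst p) * w (snd p)))\<^sup>2) * (\<Sum>p\<in>P m. (sqrt (q p))\<^sup>2)"
      by (rule Cauchy_Schwarz_ineq_sum)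
    also have "\<dots> = (\<Sum>p\<in>P m. w (fst p) * w (snd p)) * (\<Sum>p\<in>P m. q p)"
      using w by (simp add: q_def)
    also have "\<dots> \<le> S * (\<Sum>p\<in>P m. q p)"
    proof (rule mult_right_mono)
      \<comment> \<open>With the sum \<open>m\<close> fixed, either component determines the pair.
        After the inequality of the means both projections are therefore injective, and each half is
        at most a sum over \<open>F\<close>.\<close>
      have "(\<Sum>p\<in>P m. w (fst p) * w (snd p)) \<le> (\<Sum>p\<in>P m. (w (fst p))\<^sup>2 / 2 + (w (snd p))\<^sup>2 / 2)"
      proof (rule sum_mono)
        fix p
        show "w (fst p) * w (snd p) \<le> (w (fst p))\<^sup>2 / 2 + (w (snd p))\<^sup>2 / 2"
          using sum_squares_bound[of "w (fst p)" "w (snd p)"] by simp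
      qed
      also have "\<dots> = (\<Sum>p\<in>P m. (w (fst p))\<^sup>2) / 2 + (\<Sum>p\<in>P m. (w (snd p))\<^sup>2) / 2"
        by (simp add: sum.distrib sum_divide_distrib)
      also have "(\<Sum>p\<in>P m. (w (fst p))\<^sup>2) = (\<Sum>k\<in>fst ` P m. (w k)\<^sup>2)"
        by (subst sum.reindex) (auto simp: inj_on_def P_def)
      also have "\<dots> \<le> (\<Sum>k\<in>F. (w k)\<^sup>2)"
        by (rule sum_mono2) (use F in \<open>auto simp: P_def\<close>)
      also have "(\<Sum>p\<in>P m. (w (snd p))\<^sup>2) = (\<Sum>k\<in>snd ` P m. (w k)\<^sup>2)"
        by (subst sum.reindex) (auto simp: inj_on_def P_def)
      also have "\<dots> \<le> (\<Sum>k\<in>F. (w k)\<^sup>2)"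
        by (rule sum_mono2) (use F in \<open>auto simp: P_def\<close>)
      finally show "(\<Sum>p\<in>P m. w (fst p) * w (snd p)) \<le> S" using S by simp
    qed (auto simp: q_def intro: sum_nonneg)
    finally show ?thesis .
  qed
  \<comment> \<open>The fourth power of the modulus is the square of the modulus of the squared
    polynomial, to which Parseval applies.\<close>
  have "(LINT x|torus. (norm (trig F a x))^4) = (LINT x|torus. (norm ((trig F a x)\<^sup>2))\<^sup>2)"
    by (simp add: norm_power)
  also have "\<dots> = (\<Sum>m\<in>G. (norm (b m))\<^sup>2)" unfolding sq by (rule parseval_trig[OF fG])
  also have "\<dots> \<le> (\<Sum>m\<in>G. S * (\<Sum>p\<in>P m. q p))" by (rule sum_mono) (rule bm)
  also have "\<dots> = S * (\<Sum>p\<in>F \<times> F. q p)" by (simp add: group flip: sum_distrib_left)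
  also have "(\<Sum>p\<in>F \<times> F. q p) = (\<Sum>k\<in>F. (norm (c k))\<^sup>2)\<^sup>2"
    by (simp add: q_def power2_eq_square sum_product sum.cartesian_product case_prod_beta')
  finally show ?thesis .
qed

section \<open>Summability of the inverse fourth power of the frequency over the lattice\<close>

definition freq_sq :: "int^2 \<Rightarrow> real" where
  "freq_sq k = (\<Sum>i\<in>UNIV. (of_int (k $ i))\<^sup>2)"

lemma freq_sq_nonneg: "freq_sq k \<ge> 0"
  by (simp add: freq_sq_def sum_nonneg)

lemma freq_sq_2: "freq_sq k = (of_int (k $ 1))\<^sup>2 + (of_int (k $ 2))\<^sup>2"
  by (simp add: freq_sq_def sum_2)

lemma freq_sq_ge_1: "k \<noteq> 0 \<Longrightarrow> freq_sq k \<ge> 1"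
proof -
  assume "k \<noteq> 0"
  then have "(k $ 1)\<^sup>2 + (k $ 2)\<^sup>2 > 0"
    by (auto simp: vec_eq_iff forall_2 sum_power2_gt_zero_iff)
  then have "real_of_int ((k $ 1)\<^sup>2 + (k $ 2)\<^sup>2) \<ge> 1" by linarith
  then show ?thesis by (simp add: freq_sq_2)
qed

text \<open>The induction needs the sharper bound \<open>5 - 4 / (n + 1)\<close>: the two terms that
  are added at each stage are dominated by the telescoping difference
  \<open>4 / (n + 1) - 4 / (n + 2)\<close>. Equality at \<open>n = 0\<close> fixes the constant
  5.\<close>

lemma sum_inverse_1_plus_square_le:
  "(\<Sum>a\<in>{-int n..int n}. 1 / (1 + (of_int a)\<^sup>2)) \<le> (5::real)"
proof -
  have "(\<Sum>a\<in>{-int n..int n}. 1 / (1 + (of_int a)\<^sup>2)) \<le> 5 - 4 / (real n + 1)"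
  proof (induction n)
    case (Suc n)
    have "{-int (Suc n)..int (Suc n)} = insert (-int (Suc n)) (insert (int (Suc n)) {-int n..int n})" by auto
    then have "(\<Sum>a\<in>{-int (Suc n)..int (Suc n)}. 1 / (1 + (of_int a)\<^sup>2))
        = 2 / (1 + (real n + 1)\<^sup>2) + (\<Sum>a\<in>{-int n..int n}. 1 / (1 + (of_int a)\<^sup>2))"
      by (simp add: power2_eq_square algebra_simps)
    also have "2 / (1 + (real n + 1)\<^sup>2) \<le> 4 / ((real n + 1) * (real n + 2))"
      by (simp add: divide_simps power2_eq_square algebra_simps add_pos_nonneg)
    also have "4 / ((real n + 1) * (real n + 2)) = 4 / (real n + 1) - 4 / (real n + 2)"
      by (simp add: divide_simps)
    finally show ?case using Suc by (simp only: of_nat_Suc) (simp add: add.commute)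
  qed simp
  also have "\<dots> \<le> 5" by simp
  finally show ?thesis .
qed

text \<open>With \<open>s\<close> and \<open>t\<close> the squared coordinates and
  \<open>s + t \<ge> 1\<close>, the bound \<open>(1 + s) * (1 + t) \<le> 3 * (s + t)\<^sup>2\<close>
  separates the variables. The double sum is then at most 3 times the square of a single sum bounded
  by 5, whence 75.\<close>

lemma sum_inverse_freq_sq_le:
  assumes "finite F"
  shows "(\<Sum>k\<in>F. (1 / freq_sq k)\<^sup>2) \<le> 75"
proof -
  define f where "f a = 1 / (1 + (real_of_int a)\<^sup>2)" for a
  obtain n where n: "F \<subseteq> freqs n"
  proof -
    have "\<forall>\<^sub>F n in sequentially. \<forall>k\<in>F. k \<in> freqs n"
      using assms eventually_in_freqs by (simp add: eventually_ball_finite)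
    then show thesis using that by (auto simp: eventually_sequentially)
  qed
  have le: "(1 / freq_sq k)\<^sup>2 \<le> 3 * (f (k $ 1) * f (k $ 2))" for k
  proof (cases "k = 0")
    case True
    \<comment> \<open>At the frequency 0 the left side is 0 by division by zero, so \<open>F\<close>
      may contain it.\<close>
    then show ?thesis by (simp add: freq_sq_def f_def)
  next
    case False
    define s t where "s = (real_of_int (k $ 1))\<^sup>2" and "t = (real_of_int (k $ 2))\<^sup>2"
    have st: "s \<ge> 0" "t \<ge> 0" "s + t \<ge> 1" using freq_sq_ge_1[OF False] by (auto simp: s_def t_def freq_sq_2)
    have "s + t \<le> (s + t)\<^sup>2" "1 \<le> (s + t)\<^sup>2"
      using st by (simp_all add: power2_eq_square mult_le_cancel_left1 one_le_mult_iff mult_ge1_I)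
    moreover have "s * t \<le> (s + t)\<^sup>2" using st by (simp add: power2_eq_square algebra_simps)
    ultimately have "(1 + s) * (1 + t) \<le> 3 * (s + t)\<^sup>2" by (simp add: algebra_simps)
    then show ?thesis using st
      by (simp add: freq_sq_2 f_def power_one_over flip: s_def t_def) (simp add: divide_simps mult_ac)
  qed
  have "(\<Sum>k\<in>F. (1 / freq_sq k)\<^sup>2) \<le> (\<Sum>k\<in>F. 3 * (f (k $ 1) * f (k $ 2)))"
    by (rule sum_mono) (rule le)
  also have "\<dots> = (\<Sum>p\<in>(\<lambda>k. (k $ 1, k $ 2)) ` F. 3 * (f (fst p) * f (snd p)))"
    by (subst sum.reindex) (auto simp: inj_on_def vec_eq_iff forall_2)
  also have "\<dots> \<le> (\<Sum>p\<in>{-int n..int n} \<times> {-int n..int n}. 3 * (f (fst p) * f (snd p)))"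
  proof (rule sum_mono2)
    show "(\<lambda>k. (k $ 1, k $ 2)) ` F \<subseteq> {-int n..int n} \<times> {-int n..int n}"
      using n by (fastforce simp: freqs_def abs_le_iff minus_le_iff)
  qed (auto simp: f_def)
  also have "\<dots> = 3 * (\<Sum>p\<in>{-int n..int n} \<times> {-int n..int n}. f (fst p) * f (snd p))"
    by (rule sum_distrib_left[symmetric])
  also have "\<dots> = 3 * (\<Sum>a\<in>{-int n..int n}. f a)\<^sup>2"
    by (simp add: power2_eq_square sum_product sum.cartesian_product case_prod_beta')
  also have "\<dots> \<le> 3 * 5\<^sup>2"
    by (intro mult_left_mono power_mono) (use sum_inverse_1_plus_square_le in \<open>auto simp: f_def intro: sum_nonneg\<close>)
  finally show ?thesis by simp
qed

section \<open>Uniqueness of weak gradients and of solenoidal fields\<close>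

lemma Lspace_numeral_iff:
  "f \<in> Lspace (numeral n) \<longleftrightarrow> periodic f \<and> f \<in> borel_measurable torus \<and>
    integrable torus (\<lambda>x. (norm (f x)) ^ numeral n)"
  by (simp add: Lspace_def)

lemma Lspace_1_iff:
  "f \<in> Lspace 1 \<longleftrightarrow> periodic f \<and> integrable torus f"
  by (auto simp: Lspace_def integrable_norm_iff)

lemma borel_measurable_vecI:
  fixes f :: "'a \<Rightarrow> real^'n::finite"
  assumes "\<And>i. (\<lambda>x. f x $ i) \<in> borel_measurable M"
  shows "f \<in> borel_measurable M"
  using assms by (subst borel_measurable_euclidean_space) (auto simp: Basis_vec_def inner_axis)

lemma borel_measurable_vec_nth:
  fixes f :: "'a \<Rightarrow> real^'n::finite"
  assumes "f \<in> borel_measurable M"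
  shows "(\<lambda>x. f x $ i) \<in> borel_measurable M"
  using assms by (rule measurable_compose) (auto intro!: borel_measurable_continuous_onI continuous_intros)

lemma integrable_vec_nth_power:
  fixes f :: "'a \<Rightarrow> real^'n::finite"
  assumes "f \<in> borel_measurable M" and f: "integrable M (\<lambda>x. (norm (f x)) ^ p)"
  shows "integrable M (\<lambda>x. (norm (f x $ i)) ^ p)"
proof (rule Bochner_Integration.integrable_bound[OF f])
  have [measurable]: "(\<lambda>x. f x $ i) \<in> borel_measurable M" using assms(1) by (rule borel_measurable_vec_nth)
  show "(\<lambda>x. (norm (f x $ i)) ^ p) \<in> borel_measurable M" by measurable
  show "AE x in M. norm ((norm (f x $ i)) ^ p) \<le> norm ((norm (f x)) ^ p)"
    by (intro AE_I2) (simp add: power_mono component_le_norm_cart)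
qed

lemma integrable_norm_vec2_power:
  fixes f :: "'a \<Rightarrow> real^2"
  assumes m: "\<And>i. (\<lambda>x. f x $ i) \<in> borel_measurable M"
    and f: "\<And>i. integrable M (\<lambda>x. (norm (f x $ i)) ^ p)"
  shows "integrable M (\<lambda>x. (norm (f x)) ^ p)"
proof (rule Bochner_Integration.integrable_bound)
  have [measurable]: "f \<in> borel_measurable M" using m by (rule borel_measurable_vecI)
  show "(\<lambda>x. (norm (f x)) ^ p) \<in> borel_measurable M" by measurable
  show "integrable M (\<lambda>x. 2 ^ p * ((norm (f x $ 1)) ^ p + (norm (f x $ 2)) ^ p))"
    using f by simp
  show "AE x in M. norm ((norm (f x)) ^ p) \<le> norm (2 ^ p * ((norm (f x $ 1)) ^ p + (norm (f x $ 2)) ^ p))"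
  proof (rule AE_I2)
    fix x
    define m where "m = max (norm (f x $ 1)) (norm (f x $ 2))"
    have "norm (f x) \<le> norm (f x $ 1) + norm (f x $ 2)"
      using norm_le_l1_cart[of "f x"] by (simp add: sum_2)
    also have "\<dots> \<le> 2 * m" by (simp add: m_def)
    finally have "(norm (f x)) ^ p \<le> (2 * m) ^ p" by (intro power_mono) auto
    also have "\<dots> \<le> 2 ^ p * ((norm (f x $ 1)) ^ p + (norm (f x $ 2)) ^ p)"
      by (auto simp: power_mult_distrib m_def max_def)
    finally show "norm ((norm (f x)) ^ p) \<le> norm (2 ^ p * ((norm (f x $ 1)) ^ p + (norm (f x $ 2)) ^ p))"
      by simp
  qed
qed

lemma integrable_vec_nth:
  fixes f :: "'a \<Rightarrow> real^'n::finite"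
  assumes "integrable M f"
  shows "integrable M (\<lambda>x. f x $ i)" and "(LINT x|M. f x $ i) = (LINT x|M. f x) $ i"
  using assms integrable_bounded_linear[OF bounded_linear_vec_nth] integral_bounded_linear[OF bounded_linear_vec_nth]
  by blast+

lemma (in finite_measure) power2_integrable_of_power4:
  fixes f :: "'a \<Rightarrow> 'b::{banach, second_countable_topology}"
  assumes [measurable]: "f \<in> borel_measurable M" and f4: "integrable M (\<lambda>x. (norm (f x))^4)"
  shows "integrable M (\<lambda>x. (norm (f x))\<^sup>2)"
proof (rule L2_imp_integrable)
  have "(norm ((norm (f x))\<^sup>2))\<^sup>2 = (norm (f x))^4" for x
    by simp
  then show "integrable M (\<lambda>x. (norm ((norm (f x))\<^sup>2))\<^sup>2)" using f4 by simp
qed measurable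

lemma Lspace_4_subset_2: "Lspace 4 \<subseteq> Lspace 2"
  using torus.power2_integrable_of_power4 by (auto simp: Lspace_numeral_iff)

lemma Lspace_2_imp_integrable: "f \<in> Lspace 2 \<Longrightarrow> integrable torus f"
  by (auto simp: Lspace_numeral_iff intro: torus.L2_imp_integrable)

lemma Lspace_AE_cong:
  assumes f: "f \<in> Lspace p" and g: "periodic g" "g \<in> borel_measurable torus" and ae: "AE x in torus. f x = g x"
  shows "g \<in> Lspace p"
proof -
  have [measurable]: "f \<in> borel_measurable torus" "g \<in> borel_measurable torus"
    using f g by (auto simp: Lspace_def)
  have "integrable torus (\<lambda>x. norm (f x) powr p)" using f by (simp add: Lspace_def)
  then have "integrable torus (\<lambda>x. norm (g x) powr p)"
    by (rule integrable_cong_AE_imp) (use ae in auto)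
  then show ?thesis using g by (simp add: Lspace_def)
qed

text \<open>The factor \<open>z\<close> is there because test functions are real: letting it range
  over the complex numbers recovers a complex Fourier coefficient from real integrals.\<close>

lemma integral_mult_Re_char2:
  fixes f :: "real^2 \<Rightarrow> real"
  assumes f: "integrable torus f"
  shows "integrable torus (\<lambda>x. f x * Re (z * char2 m x))"
    and "(LINT x|torus. f x * Re (z * char2 m x)) = Re (z * (LINT x|torus. complex_of_real (f x) * char2 m x))"
proof -
  have [measurable]: "f \<in> borel_measurable torus" using f by auto
  have i: "integrable torus (\<lambda>x. z * (complex_of_real (f x) * char2 m x))"
    by (rule integrable_mult_right, rule Bochner_Integration.integrable_bound[OF f]) (auto simp: norm_mult)
  have eq: "f x * Re (z * char2 m x) = Re (z * (complex_of_real (f x) * char2 m x))" for x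
    by (simp add: algebra_simps)
  show "integrable torus (\<lambda>x. f x * Re (z * char2 m x))"
    unfolding eq using i by (rule integrable_Re)
  show "(LINT x|torus. f x * Re (z * char2 m x)) = Re (z * (LINT x|torus. complex_of_real (f x) * char2 m x))"
    unfolding eq integral_Re[OF i] by (simp only: integral_mult_right_zero)
qed

lemma AE_eq_0_of_real_coefficients:
  fixes f :: "real^2 \<Rightarrow> real"
  assumes f: "integrable torus f" and "\<And>m. (LINT x|torus. complex_of_real (f x) * char2 m x) = 0"
  shows "AE x in torus. f x = 0"
proof -
  have "AE x in torus. complex_of_real (f x) = 0"
    by (rule fourier_uniqueness) (use assms in auto)
  then show ?thesis by simp
qed

text \<open>The conjugate of \<open>w\<close> as \<open>z\<close> gives the squared modulus.\<close>

lemma complex_eq_0_of_Re_mult: "(\<And>z. Re (z * w) = 0) \<Longrightarrow> w = 0"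
  by (metis Re_complex_of_real complex_norm_square mult.commute norm_eq_zero power2_eq_square mult_eq_0_iff)

lemma trig_singleton: "trig {m} a x = a m * char2 m x"
  by (simp add: trig_def)

text \<open>Tested with real parts of multiples of characters, the two gradients have equal Fourier
  coefficients in each component.\<close>

lemma weak_gradient_unique:
  assumes g: "has_weak_gradient f g" and g': "has_weak_gradient f g'"
  shows "AE x in torus. g x = g' x"
proof -
  have int: "integrable torus (\<lambda>x. g x $ i)" "integrable torus (\<lambda>x. g' x $ i)" for i
    using g g' by (auto simp: has_weak_gradient_def Lspace_1_iff intro: integrable_vec_nth)
  have "AE x in torus. g x $ i - g' x $ i = 0" for i
  proof (rule AE_eq_0_of_real_coefficients)
    show i: "integrable torus (\<lambda>x. g x $ i - g' x $ i)" using int by simp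
    fix m
    show "(LINT x|torus. complex_of_real (g x $ i - g' x $ i) * char2 m x) = 0"
    proof (rule complex_eq_0_of_Re_mult)
      fix z
      have t: "(\<lambda>x. Re (z * char2 m x)) \<in> test_fun"
        using test_fun_Re_trig[of "{m}" "\<lambda>_. z"] by (simp add: trig_singleton)
      define \<psi> where "\<psi> x = Re (z * char2 m x)" for x
      have "Re (z * (LINT x|torus. complex_of_real (g x $ i - g' x $ i) * char2 m x))
          = (LINT x|torus. g x $ i * \<psi> x - g' x $ i * \<psi> x)"
        unfolding integral_mult_Re_char2(2)[OF i, symmetric] \<psi>_def by (simp only: left_diff_distrib)
      also have "\<dots> = (LINT x|torus. g x $ i * \<psi> x) - (LINT x|torus. g' x $ i * \<psi> x)"
        unfolding \<psi>_def by (intro Bochner_Integration.integral_diff integral_mult_Re_char2(1) int)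
      also have "\<dots> = 0"
      proof -
        have "\<psi> \<in> test_fun" using t by (simp only: \<psi>_def[abs_def])
        then have "(LINT x|torus. f x * grad \<psi> x $ i) = - (LINT x|torus. g x $ i * \<psi> x)"
          "(LINT x|torus. f x * grad \<psi> x $ i) = - (LINT x|torus. g' x $ i * \<psi> x)"
          using g g' unfolding has_weak_gradient_def by blast+
        then show ?thesis by simp
      qed
      finally show "Re (z * (LINT x|torus. complex_of_real (g x $ i - g' x $ i) * char2 m x)) = 0" .
    qed
  qed
  from this[of 1] this[of 2] show ?thesis
    by eventually_elim (simp add: vec_eq_iff forall_2)
qed

lemma has_weak_gradient_weak_grad:
  assumes "f \<in> W1 p"
  shows "has_weak_gradient f (weak_grad f)"
proof -
  obtain g where "has_weak_gradient f g" using assms by (auto simp: W1_def)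
  then show ?thesis unfolding weak_grad_def by (rule someI[of "has_weak_gradient f"])
qed

text \<open>The choice in \<open>weak_grad\<close> guarantees integrability only. The exponent
  \<open>p\<close> is inherited from the gradient in the definition of \<open>W1 p\<close>, which
  agrees with the chosen one almost everywhere.\<close>

lemma weak_grad_Lspace:
  assumes "f \<in> W1 p"
  shows "weak_grad f \<in> Lspace p"
proof -
  obtain g where g: "g \<in> Lspace p" "has_weak_gradient f g" using assms by (auto simp: W1_def)
  note w = has_weak_gradient_weak_grad[OF assms]
  show ?thesis
    by (rule Lspace_AE_cong[OF g(1) _ _ weak_gradient_unique[OF g(2) w]])
       (use w in \<open>auto simp: has_weak_gradient_def Lspace_1_iff\<close>)
qed

text \<open>At each frequency \<open>m\<close>, divergence and curl of the difference give two
  linear equations for its two coefficients, with determinant \<open>freq_sq m\<close>. This is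
  nonzero unless \<open>m = 0\<close>, and there zero mean takes over.\<close>

lemma div_curl_unique:
  assumes u: "u \<in> Lspace 2" "zero_mean u" "weakly_div_free u" "weak_curl_eq u \<xi>"
    and v: "v \<in> Lspace 2" "zero_mean v" "weakly_div_free v" "weak_curl_eq v \<xi>"
  shows "AE x in torus. u x = v x"
proof -
  define w where "w x = u x - v x" for x
  have iu: "integrable torus u" and iv: "integrable torus v" using u v by (auto intro: Lspace_2_imp_integrable)
  have iw: "integrable torus w" unfolding w_def using iu iv by simp
  define W where "W m i = (LINT x|torus. complex_of_real (w x $ i) * char2 m x)" for m i
  have int: "integrable torus (\<lambda>x. y x $ i * Re (z * char2 m x))" if "integrable torus y" for y :: "real^2 \<Rightarrow> real^2" and i z m
    by (rule integral_mult_Re_char2(1)[OF integrable_vec_nth(1)[OF that]])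
  have Re: "(LINT x|torus. w x $ i * Re (z * char2 m x)) = Re (z * W m i)" for i z m
    unfolding W_def by (rule integral_mult_Re_char2(2)[OF integrable_vec_nth(1)[OF iw]])
  have grad: "grad (\<lambda>x. Re (z * char2 m x)) x $ i = Re (dcoef i (\<lambda>_. z) m * char2 m x)" for z m x i
    using grad_Re_trig[of "{m}" "\<lambda>_. z"] by (simp add: trig_singleton)
  have t: "(\<lambda>x. Re (z * char2 m x)) \<in> test_fun" for z m
    using test_fun_Re_trig[of "{m}" "\<lambda>_. z"] by (simp add: trig_singleton)
  have test: "\<exists>\<psi> \<phi>. \<psi> \<in> test_fun \<and> (\<forall>x i. grad \<psi> x $ i = \<phi> i x) \<and>
      (\<forall>i j. integrable torus (\<lambda>x. u x $ j * \<phi> i x) \<and> integrable torus (\<lambda>x. v x $ j * \<phi> i x) \<and>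
        (LINT x|torus. u x $ j * \<phi> i x) - (LINT x|torus. v x $ j * \<phi> i x) = Re (z * (of_int (m $ i) * W m j)))" for z m
  proof (intro exI conjI allI)
    \<comment> \<open>Cancels the factor of the derivative multiplier, so that
      \<open>dcoef i (\<lambda>_. y) m\<close> is just \<open>z * m $ i\<close>.\<close>
    define y where "y = z / (2 * pi * \<i>)"
    define \<phi> where "\<phi> i x = Re (dcoef i (\<lambda>_. y) m * char2 m x)" for i x
    show "(\<lambda>x. Re (y * char2 m x)) \<in> test_fun" by (rule t)
    show "grad (\<lambda>x. Re (y * char2 m x)) x $ i = \<phi> i x" for x i
      unfolding \<phi>_def by (rule grad)
    show i: "integrable torus (\<lambda>x. u x $ j * \<phi> i x)" "integrable torus (\<lambda>x. v x $ j * \<phi> i x)" for i j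
      unfolding \<phi>_def by (intro int iu iv)+
    show "(LINT x|torus. u x $ j * \<phi> i x) - (LINT x|torus. v x $ j * \<phi> i x) = Re (z * (of_int (m $ i) * W m j))" for i j
    proof -
      have "(LINT x|torus. u x $ j * \<phi> i x) - (LINT x|torus. v x $ j * \<phi> i x) = (LINT x|torus. w x $ j * \<phi> i x)"
        using i by (simp add: w_def left_diff_distrib)
      also have "\<dots> = Re (dcoef i (\<lambda>_. y) m * W m j)"
        unfolding \<phi>_def by (rule Re)
      also have "dcoef i (\<lambda>_. y) m = z * of_int (m $ i)"
        by (simp add: dcoef_def y_def)
      finally show ?thesis by (simp only: mult.assoc)
    qed
  qed
  have div: "of_int (m $ 1) * W m 1 + of_int (m $ 2) * W m 2 = 0" for m
  proof (rule complex_eq_0_of_Re_mult)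
    fix z
    obtain \<psi> \<phi> where \<psi>: "\<psi> \<in> test_fun" and gr: "\<And>x i. grad \<psi> x $ i = \<phi> i x"
      and i: "\<And>i j. integrable torus (\<lambda>x. u x $ j * \<phi> i x)" "\<And>i j. integrable torus (\<lambda>x. v x $ j * \<phi> i x)"
      and d: "\<And>i j. (LINT x|torus. u x $ j * \<phi> i x) - (LINT x|torus. v x $ j * \<phi> i x) = Re (z * (of_int (m $ i) * W m j))"
      using test[of z m] by blast
    have "(LINT x|torus. u x \<bullet> grad \<psi> x) = 0" "(LINT x|torus. v x \<bullet> grad \<psi> x) = 0"
      using u(3) v(3) \<psi> by (auto simp: weakly_div_free_def)
    then have "(LINT x|torus. u x $ 1 * \<phi> 1 x) + (LINT x|torus. u x $ 2 * \<phi> 2 x) = 0"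
      "(LINT x|torus. v x $ 1 * \<phi> 1 x) + (LINT x|torus. v x $ 2 * \<phi> 2 x) = 0"
      using i by (simp_all add: inner_vec_def sum_2 gr)
    then show "Re (z * (of_int (m $ 1) * W m 1 + of_int (m $ 2) * W m 2)) = 0"
      using d[of 1 1] d[of 2 2] by (simp only: distrib_left plus_complex.sel)
  qed
  have curl: "- of_int (m $ 2) * W m 1 + of_int (m $ 1) * W m 2 = 0" for m
  proof (rule complex_eq_0_of_Re_mult)
    fix z
    obtain \<psi> \<phi> where \<psi>: "\<psi> \<in> test_fun" and gr: "\<And>x i. grad \<psi> x $ i = \<phi> i x"
      and i: "\<And>i j. integrable torus (\<lambda>x. u x $ j * \<phi> i x)" "\<And>i j. integrable torus (\<lambda>x. v x $ j * \<phi> i x)"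
      and d: "\<And>i j. (LINT x|torus. u x $ j * \<phi> i x) - (LINT x|torus. v x $ j * \<phi> i x) = Re (z * (of_int (m $ i) * W m j))"
      using test[of z m] by blast
    have "(LINT x|torus. u x \<bullet> perp (grad \<psi> x)) = (LINT x|torus. v x \<bullet> perp (grad \<psi> x))"
      using u(4) v(4) \<psi> by (auto simp: weak_curl_eq_def)
    then have "(LINT x|torus. u x $ 2 * \<phi> 1 x) - (LINT x|torus. u x $ 1 * \<phi> 2 x)
        = (LINT x|torus. v x $ 2 * \<phi> 1 x) - (LINT x|torus. v x $ 1 * \<phi> 2 x)"
      using i by (simp add: inner_vec_def sum_2 gr perp_def)
    then have "Re (z * (of_int (m $ 1) * W m 2)) - Re (z * (of_int (m $ 2) * W m 1)) = 0"
      unfolding d[symmetric] by simp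
    then show "Re (z * (- of_int (m $ 2) * W m 1 + of_int (m $ 1) * W m 2)) = 0"
      by (simp add: algebra_simps)
  qed
  have W0: "W m i = 0" for m i
  proof (cases "m = 0")
    case True
    have "(LINT x|torus. w x) = 0" unfolding w_def using iu iv u(2) v(2) by (simp add: zero_mean_def)
    then have "(LINT x|torus. w x $ i) = 0" using integrable_vec_nth(2)[OF iw] by simp
    then show ?thesis unfolding W_def True by simp
  next
    case False
    define p q where "p = complex_of_int (m $ 1)" and "q = complex_of_int (m $ 2)"
    have "p\<^sup>2 + q\<^sup>2 = complex_of_real (freq_sq m)" by (simp add: p_def q_def freq_sq_2)
    then have pq: "p\<^sup>2 + q\<^sup>2 \<noteq> 0" using freq_sq_ge_1[OF False] by auto
    have d: "p * W m 1 + q * W m 2 = 0" and c: "- q * W m 1 + p * W m 2 = 0"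
      using div[of m] curl[of m] by (auto simp: p_def q_def)
    have "(p\<^sup>2 + q\<^sup>2) * W m 1 = p * (p * W m 1 + q * W m 2) - q * (- q * W m 1 + p * W m 2)"
      by (simp add: algebra_simps power2_eq_square)
    moreover have "(p\<^sup>2 + q\<^sup>2) * W m 2 = q * (p * W m 1 + q * W m 2) + p * (- q * W m 1 + p * W m 2)"
      by (simp add: algebra_simps power2_eq_square)
    ultimately have "W m 1 = 0" "W m 2 = 0" using pq d c by auto
    then show ?thesis using exhaust_2[of i] by auto
  qed
  have "AE x in torus. w x $ i = 0" for i
    by (rule AE_eq_0_of_real_coefficients[OF integrable_vec_nth(1)[OF iw]]) (use W0 in \<open>simp add: W_def\<close>)
  from this[of 1] this[of 2] show ?thesis
    by eventually_elim (simp add: w_def vec_eq_iff forall_2)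
qed

section \<open>The Biot--Savart field\<close>

text \<open>The coefficients \<open>- 2\<pi>\<i> k\<^sub>2 c\<^sub>k / (- 4\<pi>\<^sup>2 \<bar>k\<bar>\<^sup>2)\<close> and
  \<open>2\<pi>\<i> k\<^sub>1 c\<^sub>k / (- 4\<pi>\<^sup>2 \<bar>k\<bar>\<^sup>2)\<close> of the rotated gradient of the inverse Laplacian; the
  one with index \<open>0\<close> vanishes because of the division by zero.\<close>

definition bs_coef :: "(int^2 \<Rightarrow> complex) \<Rightarrow> 2 \<Rightarrow> int^2 \<Rightarrow> complex" where
  "bs_coef c i k = (if i = 1 then \<i> * of_int (k $ 2) else - \<i> * of_int (k $ 1)) * c k / (2 * pi * freq_sq k)"

definition bs_sum :: "(real^2 \<Rightarrow> real) \<Rightarrow> nat \<Rightarrow> 2 \<Rightarrow> real^2 \<Rightarrow> real" where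
  "bs_sum \<xi> n i x = Re (trig (freqs n) (bs_coef (fcoef (\<lambda>y. complex_of_real (\<xi> y))) i) x)"

text \<open>The form in which \<open>L4_trig_le\<close> takes its coefficients. The weight is the
  inverse square of the frequency, and the square of the weight is summable over the
  lattice.\<close>

lemma norm_bs_coef_le: "(norm (bs_coef c i k))\<^sup>2 \<le> 1 / freq_sq k * (norm (c k))\<^sup>2"
proof (cases "k = 0")
  case True
  then show ?thesis by (simp add: bs_coef_def freq_sq_def)
next
  case False
  define s where "s = freq_sq k"
  have s: "s \<ge> 1" using freq_sq_ge_1[OF False] by (simp add: s_def)
  define j where "j = (if i = 1 then k $ 2 else k $ 1)"
  have j: "(real_of_int j)\<^sup>2 \<le> s" by (simp add: j_def s_def freq_sq_2)
  have "norm (bs_coef c i k) = \<bar>real_of_int j\<bar> * norm (c k) / (2 * pi * s)"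
    using s by (simp add: bs_coef_def norm_mult norm_divide j_def s_def)
  then have "(norm (bs_coef c i k))\<^sup>2 = (real_of_int j)\<^sup>2 * (norm (c k))\<^sup>2 / ((2 * pi)\<^sup>2 * s\<^sup>2)"
    by (simp add: power_mult_distrib power_divide)
  also have "\<dots> \<le> s * (norm (c k))\<^sup>2 / (1 * s\<^sup>2)"
  proof (intro frac_le mult_right_mono j)
    have "1 \<le> 2 * pi" using pi_gt3 by simp
    then show "1 \<le> (2 * pi)\<^sup>2" by (rule one_le_power)
  qed (use s in auto)
  also have "\<dots> = 1 / s * (norm (c k))\<^sup>2" using s by (simp add: power2_eq_square)
  finally show ?thesis by (simp add: s_def)
qed

lemma bs_coef_div: "dcoef 1 (bs_coef c 1) k + dcoef 2 (bs_coef c 2) k = 0"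
  by (simp add: dcoef_def bs_coef_def)

text \<open>A curl has no component at the frequency 0; this is where zero mean of the vorticity
  enters.\<close>

lemma bs_coef_curl:
  assumes "c 0 = 0"
  shows "dcoef 1 (bs_coef c 2) k - dcoef 2 (bs_coef c 1) k = c k"
proof (cases "k = 0")
  case True
  then show ?thesis using assms by (simp add: dcoef_def)
next
  case False
  define s where "s = complex_of_real (freq_sq k)"
  have s: "s \<noteq> 0" using freq_sq_ge_1[OF False] by (auto simp: s_def)
  have eq: "s = (of_int (k $ 1))\<^sup>2 + (of_int (k $ 2))\<^sup>2" by (simp add: s_def freq_sq_2)
  have "dcoef 1 (bs_coef c 2) k - dcoef 2 (bs_coef c 1) k
      = ((of_int (k $ 1))\<^sup>2 + (of_int (k $ 2))\<^sup>2) * c k / s"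
    by (simp add: dcoef_def bs_coef_def flip: s_def) (simp add: power2_eq_square add_divide_distrib algebra_simps)
  then show ?thesis using s by (simp flip: eq)
qed

lemma test_fun_bs_sum: "bs_sum \<xi> n i \<in> test_fun"
  unfolding bs_sum_def[abs_def] by (rule test_fun_Re_trig)

lemma grad_bs_sum:
  "grad (bs_sum \<xi> n i) x $ j = Re (trig (freqs n) (dcoef j (bs_coef (fcoef (\<lambda>y. complex_of_real (\<xi> y))) i)) x)"
  unfolding bs_sum_def[abs_def] by (rule grad_Re_trig)

text \<open>The divergence vanishes frequency by frequency, so the truncations are exactly
  solenoidal, not merely in the limit.\<close>

lemma bs_sum_div: "grad (bs_sum \<xi> n 1) x $ 1 + grad (bs_sum \<xi> n 2) x $ 2 = 0"
proof -
  let ?c = "fcoef (\<lambda>y. complex_of_real (\<xi> y))"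
  have "trig (freqs n) (dcoef 1 (bs_coef ?c 1)) x + trig (freqs n) (dcoef 2 (bs_coef ?c 2)) x = 0"
    unfolding trig_linear(1)[symmetric] bs_coef_div by (simp add: trig_def)
  then show ?thesis
    unfolding grad_bs_sum by (simp only: plus_complex.sel[symmetric] zero_complex.sel)
qed

lemma E_space_fcoef_0:
  assumes "\<xi> \<in> E_space"
  shows "fcoef (\<lambda>y. complex_of_real (\<xi> y)) 0 = 0"
  using assms by (simp add: E_space_def zero_mean_def fcoef_def)

lemma bs_sum_curl:
  assumes "\<xi> \<in> E_space"
  shows "grad (bs_sum \<xi> n 2) x $ 1 - grad (bs_sum \<xi> n 1) x $ 2 = fourier_sum \<xi> n x"
proof -
  let ?c = "fcoef (\<lambda>y. complex_of_real (\<xi> y))"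
  have "trig (freqs n) (dcoef 1 (bs_coef ?c 2)) x - trig (freqs n) (dcoef 2 (bs_coef ?c 1)) x = trig (freqs n) ?c x"
    unfolding trig_linear(2)[symmetric] bs_coef_curl[of ?c, OF E_space_fcoef_0[OF assms]] ..
  then show ?thesis
    unfolding grad_bs_sum fourier_sum_def by (simp only: minus_complex.sel[symmetric])
qed

lemma L2_limit_tendsto_integral_mult:
  fixes g :: "real^2 \<Rightarrow> real"
  assumes [measurable]: "\<And>n. f n \<in> borel_measurable torus" "h \<in> borel_measurable torus"
    and "\<And>n. integrable torus (\<lambda>x. (norm (f n x))\<^sup>2)" "integrable torus (\<lambda>x. (norm (h x))\<^sup>2)"
    and "(\<lambda>n. LINT x|torus. (norm (f n x - h x))\<^sup>2) \<longlonglongrightarrow> 0"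
    and g: "continuous_on UNIV g"
  shows "(\<lambda>n. LINT x|torus. f n x * g x) \<longlonglongrightarrow> (LINT x|torus. h x * g x)"
  using assms(1-5) by (intro torus.tendsto_integral_mult_L2 borel_measurable_torus[OF g])
    (auto intro!: integrable_torus_continuous continuous_intros g)

lemma bs_sum_measurable [measurable]: "bs_sum \<xi> n i \<in> borel_measurable torus"
  unfolding bs_sum_def[abs_def] by measurable

lemma continuous_bs_sum: "continuous_on S (bs_sum \<xi> n i)"
  unfolding bs_sum_def[abs_def] by (rule continuous_Re_trig)

lemma bs_sum_L2: "integrable torus (\<lambda>x. (norm (bs_sum \<xi> n i x))\<^sup>2)"
  by (intro integrable_torus_continuous continuous_intros continuous_bs_sum)

lemma E_space_measurable: "\<xi> \<in> E_space \<Longrightarrow> \<xi> \<in> borel_measurable torus"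
  and E_space_L2: "\<xi> \<in> E_space \<Longrightarrow> integrable torus (\<lambda>x. (norm (\<xi> x))\<^sup>2)"
  by (auto simp: E_space_def Lspace_numeral_iff)

text \<open>Each component is a mean square limit of its truncations. For these, divergence and curl
  are classical, and integration by parts moves them onto test functions, where the limit can be
  taken. A uniform bound on the fourth powers passes to the limit by Fatou. The convergence is
  exported for later use with truncated velocities.\<close>

lemma biot_savart_field_exists:
  assumes \<xi>: "\<xi> \<in> E_space"
  obtains u where "u \<in> Lspace 4" "zero_mean u" "weakly_div_free u" "weak_curl_eq u \<xi>"
    "\<And>i. (\<lambda>n. LINT x|torus. (norm (bs_sum \<xi> n i x - u x $ i))\<^sup>2) \<longlonglongrightarrow> 0"
proof -
  define c where "c = fcoef (\<lambda>y. complex_of_real (\<xi> y))"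
  define a where "a = bs_coef c"
  define I where "I = (LINT x|torus. (norm (complex_of_real (\<xi> x)))\<^sup>2)"
  have [measurable]: "\<xi> \<in> borel_measurable torus" by (rule E_space_measurable[OF \<xi>])
  have \<xi>2: "integrable torus (\<lambda>x. (norm (\<xi> x))\<^sup>2)" by (rule E_space_L2[OF \<xi>])
  have cI: "(\<Sum>k\<in>F. (norm (c k))\<^sup>2) \<le> I" if "finite F" for F
    unfolding c_def I_def by (rule bessel) (use \<xi>2 that in auto)
  have I0: "I \<ge> 0" unfolding I_def by simp
  \<comment> \<open>The gain of decay is given away here: convergence in the mean square needs only
    the square summability of \<open>c\<close>.\<close>
  have a_le: "(norm (a i k))\<^sup>2 \<le> (norm (c k))\<^sup>2" for i k
  proof -
    have "1 / freq_sq k \<le> 1"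
      using freq_sq_ge_1[of k] by (cases "k = 0") (auto simp: freq_sq_def)
    then have "1 / freq_sq k * (norm (c k))\<^sup>2 \<le> 1 * (norm (c k))\<^sup>2" by (rule mult_right_mono) simp
    from order_trans[OF norm_bs_coef_le[of c i k] this] show ?thesis by (simp only: a_def mult_1)
  qed
  have aI: "(\<Sum>k\<in>freqs n. (norm (a i k))\<^sup>2) \<le> I" for n i
    using sum_mono[of "freqs n", OF a_le] cI[OF finite_freqs] by (rule order_trans)
  define Q where "Q i h \<longleftrightarrow> periodic h \<and> h \<in> borel_measurable torus \<and> integrable torus (\<lambda>x. (norm (h x))\<^sup>2) \<and>
    (\<lambda>n. LINT x|torus. (norm (trig (freqs n) (a i) x - h x))\<^sup>2) \<longlonglongrightarrow> 0" for i h
  have "\<exists>h. Q i h" for i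
    by (rule Riesz_Fischer[OF aI[of i]]) (auto simp: Q_def)
  then obtain h where Q: "\<And>i. Q i (h i)" by metis
  then have per: "periodic (h i)" and [measurable]: "h i \<in> borel_measurable torus"
    and h2: "integrable torus (\<lambda>x. (norm (h i x))\<^sup>2)"
    and lim: "(\<lambda>n. LINT x|torus. (norm (trig (freqs n) (a i) x - h i x))\<^sup>2) \<longlonglongrightarrow> 0" for i
    by (simp_all add: Q_def)
  have h4: "integrable torus (\<lambda>x. (norm (h i x))^4)" for i
  proof (rule torus.L2_limit_power4[OF _ _ integrable_trig_power h2 lim integrable_trig_power])
    fix n
    \<comment> \<open>Here 75 is the bound for the lattice sum of the squared weights; the estimate
      does not depend on \<open>n\<close>.\<close>
    have "(LINT x|torus. (norm (trig (freqs n) (a i) x))^4) \<le> 75 * (\<Sum>k\<in>freqs n. (norm (c k))\<^sup>2)\<^sup>2"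
    proof (rule L4_trig_le)
      show "(norm (a i k))\<^sup>2 \<le> 1 / freq_sq k * (norm (c k))\<^sup>2" for k
        unfolding a_def by (rule norm_bs_coef_le)
      show "(\<Sum>k\<in>freqs n. (1 / freq_sq k)\<^sup>2) \<le> 75"
        by (rule sum_inverse_freq_sq_le) simp
    qed (simp_all add: freq_sq_nonneg)
    also have "\<dots> \<le> 75 * I\<^sup>2"
      by (intro mult_left_mono power_mono cI sum_nonneg) auto
    finally show "(LINT x|torus. (norm (trig (freqs n) (a i) x))^4) \<le> 75 * I\<^sup>2" .
  qed simp_all
  define u :: "real^2 \<Rightarrow> real^2" where "u x = (\<chi> i. Re (h i x))" for x
  have ui: "u x $ i = Re (h i x)" for x i by (simp add: u_def)
  have um[measurable]: "(\<lambda>x. u x $ i) \<in> borel_measurable torus" for i unfolding ui by measurable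
  have ule: "(norm (u x $ i)) ^ p \<le> (norm (h i x)) ^ p" for x i p
    by (simp add: ui power_mono abs_Re_le_cmod)
  have ui2: "integrable torus (\<lambda>x. (norm (u x $ i))\<^sup>2)" for i
    by (rule Bochner_Integration.integrable_bound[OF h2[of i]]) (use ule[of _ _ 2] in auto)
  have ui4: "integrable torus (\<lambda>x. (norm (u x $ i))^4)" for i
    by (rule Bochner_Integration.integrable_bound[OF h4[of i]]) (use ule[of _ _ 4] in auto)
  have uL: "u \<in> Lspace 4"
    unfolding Lspace_numeral_iff
  proof (intro conjI)
    show "periodic u" using per unfolding periodic_def u_def by simp
    show "u \<in> borel_measurable torus" by (rule borel_measurable_vecI) (rule um)
    show "integrable torus (\<lambda>x. (norm (u x)) ^ 4)" by (rule integrable_norm_vec2_power[OF um ui4])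
  qed
  have ulim: "(\<lambda>n. LINT x|torus. (norm (bs_sum \<xi> n i x - u x $ i))\<^sup>2) \<longlonglongrightarrow> 0" for i
    unfolding ui bs_sum_def c_def[symmetric] a_def[symmetric]
    by (rule tendsto_L2_Re[OF _ _ integrable_trig_power h2 lim]) auto
  have int: "(\<lambda>n. LINT x|torus. bs_sum \<xi> n i x * g x) \<longlonglongrightarrow> (LINT x|torus. u x $ i * g x)"
    if "continuous_on UNIV g" for i g
    by (rule L2_limit_tendsto_integral_mult[OF _ _ bs_sum_L2 ui2 ulim that]) auto
  have uint: "integrable torus (\<lambda>x. u x $ i * g x)" if g: "continuous_on UNIV g" for i g
    by (rule integrable_mult_L2[OF _ _ ui2])
       (auto intro!: integrable_torus_continuous continuous_intros g borel_measurable_torus)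
  have iu: "integrable torus u" using uL Lspace_4_subset_2 Lspace_2_imp_integrable by blast
  have "(LINT x|torus. u x $ i) = 0" for i
  proof -
    \<comment> \<open>The mean is the coefficient at the frequency 0, which is 0 by the convention
      on division.\<close>
    have "(LINT x|torus. bs_sum \<xi> n i x * 1) = 0" for n
    proof -
      have "(LINT x|torus. bs_sum \<xi> n i x * 1) = Re (LINT x|torus. trig (freqs n) (a i) x)"
        unfolding bs_sum_def c_def[symmetric] a_def[symmetric] mult_1_right
        by (rule integral_Re[OF integrable_torus_continuous[OF continuous_trig]])
      also have "(LINT x|torus. trig (freqs n) (a i) x) = fcoef (trig (freqs n) (a i)) 0"
        by (simp add: fcoef_def)
      also have "\<dots> = 0" by (simp add: fcoef_trig a_def bs_coef_def)
      finally show ?thesis by simp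
    qed
    then have "(LINT x|torus. u x $ i * 1) = 0"
      using int[of "\<lambda>_. 1" i] by (simp add: LIMSEQ_const_iff)
    then show ?thesis by simp
  qed
  then have zm: "zero_mean u"
    unfolding zero_mean_def by (simp add: vec_eq_iff integrable_vec_nth(2)[OF iu])
  have div: "weakly_div_free u"
    unfolding weakly_div_free_def
  proof
    fix \<psi> assume \<psi>: "\<psi> \<in> test_fun"
    note c\<psi> = continuous_test_fun[OF \<psi>]
    have "(LINT x|torus. bs_sum \<xi> n 1 x * grad \<psi> x $ 1) + (LINT x|torus. bs_sum \<xi> n 2 x * grad \<psi> x $ 2) = 0" for n
    proof -
      have i: "integrable torus (\<lambda>x. grad (bs_sum \<xi> n i) x $ i * \<psi> x)" for i
        by (intro integrable_torus_continuous continuous_intros c\<psi> continuous_test_fun(2)[OF test_fun_bs_sum])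
      have ibp: "(LINT x|torus. bs_sum \<xi> n i x * grad \<psi> x $ i) = - (LINT x|torus. grad (bs_sum \<xi> n i) x $ i * \<psi> x)" for i
        unfolding grad_bs_sum bs_sum_def by (rule integral_partial_Re_trig_mult[OF \<psi>])
      have "(LINT x|torus. bs_sum \<xi> n 1 x * grad \<psi> x $ 1) + (LINT x|torus. bs_sum \<xi> n 2 x * grad \<psi> x $ 2)
          = - (LINT x|torus. (grad (bs_sum \<xi> n 1) x $ 1 + grad (bs_sum \<xi> n 2) x $ 2) * \<psi> x)"
        unfolding ibp using i by (simp add: distrib_right)
      then show ?thesis by (simp add: bs_sum_div)
    qed
    then have "(LINT x|torus. u x $ 1 * grad \<psi> x $ 1) + (LINT x|torus. u x $ 2 * grad \<psi> x $ 2) = 0"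
      using tendsto_add[OF int[OF c\<psi>(2), of 1 1] int[OF c\<psi>(2), of 2 2]] by (simp add: LIMSEQ_const_iff)
    then show "(LINT x|torus. u x \<bullet> grad \<psi> x) = 0"
      using uint[OF c\<psi>(2)] by (simp add: inner_vec_def sum_2)
  qed
  have curl: "weak_curl_eq u \<xi>"
    unfolding weak_curl_eq_def
  proof
    fix \<psi> assume \<psi>: "\<psi> \<in> test_fun"
    note c\<psi> = continuous_test_fun[OF \<psi>]
    have eq: "(LINT x|torus. bs_sum \<xi> n 2 x * grad \<psi> x $ 1) - (LINT x|torus. bs_sum \<xi> n 1 x * grad \<psi> x $ 2)
        = - (LINT x|torus. fourier_sum \<xi> n x * \<psi> x)" for n
    proof -
      have i: "integrable torus (\<lambda>x. grad (bs_sum \<xi> n i) x $ j * \<psi> x)" for i j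
        by (intro integrable_torus_continuous continuous_intros c\<psi> continuous_test_fun(2)[OF test_fun_bs_sum])
      have ibp: "(LINT x|torus. bs_sum \<xi> n i x * grad \<psi> x $ j) = - (LINT x|torus. grad (bs_sum \<xi> n i) x $ j * \<psi> x)" for i j
        unfolding grad_bs_sum bs_sum_def by (rule integral_partial_Re_trig_mult[OF \<psi>])
      show ?thesis
        unfolding ibp bs_sum_curl[OF \<xi>, symmetric] using i by (simp add: left_diff_distrib)
    qed
    have "(\<lambda>n. - (LINT x|torus. fourier_sum \<xi> n x * \<psi> x)) \<longlonglongrightarrow> - (LINT x|torus. \<xi> x * \<psi> x)"
    proof (intro tendsto_minus L2_limit_tendsto_integral_mult[OF _ _ _ \<xi>2 _ c\<psi>(1)])
      show "fourier_sum \<xi> n \<in> borel_measurable torus" for n unfolding fourier_sum_def[abs_def] by measurable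
      show "integrable torus (\<lambda>x. (norm (fourier_sum \<xi> n x))\<^sup>2)" for n
        unfolding fourier_sum_def by (intro integrable_torus_continuous continuous_intros continuous_Re_trig)
      show "(\<lambda>n. LINT x|torus. (norm (fourier_sum \<xi> n x - \<xi> x))\<^sup>2) \<longlonglongrightarrow> 0"
        by (rule fourier_sum_tendsto_L2[OF _ \<xi>2]) simp
    qed simp
    moreover have "(\<lambda>n. - (LINT x|torus. fourier_sum \<xi> n x * \<psi> x)) \<longlonglongrightarrow>
        (LINT x|torus. u x $ 2 * grad \<psi> x $ 1) - (LINT x|torus. u x $ 1 * grad \<psi> x $ 2)"
      unfolding eq[symmetric] by (intro tendsto_diff int c\<psi>(2))
    ultimately have "(LINT x|torus. u x $ 2 * grad \<psi> x $ 1) - (LINT x|torus. u x $ 1 * grad \<psi> x $ 2)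
        = - (LINT x|torus. \<xi> x * \<psi> x)"
      by (rule LIMSEQ_unique[rotated])
    then show "(LINT x|torus. u x \<bullet> perp (grad \<psi> x)) = - (LINT x|torus. \<xi> x * \<psi> x)"
      using uint[OF c\<psi>(2)] by (simp add: inner_vec_def sum_2 perp_def)
  qed
  show thesis using that uL zm div curl ulim by blast
qed

text \<open>The choice in \<open>biot_savart\<close> is made among square integrable fields. The
  field constructed above shows that the choice is not void, and by uniqueness its further
  properties carry over.\<close>

lemma biot_savart:
  assumes \<xi>: "\<xi> \<in> E_space"
  shows biot_savart_Lspace_4: "biot_savart \<xi> \<in> Lspace 4"
    and bs_sum_tendsto: "(\<lambda>n. LINT x|torus. (norm (bs_sum \<xi> n i x - biot_savart \<xi> x $ i))\<^sup>2) \<longlonglongrightarrow> 0"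
proof -
  obtain u where u: "u \<in> Lspace 4" "zero_mean u" "weakly_div_free u" "weak_curl_eq u \<xi>"
    and lim: "\<And>i. (\<lambda>n. LINT x|torus. (norm (bs_sum \<xi> n i x - u x $ i))\<^sup>2) \<longlonglongrightarrow> 0"
    using biot_savart_field_exists[OF \<xi>] by blast
  have u2: "u \<in> Lspace 2" using u Lspace_4_subset_2 by blast
  have v: "biot_savart \<xi> \<in> Lspace 2 \<and> zero_mean (biot_savart \<xi>) \<and> weakly_div_free (biot_savart \<xi>) \<and> weak_curl_eq (biot_savart \<xi>) \<xi>"
    unfolding biot_savart_def by (rule someI[of _ u]) (use u u2 in simp)
  have ae: "AE x in torus. u x = biot_savart \<xi> x"
    by (rule div_curl_unique) (use u u2 v in auto)
  show "biot_savart \<xi> \<in> Lspace 4"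
    by (rule Lspace_AE_cong[OF u(1) _ _ ae]) (use v in \<open>auto simp: Lspace_numeral_iff\<close>)
  have [measurable]: "(\<lambda>x. u x $ i) \<in> borel_measurable torus" "(\<lambda>x. biot_savart \<xi> x $ i) \<in> borel_measurable torus"
    using u2 v by (auto simp: Lspace_numeral_iff intro: borel_measurable_vec_nth)
  have "(LINT x|torus. (norm (bs_sum \<xi> n i x - u x $ i))\<^sup>2) = (LINT x|torus. (norm (bs_sum \<xi> n i x - biot_savart \<xi> x $ i))\<^sup>2)" for n
    by (intro integral_cong_AE) (use ae in auto)
  then show "(\<lambda>n. LINT x|torus. (norm (bs_sum \<xi> n i x - biot_savart \<xi> x $ i))\<^sup>2) \<longlonglongrightarrow> 0"
    using lim[of i] by simp
qed

section \<open>Skew symmetry of the transport operator\<close>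

text \<open>Cauchy-Schwarz for the squares of the two functions.\<close>

lemma (in finite_measure) L2_mult_of_power4:
  fixes f g :: "'a \<Rightarrow> 'b::{real_normed_div_algebra, banach, second_countable_topology}"
  assumes [measurable]: "f \<in> borel_measurable M" "g \<in> borel_measurable M"
    and "integrable M (\<lambda>x. (norm (f x))^4)" "integrable M (\<lambda>x. (norm (g x))^4)"
  shows "integrable M (\<lambda>x. (norm (f x * g x))\<^sup>2)"
proof -
  have "integrable M (\<lambda>x. (norm (f x))\<^sup>2 * (norm (g x))\<^sup>2)"
    by (rule integrable_mult_L2) (use assms in \<open>simp_all flip: power_mult\<close>)
  then show ?thesis by (simp add: norm_mult power_mult_distrib)
qed

text \<open>The identity \<open>f g = (f - F)(g - G) + f G + g F - F G\<close> leaves one term that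
  is small in both factors and two terms with only one varying factor.\<close>

lemma (in finite_measure) tendsto_integral_mult_L2_both:
  fixes f g :: "nat \<Rightarrow> 'a \<Rightarrow> real"
  assumes [measurable]: "\<And>n. f n \<in> borel_measurable M" "F \<in> borel_measurable M"
      "\<And>n. g n \<in> borel_measurable M" "G \<in> borel_measurable M"
    and f2: "\<And>n. integrable M (\<lambda>x. (norm (f n x))\<^sup>2)" and F2: "integrable M (\<lambda>x. (norm (F x))\<^sup>2)"
    and g2: "\<And>n. integrable M (\<lambda>x. (norm (g n x))\<^sup>2)" and G2: "integrable M (\<lambda>x. (norm (G x))\<^sup>2)"
    and flim: "(\<lambda>n. LINT x|M. (norm (f n x - F x))\<^sup>2) \<longlonglongrightarrow> 0"
    and glim: "(\<lambda>n. LINT x|M. (norm (g n x - G x))\<^sup>2) \<longlonglongrightarrow> 0"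
  shows "(\<lambda>n. LINT x|M. f n x * g n x) \<longlonglongrightarrow> (LINT x|M. F x * G x)"
proof -
  have df: "integrable M (\<lambda>x. (norm (f n x - F x))\<^sup>2)" for n by (intro L2_diff f2 F2) measurable
  have dg: "integrable M (\<lambda>x. (norm (g n x - G x))\<^sup>2)" for n by (intro L2_diff g2 G2) measurable
  have i: "integrable M (\<lambda>x. (f n x - F x) * (g n x - G x))" "integrable M (\<lambda>x. f n x * G x)"
    "integrable M (\<lambda>x. g n x * F x)" "integrable M (\<lambda>x. F x * G x)" for n
    by (intro integrable_mult_L2 df dg f2 F2 g2 G2; measurable)+
  have 1: "(\<lambda>n. LINT x|M. (f n x - F x) * (g n x - G x)) \<longlonglongrightarrow> 0"
  proof (rule Lim_null_comparison)
    show "\<forall>\<^sub>F n in sequentially. norm (LINT x|M. (f n x - F x) * (g n x - G x))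
        \<le> sqrt ((LINT x|M. (norm (f n x - F x))\<^sup>2) * (LINT x|M. (norm (g n x - G x))\<^sup>2))"
      by (intro always_eventually allI norm_integral_mult_le df dg) measurable
    show "(\<lambda>n. sqrt ((LINT x|M. (norm (f n x - F x))\<^sup>2) * (LINT x|M. (norm (g n x - G x))\<^sup>2))) \<longlonglongrightarrow> 0"
      using tendsto_real_sqrt[OF tendsto_mult[OF flim glim]] by simp
  qed
  have 2: "(\<lambda>n. LINT x|M. f n x * G x) \<longlonglongrightarrow> (LINT x|M. F x * G x)"
    by (rule tendsto_integral_mult_L2[OF _ _ _ f2 F2 G2 flim]) measurable
  have 3: "(\<lambda>n. LINT x|M. g n x * F x) \<longlonglongrightarrow> (LINT x|M. G x * F x)"
    by (rule tendsto_integral_mult_L2[OF _ _ _ g2 G2 F2 glim]) measurable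
  have "(LINT x|M. f n x * g n x) = (LINT x|M. (f n x - F x) * (g n x - G x)) + (LINT x|M. f n x * G x)
      + (LINT x|M. g n x * F x) - (LINT x|M. F x * G x)" for n
  proof -
    have "(LINT x|M. f n x * g n x) = (LINT x|M. (f n x - F x) * (g n x - G x) + f n x * G x + g n x * F x - F x * G x)"
      by (simp add: algebra_simps)
    then show ?thesis using i by simp
  qed
  moreover have "(\<lambda>n. (LINT x|M. (f n x - F x) * (g n x - G x)) + (LINT x|M. f n x * G x)
      + (LINT x|M. g n x * F x) - (LINT x|M. F x * G x)) \<longlonglongrightarrow> 0 + (LINT x|M. F x * G x) + (LINT x|M. G x * F x) - (LINT x|M. F x * G x)"
    by (intro tendsto_intros 1 2 3)
  ultimately show ?thesis by (simp add: mult.commute)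
qed

lemma tendsto_L2_mult_bounded:
  fixes f :: "nat \<Rightarrow> 'a \<Rightarrow> real"
  assumes [measurable]: "\<And>n. f n \<in> borel_measurable M" "F \<in> borel_measurable M" "b \<in> borel_measurable M"
    and f2: "\<And>n. integrable M (\<lambda>x. (norm (f n x))\<^sup>2)" and F2: "integrable M (\<lambda>x. (norm (F x))\<^sup>2)"
    and lim: "(\<lambda>n. LINT x|M. (norm (f n x - F x))\<^sup>2) \<longlonglongrightarrow> 0"
    and B: "\<And>x. x \<in> space M \<Longrightarrow> norm (b x) \<le> B"
  shows "(\<lambda>n. LINT x|M. (norm (b x * f n x - b x * F x))\<^sup>2) \<longlonglongrightarrow> 0"
proof (rule tendsto_sandwich[OF _ _ tendsto_const])
  have d: "integrable M (\<lambda>x. B\<^sup>2 * (norm (f n x - F x))\<^sup>2)" for n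
    by (intro integrable_mult_right L2_diff f2 F2) measurable
  have le: "(norm (b x * f n x - b x * F x))\<^sup>2 \<le> B\<^sup>2 * (norm (f n x - F x))\<^sup>2" if "x \<in> space M" for x n
  proof -
    have "(norm (b x))\<^sup>2 * (norm (f n x - F x))\<^sup>2 \<le> B\<^sup>2 * (norm (f n x - F x))\<^sup>2"
      by (intro mult_right_mono power_mono B that) auto
    then show ?thesis by (simp add: power_mult_distrib flip: right_diff_distrib)
  qed
  show "\<forall>\<^sub>F n in sequentially. (LINT x|M. (norm (b x * f n x - b x * F x))\<^sup>2) \<le> B\<^sup>2 * (LINT x|M. (norm (f n x - F x))\<^sup>2)"
  proof (intro always_eventually allI)
    fix n
    have "(LINT x|M. (norm (b x * f n x - b x * F x))\<^sup>2) \<le> (LINT x|M. B\<^sup>2 * (norm (f n x - F x))\<^sup>2)"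
      by (intro integral_mono d le Bochner_Integration.integrable_bound[OF d]) (use le in auto)
    then show "(LINT x|M. (norm (b x * f n x - b x * F x))\<^sup>2) \<le> B\<^sup>2 * (LINT x|M. (norm (f n x - F x))\<^sup>2)" by simp
  qed
  show "(\<lambda>n. B\<^sup>2 * (LINT x|M. (norm (f n x - F x))\<^sup>2)) \<longlonglongrightarrow> 0"
    using tendsto_mult_left[OF lim, of "B\<^sup>2"] by simp
qed simp

text \<open>The periodic function \<open>b * z\<^sup>2\<close> has a partial derivative with
  integral 0. Summed over the components of a solenoidal \<open>b\<close>, the right side
  vanishes.\<close>

lemma integral_test_fun_mult_square:
  assumes b: "b \<in> test_fun" and z: "z \<in> test_fun"
  shows "2 * (LINT x|torus. (b x * grad z x $ i) * z x) = - (LINT x|torus. grad b x $ i * (z x)\<^sup>2)"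
proof -
  note c = continuous_test_fun[OF b] continuous_test_fun[OF z]
  let ?b' = "\<lambda>x. frechet_derivative b (at x)" and ?z' = "\<lambda>x. frechet_derivative z (at x)"
  have "(LINT x|torus. b x * (z x * ?z' x (axis i 1) + ?z' x (axis i 1) * z x) + ?b' x (axis i 1) * (z x * z x)) = 0"
  proof (rule integral_partial_derivative_periodic)
    show "periodic (\<lambda>x. b x * (z x * z x))" using b z by (simp add: periodic_def test_fun_def)
    show "((\<lambda>x. b x * (z x * z x)) has_derivative
        (\<lambda>h. b x * (z x * ?z' x h + ?z' x h * z x) + ?b' x h * (z x * z x))) (at x)" for x
      by (intro has_derivative_mult has_derivative_test_fun(1) b z)
    show "continuous_on UNIV (\<lambda>x. b x * (z x * ?z' x (axis i 1) + ?z' x (axis i 1) * z x) + ?b' x (axis i 1) * (z x * z x))"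
      unfolding has_derivative_test_fun(2)[OF b] has_derivative_test_fun(2)[OF z] by (intro continuous_intros c)
  qed
  then have "(LINT x|torus. 2 * ((b x * grad z x $ i) * z x) + grad b x $ i * (z x)\<^sup>2) = 0"
    unfolding has_derivative_test_fun(2)[OF b] has_derivative_test_fun(2)[OF z]
    by (simp add: power2_eq_square algebra_simps)
  moreover have "integrable torus (\<lambda>x. 2 * ((b x * grad z x $ i) * z x))" "integrable torus (\<lambda>x. grad b x $ i * (z x)\<^sup>2)"
    by (intro integrable_torus_continuous continuous_intros c)+
  ultimately show ?thesis by simp
qed

text \<open>Shows that truncation commutes with the weak gradient, so that the gradients of the
  partial sums converge to it in the mean square.\<close>

lemma fcoef_weak_gradient:
  assumes g: "has_weak_gradient f g"
  shows "fcoef (\<lambda>x. complex_of_real (g x $ i)) = dcoef i (fcoef (\<lambda>x. complex_of_real (f x)))"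
proof
  fix k
  have fint: "integrable torus f" and gint: "integrable torus (\<lambda>x. g x $ i)"
    using g by (auto simp: has_weak_gradient_def Lspace_1_iff intro: integrable_vec_nth)
  have "fcoef (\<lambda>x. complex_of_real (g x $ i)) k - dcoef i (fcoef (\<lambda>x. complex_of_real (f x))) k = 0"
  proof (rule complex_eq_0_of_Re_mult)
    fix z
    \<comment> \<open>The coefficient at \<open>k\<close> is an integral against the character of
      \<open>- k\<close>. The sign in this multiplier cancels the sign in the definition of the weak
      gradient.\<close>
    let ?y = "dcoef i (\<lambda>_. z) (- k)"
    have t: "(\<lambda>x. Re (z * char2 (- k) x)) \<in> test_fun"
      using test_fun_Re_trig[of "{- k}" "\<lambda>_. z"] by (simp add: trig_singleton)
    have grad: "grad (\<lambda>x. Re (z * char2 (- k) x)) x $ i = Re (?y * char2 (- k) x)" for x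
      using grad_Re_trig[of "{- k}" "\<lambda>_. z"] by (simp add: trig_singleton)
    have "(LINT x|torus. f x * grad (\<lambda>x. Re (z * char2 (- k) x)) x $ i) = - (LINT x|torus. g x $ i * Re (z * char2 (- k) x))"
      using g t unfolding has_weak_gradient_def by blast
    then have "Re (?y * fcoef (\<lambda>x. complex_of_real (f x)) k) = - Re (z * fcoef (\<lambda>x. complex_of_real (g x $ i)) k)"
      unfolding grad integral_mult_Re_char2(2)[OF fint] integral_mult_Re_char2(2)[OF gint] fcoef_def cnj_char2 .
    moreover have "?y * fcoef (\<lambda>x. complex_of_real (f x)) k = - (z * dcoef i (fcoef (\<lambda>x. complex_of_real (f x))) k)"
      by (simp add: dcoef_def)
    ultimately show "Re (z * (fcoef (\<lambda>x. complex_of_real (g x $ i)) k - dcoef i (fcoef (\<lambda>x. complex_of_real (f x))) k)) = 0"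
      by (simp only: right_diff_distrib minus_complex.sel uminus_complex.sel)
  qed
  then show "fcoef (\<lambda>x. complex_of_real (g x $ i)) k = dcoef i (fcoef (\<lambda>x. complex_of_real (f x))) k" by simp
qed

lemma test_fun_fourier_sum: "fourier_sum f n \<in> test_fun"
  unfolding fourier_sum_def[abs_def] by (rule test_fun_Re_trig)

lemma grad_fourier_sum:
  assumes "has_weak_gradient f g"
  shows "grad (fourier_sum f n) x $ i = fourier_sum (\<lambda>y. g y $ i) n x"
  unfolding fourier_sum_def[abs_def] grad_Re_trig fcoef_weak_gradient[OF assms] ..

lemma continuous_fourier_sum: "continuous_on S (fourier_sum f n)"
  unfolding fourier_sum_def[abs_def] by (rule continuous_Re_trig)

lemma fourier_sum_L2: "integrable torus (\<lambda>x. (norm (fourier_sum f n x))\<^sup>2)"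
  by (intro integrable_torus_continuous continuous_intros continuous_fourier_sum)

context
  fixes \<xi> \<zeta> :: "real^2 \<Rightarrow> real"
  assumes \<xi>: "\<xi> \<in> E_space" and \<zeta>: "\<zeta> \<in> W1 4"
begin

private lemma B4: "biot_savart \<xi> \<in> borel_measurable torus" "integrable torus (\<lambda>x. (norm (biot_savart \<xi> x)) ^ 4)"
  "periodic (biot_savart \<xi>)"
  using biot_savart_Lspace_4[OF \<xi>] by (auto simp: Lspace_numeral_iff)

private lemma g4: "weak_grad \<zeta> \<in> borel_measurable torus" "integrable torus (\<lambda>x. (norm (weak_grad \<zeta> x)) ^ 4)"
  "periodic (weak_grad \<zeta>)"
  using weak_grad_Lspace[OF \<zeta>] by (auto simp: Lspace_numeral_iff)

private lemma z4: "\<zeta> \<in> borel_measurable torus" "integrable torus (\<lambda>x. (norm (\<zeta> x)) ^ 4)"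
  using \<zeta> by (auto simp: W1_def Lspace_numeral_iff)

private lemma comp:
  "(\<lambda>x. biot_savart \<xi> x $ i) \<in> borel_measurable torus" "integrable torus (\<lambda>x. (norm (biot_savart \<xi> x $ i)) ^ 4)"
  "integrable torus (\<lambda>x. (norm (biot_savart \<xi> x $ i))\<^sup>2)"
  "(\<lambda>x. weak_grad \<zeta> x $ i) \<in> borel_measurable torus" "integrable torus (\<lambda>x. (norm (weak_grad \<zeta> x $ i)) ^ 4)"
  "integrable torus (\<lambda>x. (norm (weak_grad \<zeta> x $ i))\<^sup>2)"
  by (intro borel_measurable_vec_nth integrable_vec_nth_power torus.power2_integrable_of_power4 B4 g4)+

private lemma z2: "integrable torus (\<lambda>x. (norm (\<zeta> x))\<^sup>2)"
  by (intro torus.power2_integrable_of_power4 z4)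

text \<open>Both factors have integrable fourth powers; this pairing of exponents is the reason for
  \<open>W1 4\<close>.\<close>

lemma transport_Lspace_2: "transport \<xi> \<zeta> \<in> Lspace 2"
proof -
  have [measurable]: "biot_savart \<xi> \<in> borel_measurable torus" "weak_grad \<zeta> \<in> borel_measurable torus"
    by (rule B4 g4)+
  have m[measurable]: "transport \<xi> \<zeta> \<in> borel_measurable torus"
    unfolding transport_def[abs_def] by measurable
  have "integrable torus (\<lambda>x. (norm (norm (biot_savart \<xi> x) * norm (weak_grad \<zeta> x)))\<^sup>2)"
    by (rule torus.L2_mult_of_power4) (use B4 g4 in auto)
  then have "integrable torus (\<lambda>x. (norm (transport \<xi> \<zeta> x))\<^sup>2)"
  proof (rule Bochner_Integration.integrable_bound)
    show "AE x in torus. norm ((norm (transport \<xi> \<zeta> x))\<^sup>2) \<le> norm ((norm (norm (biot_savart \<xi> x) * norm (weak_grad \<zeta> x)))\<^sup>2)"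
    proof (rule AE_I2)
      fix x
      have "(norm (transport \<xi> \<zeta> x))\<^sup>2 \<le> (norm (biot_savart \<xi> x) * norm (weak_grad \<zeta> x))\<^sup>2"
        using Cauchy_Schwarz_ineq2[of "biot_savart \<xi> x" "weak_grad \<zeta> x"]
        unfolding transport_def by (intro power_mono) auto
      then show "norm ((norm (transport \<xi> \<zeta> x))\<^sup>2) \<le> norm ((norm (norm (biot_savart \<xi> x) * norm (weak_grad \<zeta> x)))\<^sup>2)"
        by simp
    qed
  qed measurable
  moreover have "periodic (transport \<xi> \<zeta>)"
    using B4(3) g4(3) unfolding periodic_def transport_def by simp
  ultimately show ?thesis using m by (simp add: Lspace_numeral_iff)
qed

text \<open>It suffices to test with the smooth solenoidal truncations of the velocity.\<close>

private lemma transport_limit: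
  assumes w: "w \<in> borel_measurable torus" "\<And>i. integrable torus (\<lambda>x. (norm (weak_grad \<zeta> x $ i * w x))\<^sup>2)"
    and 0: "\<And>n. (LINT x|torus. bs_sum \<xi> n 1 x * (weak_grad \<zeta> x $ 1 * w x))
      + (LINT x|torus. bs_sum \<xi> n 2 x * (weak_grad \<zeta> x $ 2 * w x)) = 0"
  shows "(LINT x|torus. transport \<xi> \<zeta> x * w x) = 0"
proof -
  note [measurable] = comp(1,4) w(1)
  have lim: "(\<lambda>n. LINT x|torus. bs_sum \<xi> n i x * (weak_grad \<zeta> x $ i * w x))
      \<longlonglongrightarrow> (LINT x|torus. biot_savart \<xi> x $ i * (weak_grad \<zeta> x $ i * w x))" for i
    by (rule torus.tendsto_integral_mult_L2[OF _ _ _ bs_sum_L2 comp(3) w(2) bs_sum_tendsto[OF \<xi>]]) measurable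
  have int: "integrable torus (\<lambda>x. biot_savart \<xi> x $ i * (weak_grad \<zeta> x $ i * w x))" for i
    by (rule integrable_mult_L2[OF _ _ comp(3) w(2)]) measurable
  have "(LINT x|torus. transport \<xi> \<zeta> x * w x)
      = (LINT x|torus. biot_savart \<xi> x $ 1 * (weak_grad \<zeta> x $ 1 * w x) + biot_savart \<xi> x $ 2 * (weak_grad \<zeta> x $ 2 * w x))"
    by (simp add: transport_def inner_vec_def sum_2 algebra_simps)
  also have "\<dots> = (LINT x|torus. biot_savart \<xi> x $ 1 * (weak_grad \<zeta> x $ 1 * w x)) + (LINT x|torus. biot_savart \<xi> x $ 2 * (weak_grad \<zeta> x $ 2 * w x))"
    by (rule Bochner_Integration.integral_add[OF int int])
  also have "\<dots> = 0"
    using tendsto_add[OF lim[of 1] lim[of 2]] unfolding 0 by (simp add: LIMSEQ_const_iff)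
  finally show ?thesis .
qed

private lemma wg: "has_weak_gradient \<zeta> (weak_grad \<zeta>)"
  by (rule has_weak_gradient_weak_grad[OF \<zeta>])

text \<open>The components of a truncated velocity are themselves test functions for the weak
  gradient of \<open>\<zeta>\<close>, and the derivatives which they receive add up to the
  divergence.\<close>

lemma integral_transport_eq_0: "(LINT x|torus. transport \<xi> \<zeta> x) = 0"
proof -
  note [measurable] = z4(1)
  have "(LINT x|torus. transport \<xi> \<zeta> x * 1) = 0"
  proof (rule transport_limit)
    fix n
    have wgb: "(LINT x|torus. \<zeta> x * grad (bs_sum \<xi> n i) x $ i) = - (LINT x|torus. weak_grad \<zeta> x $ i * bs_sum \<xi> n i x)" for i
      using wg test_fun_bs_sum unfolding has_weak_gradient_def by blast
    have cg: "continuous_on UNIV (\<lambda>x. grad (bs_sum \<xi> n i) x $ i)" for i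
      by (rule continuous_test_fun(2)[OF test_fun_bs_sum])
    have i: "integrable torus (\<lambda>x. \<zeta> x * grad (bs_sum \<xi> n i) x $ i)" for i
      by (rule integrable_mult_L2[OF z4(1) _ z2])
         (auto intro!: borel_measurable_torus integrable_torus_continuous continuous_intros cg)
    have "(LINT x|torus. weak_grad \<zeta> x $ 1 * bs_sum \<xi> n 1 x) + (LINT x|torus. weak_grad \<zeta> x $ 2 * bs_sum \<xi> n 2 x)
        = - (LINT x|torus. \<zeta> x * (grad (bs_sum \<xi> n 1) x $ 1 + grad (bs_sum \<xi> n 2) x $ 2))"
      using wgb[of 1] wgb[of 2] i[of 1] i[of 2] by (simp add: distrib_left)
    also have "\<dots> = 0" by (simp add: bs_sum_div)
    finally show "(LINT x|torus. bs_sum \<xi> n 1 x * (weak_grad \<zeta> x $ 1 * 1)) + (LINT x|torus. bs_sum \<xi> n 2 x * (weak_grad \<zeta> x $ 2 * 1)) = 0"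
      by (simp add: mult.commute)
  qed (use comp(6) in auto)
  then show ?thesis by simp
qed

text \<open>There are two limits, in this order: with the velocity truncated, hence bounded, mean
  square convergence of the Fourier sums of \<open>\<zeta>\<close> and of their gradients suffices.
  Only then is the truncation removed, against the fixed function
  \<open>weak_grad \<zeta> x $ i * \<zeta> x\<close>, which is square integrable by the exponent
  4.\<close>

lemma integral_transport_mult_eq_0: "(LINT x|torus. transport \<xi> \<zeta> x * \<zeta> x) = 0"
proof (rule transport_limit)
  note [measurable] = z4(1) comp(4)
  show "\<zeta> \<in> borel_measurable torus" by (rule z4)
  show "integrable torus (\<lambda>x. (norm (weak_grad \<zeta> x $ i * \<zeta> x))\<^sup>2)" for i
    by (rule torus.L2_mult_of_power4[OF comp(4) z4(1) comp(5) z4(2)])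
  fix n
  define b where "b i = bs_sum \<xi> n i" for i
  have b[measurable]: "b i \<in> borel_measurable torus" for i unfolding b_def by measurable
  define Z where "Z m = fourier_sum \<zeta> m" for m
  have cb: "continuous_on UNIV (b i)" for i unfolding b_def by (rule continuous_bs_sum)
  have cZ: "continuous_on UNIV (Z m)" "continuous_on UNIV (\<lambda>x. grad (Z m) x $ i)" for i m
    unfolding Z_def by (rule continuous_fourier_sum, rule continuous_test_fun(2)[OF test_fun_fourier_sum])
  have [measurable]: "Z m \<in> borel_measurable torus" "(\<lambda>x. grad (Z m) x $ i) \<in> borel_measurable torus" for i m
    by (intro borel_measurable_torus cZ)+
  have lim: "(\<lambda>m. LINT x|torus. (b i x * grad (Z m) x $ i) * Z m x) \<longlonglongrightarrow> (LINT x|torus. (b i x * weak_grad \<zeta> x $ i) * \<zeta> x)" for i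
  proof (rule torus.tendsto_integral_mult_L2_both)
    show "(\<lambda>m. LINT x|torus. (norm (Z m x - \<zeta> x))\<^sup>2) \<longlonglongrightarrow> 0"
      unfolding Z_def by (rule fourier_sum_tendsto_L2[OF z4(1) z2])
    obtain B where B: "\<And>x. x \<in> space torus \<Longrightarrow> norm (b i x) \<le> B" using bounded_on_torus[OF cb] by blast
    have gl: "(\<lambda>m. LINT x|torus. (norm (grad (Z m) x $ i - weak_grad \<zeta> x $ i))\<^sup>2) \<longlonglongrightarrow> 0"
      unfolding Z_def grad_fourier_sum[OF wg] by (rule fourier_sum_tendsto_L2[OF comp(4) comp(6)])
    have g2: "integrable torus (\<lambda>x. (norm (grad (Z m) x $ i))\<^sup>2)" for m
      by (intro integrable_torus_continuous continuous_intros cZ)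
    show "(\<lambda>m. LINT x|torus. (norm (b i x * grad (Z m) x $ i - b i x * weak_grad \<zeta> x $ i))\<^sup>2) \<longlonglongrightarrow> 0"
      by (rule tendsto_L2_mult_bounded[OF _ _ _ g2 comp(6) gl B]) measurable
    show "integrable torus (\<lambda>x. (norm (Z m x))\<^sup>2)" for m unfolding Z_def by (rule fourier_sum_L2)
    show "integrable torus (\<lambda>x. (norm (\<zeta> x))\<^sup>2)" by (rule z2)
    show "integrable torus (\<lambda>x. (norm (b i x * grad (Z m) x $ i))\<^sup>2)" for m
      by (intro integrable_torus_continuous continuous_intros cb cZ)
    show "integrable torus (\<lambda>x. (norm (b i x * weak_grad \<zeta> x $ i))\<^sup>2)"
      by (intro torus.L2_mult_of_power4 comp b integrable_torus_continuous continuous_intros cb)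
  qed measurable
  have 0: "(LINT x|torus. (b 1 x * grad (Z m) x $ 1) * Z m x) + (LINT x|torus. (b 2 x * grad (Z m) x $ 2) * Z m x) = 0" for m
  proof -
    have eq: "2 * (LINT x|torus. (b i x * grad (Z m) x $ i) * Z m x) = - (LINT x|torus. grad (b i) x $ i * (Z m x)\<^sup>2)" for i
      unfolding b_def Z_def by (rule integral_test_fun_mult_square[OF test_fun_bs_sum test_fun_fourier_sum])
    have cg: "continuous_on UNIV (\<lambda>x. grad (b i) x $ i)" for i
      unfolding b_def by (rule continuous_test_fun(2)[OF test_fun_bs_sum])
    have i: "integrable torus (\<lambda>x. grad (b i) x $ i * (Z m x)\<^sup>2)" for i
      by (intro integrable_torus_continuous continuous_intros cg cZ)
    have "2 * ((LINT x|torus. (b 1 x * grad (Z m) x $ 1) * Z m x) + (LINT x|torus. (b 2 x * grad (Z m) x $ 2) * Z m x))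
        = - (LINT x|torus. (grad (b 1) x $ 1 + grad (b 2) x $ 2) * (Z m x)\<^sup>2)"
      unfolding distrib_left eq using i[of 1] i[of 2] by (simp add: distrib_right)
    also have "\<dots> = 0" unfolding b_def by (simp add: bs_sum_div)
    finally show ?thesis by simp
  qed
  have "(LINT x|torus. (b 1 x * weak_grad \<zeta> x $ 1) * \<zeta> x) + (LINT x|torus. (b 2 x * weak_grad \<zeta> x $ 2) * \<zeta> x) = 0"
    using tendsto_add[OF lim[of 1] lim[of 2]] unfolding 0 by (simp add: LIMSEQ_const_iff)
  then show "(LINT x|torus. bs_sum \<xi> n 1 x * (weak_grad \<zeta> x $ 1 * \<zeta> x)) + (LINT x|torus. bs_sum \<xi> n 2 x * (weak_grad \<zeta> x $ 2 * \<zeta> x)) = 0"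
    by (simp add: b_def mult.assoc)
qed

end

section \<open>Solution of the equation\<close>

text \<open>Lions' projection theorem: the functional \<open>T \<zeta> \<mapsto> \<langle>\<xi>, \<zeta>\<rangle>\<close> is well-defined and
  bounded on the range of \<open>T\<close>. Its representing vector is obtained as the limit of \<open>T \<zeta>\<^sub>n\<close> for a
  minimizing sequence \<open>\<zeta>\<^sub>n\<close> of \<open>J \<zeta> = \<parallel>T \<zeta>\<parallel>\<^sup>2 / 2 - \<langle>\<xi>, \<zeta>\<rangle>\<close>.\<close>

lemma (in finite_measure) Lions_projection:
  fixes T :: "('a \<Rightarrow> real) \<Rightarrow> 'a \<Rightarrow> real" and V :: "('a \<Rightarrow> real) set"
  assumes V0: "(\<lambda>_. 0) \<in> V" and Vlin: "\<And>\<zeta> \<eta> a b. \<zeta> \<in> V \<Longrightarrow> \<eta> \<in> V \<Longrightarrow> (\<lambda>x. a * \<zeta> x + b * \<eta> x) \<in> V"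
    and Vm: "\<And>\<zeta>. \<zeta> \<in> V \<Longrightarrow> \<zeta> \<in> borel_measurable M" and V2: "\<And>\<zeta>. \<zeta> \<in> V \<Longrightarrow> integrable M (\<lambda>x. (norm (\<zeta> x))\<^sup>2)"
    and Tm: "\<And>\<zeta>. \<zeta> \<in> V \<Longrightarrow> T \<zeta> \<in> borel_measurable M" and T2: "\<And>\<zeta>. \<zeta> \<in> V \<Longrightarrow> integrable M (\<lambda>x. (norm (T \<zeta> x))\<^sup>2)"
    and Tlin: "\<And>\<zeta> \<eta> a b. \<zeta> \<in> V \<Longrightarrow> \<eta> \<in> V \<Longrightarrow> AE x in M. T (\<lambda>x. a * \<zeta> x + b * \<eta> x) x = a * T \<zeta> x + b * T \<eta> x"
    and coercive: "\<And>\<zeta>. \<zeta> \<in> V \<Longrightarrow> (LINT x|M. (norm (\<zeta> x))\<^sup>2) \<le> (LINT x|M. (norm (T \<zeta> x))\<^sup>2)"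
    and \<xi>m: "\<xi> \<in> borel_measurable M" and \<xi>2: "integrable M (\<lambda>x. (norm (\<xi> x))\<^sup>2)"
  obtains \<Phi> z r where "\<And>n. z n \<in> V" "\<Phi> = (\<lambda>x. lim (\<lambda>j. T (z (r j)) x))" "\<Phi> \<in> borel_measurable M"
    "integrable M (\<lambda>x. (norm (\<Phi> x))\<^sup>2)" "(\<lambda>n. LINT x|M. (norm (T (z n) x - \<Phi> x))\<^sup>2) \<longlonglongrightarrow> 0"
    "\<And>\<eta>. \<eta> \<in> V \<Longrightarrow> (LINT x|M. \<Phi> x * T \<eta> x) = (LINT x|M. \<xi> x * \<eta> x)"
proof -
  define Q where "Q \<zeta> \<eta> = (LINT x|M. T \<zeta> x * T \<eta> x)" for \<zeta> \<eta>
  define l where "l \<zeta> = (LINT x|M. \<xi> x * \<zeta> x)" for \<zeta>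
  define J where "J \<zeta> = Q \<zeta> \<zeta> / 2 - l \<zeta>" for \<zeta>
  have QQ: "Q \<zeta> \<zeta> = (LINT x|M. (norm (T \<zeta> x))\<^sup>2)" for \<zeta>
    by (simp add: Q_def power2_eq_square)
  have Q0: "Q \<zeta> \<zeta> \<ge> 0" for \<zeta> unfolding QQ by simp
  have Qint: "integrable M (\<lambda>x. T \<zeta> x * T \<eta> x)" if "\<zeta> \<in> V" "\<eta> \<in> V" for \<zeta> \<eta>
    by (rule integrable_mult_L2) (use that Tm T2 in auto)
  have lint: "integrable M (\<lambda>x. \<xi> x * \<zeta> x)" if "\<zeta> \<in> V" for \<zeta>
    by (rule integrable_mult_L2) (use that \<xi>m \<xi>2 Vm V2 in auto)
  have Qlin: "Q (\<lambda>x. a * \<zeta> x + b * \<eta> x) (\<lambda>x. a * \<zeta> x + b * \<eta> x) = a\<^sup>2 * Q \<zeta> \<zeta> + 2 * a * b * Q \<zeta> \<eta> + b\<^sup>2 * Q \<eta> \<eta>"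
    if V: "\<zeta> \<in> V" "\<eta> \<in> V" for \<zeta> \<eta> a b
  proof -
    note [measurable] = Tm[OF V(1)] Tm[OF V(2)] Tm[OF Vlin[OF V]]
    have "Q (\<lambda>x. a * \<zeta> x + b * \<eta> x) (\<lambda>x. a * \<zeta> x + b * \<eta> x)
        = (LINT x|M. a\<^sup>2 * (T \<zeta> x * T \<zeta> x) + 2 * a * b * (T \<zeta> x * T \<eta> x) + b\<^sup>2 * (T \<eta> x * T \<eta> x))"
      unfolding Q_def
    proof (rule integral_cong_AE)
      show "AE x in M. T (\<lambda>x. a * \<zeta> x + b * \<eta> x) x * T (\<lambda>x. a * \<zeta> x + b * \<eta> x) x
          = a\<^sup>2 * (T \<zeta> x * T \<zeta> x) + 2 * a * b * (T \<zeta> x * T \<eta> x) + b\<^sup>2 * (T \<eta> x * T \<eta> x)"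
        using Tlin[OF V, of a b] by eventually_elim (simp add: power2_eq_square algebra_simps)
    qed measurable
    then show ?thesis using Qint[OF V] Qint[OF V(1) V(1)] Qint[OF V(2) V(2)] by (simp add: Q_def)
  qed
  have llin: "l (\<lambda>x. a * \<zeta> x + b * \<eta> x) = a * l \<zeta> + b * l \<eta>" if V: "\<zeta> \<in> V" "\<eta> \<in> V" for \<zeta> \<eta> a b
  proof -
    have "l (\<lambda>x. a * \<zeta> x + b * \<eta> x) = (LINT x|M. a * (\<xi> x * \<zeta> x) + b * (\<xi> x * \<eta> x))"
      unfolding l_def by (simp add: algebra_simps)
    then show ?thesis using lint[OF V(1)] lint[OF V(2)] by (simp add: l_def)
  qed
  \<comment> \<open>The linear term is split by the inequality of the means, and coercivity absorbs
    the part in \<open>\<zeta>\<close> into the quadratic term.\<close>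
  have bdd: "- (LINT x|M. (norm (\<xi> x))\<^sup>2) / 2 \<le> J \<zeta>" if V: "\<zeta> \<in> V" for \<zeta>
  proof -
    have "l \<zeta> \<le> (LINT x|M. (norm (\<xi> x))\<^sup>2 / 2 + (norm (\<zeta> x))\<^sup>2 / 2)"
      unfolding l_def
    proof (rule integral_mono)
      show "integrable M (\<lambda>x. (norm (\<xi> x))\<^sup>2 / 2 + (norm (\<zeta> x))\<^sup>2 / 2)" using \<xi>2 V2[OF V] by simp
      show "\<xi> x * \<zeta> x \<le> (norm (\<xi> x))\<^sup>2 / 2 + (norm (\<zeta> x))\<^sup>2 / 2" for x
        using sum_squares_bound[of "\<xi> x" "\<zeta> x"] by simp
    qed (rule lint[OF V])
    also have "\<dots> = (LINT x|M. (norm (\<xi> x))\<^sup>2) / 2 + (LINT x|M. (norm (\<zeta> x))\<^sup>2) / 2"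
      using \<xi>2 V2[OF V] by simp
    finally show ?thesis using coercive[OF V] unfolding J_def QQ by simp
  qed
  define j where "j = Inf (J ` V)"
  have bb: "bdd_below (J ` V)" using bdd by (auto intro!: bdd_belowI2)
  have jle: "j \<le> J \<zeta>" if "\<zeta> \<in> V" for \<zeta> unfolding j_def using bb that by (intro cInf_lower) auto
  have "\<exists>\<zeta>\<in>V. J \<zeta> < j + 1 / real (Suc n)" for n
  proof -
    have "Inf (J ` V) < j + 1 / real (Suc n)" by (simp add: j_def)
    then show ?thesis using cInf_lessD[of "J ` V"] V0 by auto
  qed
  then obtain z where zV: "\<And>n. z n \<in> V" and zJ: "\<And>n. J (z n) < j + 1 / real (Suc n)" by metis
  have par: "(LINT x|M. (norm (T (z m) x - T (z n) x))\<^sup>2) \<le> 4 * (1 / real (Suc m) + 1 / real (Suc n))" for m n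
  proof -
    have "(LINT x|M. (norm (T (z m) x - T (z n) x))\<^sup>2)
        = (LINT x|M. T (z m) x * T (z m) x - 2 * (T (z m) x * T (z n) x) + T (z n) x * T (z n) x)"
      by (simp add: power2_eq_square algebra_simps)
    also have "\<dots> = Q (z m) (z m) - 2 * Q (z m) (z n) + Q (z n) (z n)"
      using Qint[OF zV zV] by (simp add: Q_def)
    \<comment> \<open>The parallelogram law: the linear parts cancel at the midpoint. As
      \<open>J\<close> is at least \<open>j\<close> there, near-minimality at the ends forces the
      images under \<open>T\<close> together, though not the arguments.\<close>
    also have "\<dots> = 4 * (J (z m) + J (z n) - 2 * J (\<lambda>x. 1/2 * z m x + 1/2 * z n x))"
      unfolding J_def Qlin[OF zV zV] llin[OF zV zV] by (simp add: power2_eq_square field_simps)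
    also have "\<dots> \<le> 4 * (1 / real (Suc m) + 1 / real (Suc n))"
    proof -
      have "4 * (J (z m) + J (z n) - 2 * w) \<le> 4 * (p + q)"
        if "J (z m) < j + p" "J (z n) < j + q" "j \<le> w" for p q w using that by simp
      from this[OF zJ zJ jle[OF Vlin[OF zV zV]]] show ?thesis .
    qed
    finally show ?thesis .
  qed
  have inv0: "(\<lambda>n. 1 / real (Suc n)) \<longlonglongrightarrow> 0" by (rule LIMSEQ_Suc[OF lim_1_over_n])
  have Cauchy: "\<exists>N. \<forall>m\<ge>N. \<forall>n\<ge>N. (LINT x|M. (norm (T (z m) x - T (z n) x))\<^sup>2) < e" if "e > 0" for e
  proof -
    have "\<forall>\<^sub>F n in sequentially. 1 / real (Suc n) < e / 8"
      by (rule order_tendstoD(2)[OF inv0]) (use that in simp)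
    then obtain N where N: "\<And>n. n \<ge> N \<Longrightarrow> 1 / real (Suc n) < e / 8" by (auto simp: eventually_sequentially)
    have "(LINT x|M. (norm (T (z m) x - T (z n) x))\<^sup>2) < e" if "m \<ge> N" "n \<ge> N" for m n
    proof -
      have "d < e" if "d \<le> 4 * (p + q)" "p < e / 8" "q < e / 8" for d p q using that by simp
      from this[OF par N[OF that(1)] N[OF that(2)]] show ?thesis .
    qed
    then show ?thesis by blast
  qed
  obtain \<Phi> r where \<Phi>: "\<Phi> = (\<lambda>x. lim (\<lambda>j. T (z (r j)) x))" and \<Phi>m[measurable]: "\<Phi> \<in> borel_measurable M"
    and \<Phi>2: "integrable M (\<lambda>x. (norm (\<Phi> x))\<^sup>2)" and lim: "(\<lambda>n. LINT x|M. (norm (T (z n) x - \<Phi> x))\<^sup>2) \<longlonglongrightarrow> 0"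
    by (rule L2_complete[OF Tm[OF zV] T2[OF zV] Cauchy]) blast+
  have "(LINT x|M. \<Phi> x * T \<eta> x) = (LINT x|M. \<xi> x * \<eta> x)" if \<eta>: "\<eta> \<in> V" for \<eta>
  proof -
    define d where "d = (LINT x|M. \<Phi> x * T \<eta> x) - l \<eta>"
    have Ql: "(\<lambda>n. Q (z n) \<eta>) \<longlonglongrightarrow> (LINT x|M. \<Phi> x * T \<eta> x)"
      unfolding Q_def by (rule tendsto_integral_mult_L2[OF Tm[OF zV] \<Phi>m Tm[OF \<eta>] T2[OF zV] \<Phi>2 T2[OF \<eta>] lim])
    \<comment> \<open>The infimum need not be attained in \<open>V\<close>, so the variation in the
      direction \<open>\<eta>\<close> is taken at \<open>z n\<close>, with error
      \<open>1 / Suc n\<close>, and passed to the limit.\<close>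
    have var: "0 \<le> s * d + s\<^sup>2 * (Q \<eta> \<eta> / 2)" for s
    proof (rule tendsto_le[OF _ _ tendsto_const])
      show "(\<lambda>n. 1 / real (Suc n) + s * (Q (z n) \<eta> - l \<eta>) + s\<^sup>2 * (Q \<eta> \<eta> / 2)) \<longlonglongrightarrow> s * d + s\<^sup>2 * (Q \<eta> \<eta> / 2)"
      proof -
        have "(\<lambda>n. 1 / real (Suc n) + s * (Q (z n) \<eta> - l \<eta>) + s\<^sup>2 * (Q \<eta> \<eta> / 2)) \<longlonglongrightarrow> 0 + s * d + s\<^sup>2 * (Q \<eta> \<eta> / 2)"
          unfolding d_def by (intro tendsto_add tendsto_mult tendsto_diff tendsto_const inv0 Ql)
        then show ?thesis by simp
      qed
      show "\<forall>\<^sub>F n in sequentially. 0 \<le> 1 / real (Suc n) + s * (Q (z n) \<eta> - l \<eta>) + s\<^sup>2 * (Q \<eta> \<eta> / 2)"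
      proof (intro always_eventually allI)
        fix n
        have "j \<le> J (\<lambda>x. 1 * z n x + s * \<eta> x)" by (rule jle[OF Vlin[OF zV \<eta>]])
        also have "\<dots> = J (z n) + s * (Q (z n) \<eta> - l \<eta>) + s\<^sup>2 * (Q \<eta> \<eta> / 2)"
          unfolding J_def Qlin[OF zV \<eta>] llin[OF zV \<eta>] by (simp add: field_simps)
        finally show "0 \<le> 1 / real (Suc n) + s * (Q (z n) \<eta> - l \<eta>) + s\<^sup>2 * (Q \<eta> \<eta> / 2)"
          using zJ[of n] by linarith
      qed
    qed simp
    define c where "c = Q \<eta> \<eta> / 2"
    have c: "c \<ge> 0" using Q0 by (simp add: c_def)
    \<comment> \<open>The minimizing step would be \<open>- d / (2 * c)\<close>, but
      \<open>c\<close> may be 0; the denominator \<open>c + 1\<close> still makes the value negative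
      unless \<open>d = 0\<close>.\<close>
    have "0 \<le> (- d / (c + 1)) * d + (- d / (c + 1))\<^sup>2 * c"
      using var[of "- d / (c + 1)"] by (simp add: c_def)
    also have "\<dots> = - (d / (c + 1))\<^sup>2"
      using c by (simp add: power2_eq_square divide_simps) (simp add: algebra_simps)
    finally have "d / (c + 1) = 0" by simp
    then have "d = 0" using c by simp
    then show ?thesis by (simp add: d_def l_def)
  qed
  then show thesis using that[OF zV \<Phi> \<Phi>m \<Phi>2 lim] by blast
qed

section \<open>Linear structure of the function spaces\<close>

lemma Lspace_scaleR:
  assumes "f \<in> Lspace p"
  shows "(\<lambda>x. c *\<^sub>R f x) \<in> Lspace p"
proof -
  have [measurable]: "f \<in> borel_measurable torus" using assms by (simp add: Lspace_def)
  show ?thesis using assms by (auto simp: Lspace_def periodic_def powr_mult)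
qed

lemma Lspace_add:
  assumes f: "f \<in> Lspace p" and g: "g \<in> Lspace p" and p: "p \<ge> 0"
  shows "(\<lambda>x. f x + g x) \<in> Lspace p"
proof -
  have [measurable]: "f \<in> borel_measurable torus" "g \<in> borel_measurable torus" using f g by (auto simp: Lspace_def)
  have "integrable torus (\<lambda>x. 2 powr p * (norm (f x) powr p + norm (g x) powr p))"
    using f g by (simp add: Lspace_def)
  then have "integrable torus (\<lambda>x. norm (f x + g x) powr p)"
  proof (rule Bochner_Integration.integrable_bound)
    show "AE x in torus. norm (norm (f x + g x) powr p) \<le> norm (2 powr p * (norm (f x) powr p + norm (g x) powr p))"
    proof (rule AE_I2)
      fix x
      define m where "m = max (norm (f x)) (norm (g x))"
      have "norm (f x + g x) \<le> 2 * m" using norm_triangle_ineq[of "f x" "g x"] by (simp add: m_def)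
      then have "norm (f x + g x) powr p \<le> (2 * m) powr p" using p by (intro powr_mono2) auto
      also have "\<dots> = 2 powr p * m powr p" by (simp add: powr_mult m_def le_max_iff_disj)
      also have "\<dots> \<le> 2 powr p * (norm (f x) powr p + norm (g x) powr p)"
        by (intro mult_left_mono) (auto simp: m_def max_def)
      finally show "norm (norm (f x + g x) powr p) \<le> norm (2 powr p * (norm (f x) powr p + norm (g x) powr p))"
        by simp
    qed
  qed measurable
  then show ?thesis using f g by (auto simp: Lspace_def periodic_def)
qed

lemma has_weak_gradient_linear:
  assumes f: "has_weak_gradient f f'" and g: "has_weak_gradient g g'"
  shows "has_weak_gradient (\<lambda>x. a * f x + b * g x) (\<lambda>x. a *\<^sub>R f' x + b *\<^sub>R g' x)"
  unfolding has_weak_gradient_def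
proof (intro conjI ballI allI)
  have L: "f \<in> Lspace 1" "f' \<in> Lspace 1" "g \<in> Lspace 1" "g' \<in> Lspace 1"
    using f g by (auto simp: has_weak_gradient_def)
  show "(\<lambda>x. a * f x + b * g x) \<in> Lspace 1"
    using Lspace_add[OF Lspace_scaleR[OF L(1), of a] Lspace_scaleR[OF L(3), of b]] by simp
  show "(\<lambda>x. a *\<^sub>R f' x + b *\<^sub>R g' x) \<in> Lspace 1"
    by (intro Lspace_add Lspace_scaleR L) simp
  fix \<psi> i assume \<psi>: "\<psi> \<in> test_fun"
  have int: "integrable torus (\<lambda>x. h x * k x)" if h: "integrable torus h" and k: "continuous_on UNIV k" for h k :: "real^2 \<Rightarrow> real"
  proof -
    have [measurable]: "h \<in> borel_measurable torus" "k \<in> borel_measurable torus"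
      using h borel_measurable_torus[OF k] by auto
    obtain B where B: "\<And>x. x \<in> space torus \<Longrightarrow> norm (k x) \<le> B" using bounded_on_torus[OF k] by blast
    show ?thesis
    proof (rule Bochner_Integration.integrable_bound)
      show "integrable torus (\<lambda>x. B * h x)" using h by simp
      show "AE x in torus. norm (h x * k x) \<le> norm (B * h x)"
      proof (rule AE_I2)
        fix x assume "x \<in> space torus"
        then have "\<bar>k x\<bar> \<le> \<bar>B\<bar>" using B by fastforce
        then have "\<bar>k x\<bar> * \<bar>h x\<bar> \<le> \<bar>B\<bar> * \<bar>h x\<bar>" by (rule mult_right_mono) simp
        then show "norm (h x * k x) \<le> norm (B * h x)" by (simp add: abs_mult mult.commute)
      qed
    qed measurable
  qed
  note c = continuous_test_fun[OF \<psi>]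
  have i1: "integrable torus (\<lambda>x. f x * grad \<psi> x $ i)" "integrable torus (\<lambda>x. g x * grad \<psi> x $ i)"
    using L by (auto simp: Lspace_1_iff intro!: int c)
  have i2: "integrable torus (\<lambda>x. f' x $ i * \<psi> x)" "integrable torus (\<lambda>x. g' x $ i * \<psi> x)"
    using L by (auto simp: Lspace_1_iff intro!: int c integrable_vec_nth)
  have "(LINT x|torus. (a * f x + b * g x) * grad \<psi> x $ i)
      = (LINT x|torus. a * (f x * grad \<psi> x $ i) + b * (g x * grad \<psi> x $ i))" by (simp add: algebra_simps)
  also have "\<dots> = a * (LINT x|torus. f x * grad \<psi> x $ i) + b * (LINT x|torus. g x * grad \<psi> x $ i)"
    using i1 by simp
  also have "(LINT x|torus. f x * grad \<psi> x $ i) = - (LINT x|torus. f' x $ i * \<psi> x)"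
    using f \<psi> unfolding has_weak_gradient_def by blast
  also have "(LINT x|torus. g x * grad \<psi> x $ i) = - (LINT x|torus. g' x $ i * \<psi> x)"
    using g \<psi> unfolding has_weak_gradient_def by blast
  also have "a * - (LINT x|torus. f' x $ i * \<psi> x) + b * - (LINT x|torus. g' x $ i * \<psi> x)
      = - (LINT x|torus. a * (f' x $ i * \<psi> x) + b * (g' x $ i * \<psi> x))"
    using i2 by simp
  finally show "(LINT x|torus. (a * f x + b * g x) * grad \<psi> x $ i) = - (LINT x|torus. (a *\<^sub>R f' x + b *\<^sub>R g' x) $ i * \<psi> x)"
    by (simp add: algebra_simps)
qed

text \<open>The gradient of a combination is a choice of its own, so it is the combination of the
  chosen gradients only up to a null set.\<close>

lemma W1_linear:
  assumes f: "f \<in> W1 p" and g: "g \<in> W1 p" and p: "p \<ge> 0"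
  shows "(\<lambda>x. a * f x + b * g x) \<in> W1 p"
    and "AE x in torus. weak_grad (\<lambda>x. a * f x + b * g x) x = a *\<^sub>R weak_grad f x + b *\<^sub>R weak_grad g x"
proof -
  note w = has_weak_gradient_linear[OF has_weak_gradient_weak_grad[OF f] has_weak_gradient_weak_grad[OF g], of a b]
  have L: "f \<in> Lspace p" "g \<in> Lspace p" using f g by (auto simp: W1_def)
  have 1: "(\<lambda>x. a * f x + b * g x) \<in> Lspace p"
    using Lspace_add[OF Lspace_scaleR[OF L(1), of a] Lspace_scaleR[OF L(2), of b] p] by simp
  have 2: "(\<lambda>x. a *\<^sub>R weak_grad f x + b *\<^sub>R weak_grad g x) \<in> Lspace p"
    by (intro Lspace_add Lspace_scaleR weak_grad_Lspace f g p)
  show W: "(\<lambda>x. a * f x + b * g x) \<in> W1 p" unfolding W1_def using 1 2 w by blast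
  show "AE x in torus. weak_grad (\<lambda>x. a * f x + b * g x) x = a *\<^sub>R weak_grad f x + b *\<^sub>R weak_grad g x"
    by (rule weak_gradient_unique[OF has_weak_gradient_weak_grad[OF W] w])
qed

lemma E_space_linear:
  assumes f: "f \<in> E_space" and g: "g \<in> E_space"
  shows "(\<lambda>x. a * f x + b * g x) \<in> E_space"
proof -
  have L: "f \<in> Lspace 2" "g \<in> Lspace 2" using f g by (auto simp: E_space_def)
  have "(\<lambda>x. a * f x + b * g x) \<in> Lspace 2"
    using Lspace_add[OF Lspace_scaleR[OF L(1), of a] Lspace_scaleR[OF L(2), of b]] by simp
  moreover have "zero_mean (\<lambda>x. a * f x + b * g x)"
    using f g L[THEN Lspace_2_imp_integrable] by (simp add: E_space_def zero_mean_def)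
  ultimately show ?thesis by (simp add: E_space_def)
qed

lemma zero_in_Lspace: "(\<lambda>_. 0) \<in> Lspace p"
  by (simp add: Lspace_def periodic_def)

lemma zero_in_W1_E_space: "(\<lambda>_. 0) \<in> W1 p \<inter> E_space"
proof -
  have w: "has_weak_gradient (\<lambda>_. 0) (\<lambda>_. 0)" by (simp add: has_weak_gradient_def zero_in_Lspace)
  have "(\<lambda>_. 0) \<in> W1 p"
    unfolding W1_def by (intro CollectI conjI bexI[where x = "\<lambda>_. 0"] zero_in_Lspace w)
  then show ?thesis by (simp add: E_space_def zero_mean_def zero_in_Lspace)
qed

theorem theorem3p2:
  fixes \<xi> :: "real^2 \<Rightarrow> real" and \<tau> :: real
  assumes "\<xi> \<in> E_space" and "\<tau> > 0"
  shows "\<exists>\<Phi>\<in>E_space. \<forall>\<zeta>\<in>W1 4 \<inter> E_space.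
           transport \<xi> \<zeta> \<in> Lspace 2 \<and>
           L2_inner \<Phi> \<zeta> = L2_inner \<xi> \<zeta> + \<tau> * L2_inner (transport \<xi> \<zeta>) \<Phi>"
proof -
  note \<xi> = \<open>\<xi> \<in> E_space\<close>
  define V where "V = W1 4 \<inter> E_space"
  \<comment> \<open>With the transport term moved to the other side, the equation reads: the pairing
    of \<open>\<Phi>\<close> with \<open>T \<zeta>\<close> equals the pairing of
    \<open>\<xi>\<close> with \<open>\<zeta>\<close>.\<close>
  define T where "T \<zeta> x = \<zeta> x - \<tau> * transport \<xi> \<zeta> x" for \<zeta> x
  have tr: "transport \<xi> \<zeta> \<in> borel_measurable torus" "integrable torus (\<lambda>x. (norm (transport \<xi> \<zeta> x))\<^sup>2)"
    "periodic (transport \<xi> \<zeta>)" "integrable torus (transport \<xi> \<zeta>)" if "\<zeta> \<in> V" for \<zeta>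
  proof -
    have L: "transport \<xi> \<zeta> \<in> Lspace 2" by (rule transport_Lspace_2[OF \<xi>]) (use that in \<open>simp add: V_def\<close>)
    then show "transport \<xi> \<zeta> \<in> borel_measurable torus" "integrable torus (\<lambda>x. (norm (transport \<xi> \<zeta> x))\<^sup>2)"
      "periodic (transport \<xi> \<zeta>)" by (simp_all add: Lspace_numeral_iff)
    show "integrable torus (transport \<xi> \<zeta>)" using L by (rule Lspace_2_imp_integrable)
  qed
  have Vm: "\<zeta> \<in> borel_measurable torus" and V2: "integrable torus (\<lambda>x. (norm (\<zeta> x))\<^sup>2)"
    and Vp: "periodic \<zeta>" and V0: "(LINT x|torus. \<zeta> x) = 0" if "\<zeta> \<in> V" for \<zeta>
    using that by (auto simp: V_def E_space_def Lspace_numeral_iff zero_mean_def)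
  have Vi: "integrable torus \<zeta>" if "\<zeta> \<in> V" for \<zeta>
    by (rule Lspace_2_imp_integrable) (use that in \<open>simp add: V_def E_space_def\<close>)
  have Tm: "T \<zeta> \<in> borel_measurable torus" if "\<zeta> \<in> V" for \<zeta>
  proof -
    note [measurable] = Vm[OF that] tr(1)[OF that]
    show ?thesis unfolding T_def[abs_def] by measurable
  qed
  have T2: "integrable torus (\<lambda>x. (norm (T \<zeta> x))\<^sup>2)" if "\<zeta> \<in> V" for \<zeta>
    unfolding T_def by (rule L2_diff) (use Vm[OF that] V2[OF that] tr[OF that] in \<open>auto simp: power_mult_distrib abs_mult\<close>)
  have Tlin: "AE x in torus. T (\<lambda>x. a * \<zeta> x + b * \<eta> x) x = a * T \<zeta> x + b * T \<eta> x" if "\<zeta> \<in> V" "\<eta> \<in> V" for \<zeta> \<eta> a b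
  proof -
    have "AE x in torus. weak_grad (\<lambda>x. a * \<zeta> x + b * \<eta> x) x = a *\<^sub>R weak_grad \<zeta> x + b *\<^sub>R weak_grad \<eta> x"
      by (rule W1_linear(2)) (use that in \<open>auto simp: V_def\<close>)
    then show ?thesis
      by eventually_elim (simp add: T_def transport_def inner_add_right algebra_simps)
  qed
  \<comment> \<open>In the expanded square the mixed term vanishes by skew symmetry, and the square
    of the transport term only adds to the right side.\<close>
  have coercive: "(LINT x|torus. (norm (\<zeta> x))\<^sup>2) \<le> (LINT x|torus. (norm (T \<zeta> x))\<^sup>2)" if \<zeta>: "\<zeta> \<in> V" for \<zeta>
  proof -
    have i: "integrable torus (\<lambda>x. transport \<xi> \<zeta> x * \<zeta> x)"
      by (rule integrable_mult_L2[OF tr(1)[OF \<zeta>] Vm[OF \<zeta>] tr(2)[OF \<zeta>] V2[OF \<zeta>]])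
    have "(LINT x|torus. (norm (T \<zeta> x))\<^sup>2)
        = (LINT x|torus. (norm (\<zeta> x))\<^sup>2 - 2 * \<tau> * (transport \<xi> \<zeta> x * \<zeta> x) + \<tau>\<^sup>2 * (norm (transport \<xi> \<zeta> x))\<^sup>2)"
      by (simp add: T_def power2_eq_square algebra_simps)
    also have "\<dots> = (LINT x|torus. (norm (\<zeta> x))\<^sup>2) - 2 * \<tau> * (LINT x|torus. transport \<xi> \<zeta> x * \<zeta> x)
        + \<tau>\<^sup>2 * (LINT x|torus. (norm (transport \<xi> \<zeta> x))\<^sup>2)"
      using i V2[OF \<zeta>] tr(2)[OF \<zeta>] by simp
    also have "(LINT x|torus. transport \<xi> \<zeta> x * \<zeta> x) = 0"
      by (rule integral_transport_mult_eq_0[OF \<xi>]) (use \<zeta> in \<open>simp add: V_def\<close>)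
    finally show ?thesis by simp
  qed
  have Vlin: "(\<lambda>x. a * \<zeta> x + b * \<eta> x) \<in> V" if "\<zeta> \<in> V" "\<eta> \<in> V" for \<zeta> \<eta> a b
    using that by (auto simp: V_def intro: W1_linear(1) E_space_linear)
  have zero: "(\<lambda>_. 0) \<in> V" unfolding V_def by (rule zero_in_W1_E_space)
  obtain \<Phi> z r where zV: "\<And>n. z n \<in> V" and \<Phi>: "\<Phi> = (\<lambda>x. lim (\<lambda>j. T (z (r j)) x))" and \<Phi>m[measurable]: "\<Phi> \<in> borel_measurable torus"
    and \<Phi>2: "integrable torus (\<lambda>x. (norm (\<Phi> x))\<^sup>2)" and lim: "(\<lambda>n. LINT x|torus. (norm (T (z n) x - \<Phi> x))\<^sup>2) \<longlonglongrightarrow> 0"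
    and sol: "\<And>\<eta>. \<eta> \<in> V \<Longrightarrow> (LINT x|torus. \<Phi> x * T \<eta> x) = (LINT x|torus. \<xi> x * \<eta> x)"
    by (rule torus.Lions_projection[OF zero Vlin Vm V2 Tm T2 Tlin coercive E_space_measurable[OF \<xi>] E_space_L2[OF \<xi>]]) blast+
  \<comment> \<open>Equivalent points see the same sequence of values, hence the same
    \<open>lim\<close>.\<close>
  have "periodic \<Phi>"
    using Vp[OF zV] tr(3)[OF zV] unfolding \<Phi> T_def periodic_def by simp
  \<comment> \<open>The mean is a pairing with the constant 1, continuous in the mean square, and it
    vanishes on the range of \<open>T\<close>.\<close>
  moreover have "(LINT x|torus. \<Phi> x) = 0"
  proof -
    have "(\<lambda>n. LINT x|torus. T (z n) x * 1) \<longlonglongrightarrow> (LINT x|torus. \<Phi> x * 1)"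
      by (rule torus.tendsto_integral_mult_L2[OF Tm[OF zV] \<Phi>m _ T2[OF zV] \<Phi>2 _ lim]) auto
    moreover have "(LINT x|torus. T (z n) x * 1) = 0" for n
    proof -
      have "(LINT x|torus. transport \<xi> (z n) x) = 0"
        by (rule integral_transport_eq_0[OF \<xi>]) (use zV[of n] in \<open>simp add: V_def\<close>)
      then show ?thesis using Vi[OF zV] tr(4)[OF zV] V0[OF zV] by (simp add: T_def)
    qed
    ultimately show ?thesis by (simp add: LIMSEQ_const_iff)
  qed
  ultimately have "\<Phi> \<in> E_space"
    using \<Phi>m \<Phi>2 by (simp add: E_space_def Lspace_numeral_iff zero_mean_def)
  moreover have "transport \<xi> \<zeta> \<in> Lspace 2 \<and> L2_inner \<Phi> \<zeta> = L2_inner \<xi> \<zeta> + \<tau> * L2_inner (transport \<xi> \<zeta>) \<Phi>"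
    if "\<zeta> \<in> W1 4 \<inter> E_space" for \<zeta>
  proof
    have \<zeta>: "\<zeta> \<in> V" using that by (simp add: V_def)
    show "transport \<xi> \<zeta> \<in> Lspace 2" by (rule transport_Lspace_2[OF \<xi>]) (use that in simp)
    have i: "integrable torus (\<lambda>x. \<Phi> x * \<zeta> x)" "integrable torus (\<lambda>x. transport \<xi> \<zeta> x * \<Phi> x)"
      by (intro integrable_mult_L2 \<Phi>m \<Phi>2 Vm V2 tr \<zeta>)+
    have "(LINT x|torus. \<xi> x * \<zeta> x) = (LINT x|torus. \<Phi> x * \<zeta> x - \<tau> * (transport \<xi> \<zeta> x * \<Phi> x))"
      unfolding sol[OF \<zeta>, symmetric] T_def by (simp add: algebra_simps)
    also have "\<dots> = L2_inner \<Phi> \<zeta> - \<tau> * L2_inner (transport \<xi> \<zeta>) \<Phi>"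
      using i by (simp add: L2_inner_def)
    finally show "L2_inner \<Phi> \<zeta> = L2_inner \<xi> \<zeta> + \<tau> * L2_inner (transport \<xi> \<zeta>) \<Phi>"
      by (simp add: L2_inner_def)
  qed
  ultimately show ?thesis by blast
qed

end
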